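(* On the Sierpinski gasket $\mathcal{SG}$ with its canonical Laplacian, for every $0<\lambda<\lambda_1^D$ (with $\lambda_1^D$ the first Dirichlet eigenvalue) we have $$\mathcal A_\lambda=\mathcal C_\lambda=\mathcal D_{\psi^{-1}(\lambda)},\qquad \mathcal B_\lambda=\Big(\bigcup_{ij\in S_1}\mathcal L_{\psi^{-1}(\lambda),ij}\Big)\cup\{\boldsymbol\theta\},$$ and $$(\mathcal T_\lambda^i)^{-1}(\mathcal A_{5^{-1}\lambda})=\mathcal G_{\psi^{-1}(\lambda),i}\quad\text{for } i\in S.$$ In particular, there exists $\lambda_0>0$ such that $\#\mathrm{Extr}(u_\lambda)\le1$ for any $\lambda$-eigenfunction $u_\lambda$ with $0\le\lambda<\lambda_0$.
   Context: Sierpinski gasket: $S=\{1,2,3\}$, $S_1=\{23,31,12\}$; $p_1,p_2,p_3$ are the vertices of an equilateral triangle in $\mathbb R^2$, $V_0=\{p_1,p_2,p_3\}$; $F_i(x)=(x-p_i)/2+p_i$; $\mathcal{SG}$ is the unique nonempty compact set with $\mathcal{SG}=\bigcup_{i\in S}F_i\mathcal{SG}$. For $w=w_1\cdots w_m\in W_m=S^m$, $F_w=F_{w_1}\circ\cdots\circ F_{w_m}$; $V_m=\bigcup_{w\in W_m}F_wV_0$. For $p\ne q\in V_m$ write $p\sim_m q$ if $p,q\in F_wV_0$ for some $w\in W_m$, and $(\Delta_m u)(p)=\sum_{q\sim_m p}(u(q)-u(p))$. $\mathscr D$ is the set of $u\in C(\mathcal{SG})$ for which there is $f\in C(\mathcal{SG})$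 with $\lim_m\max_{p\in V_m\setminus V_0}|\tfrac32 5^m(\Delta_m u)(p)-f(p)|=0$; then $\Delta u=f$. For $u\in\mathscr D$, $\{i,j,k\}=S$, $(\mathrm du)_{p_i}=\lim_m(5/3)^m(2u(p_i)-u(F_i^mp_j)-u(F_i^mp_k))$. $E(\lambda)=\{u\in\mathscr D:-\Delta u=\lambda u\text{ on }\mathcal{SG}\setminus V_0\}$; a $\lambda$-eigenfunction is a nonzero element of $E(\lambda)$. Extreme sets: a nonempty $A\subset\mathcal{SG}$ is an extreme set of $u\in\mathscr D$ if for some $c\in\mathbb R$: $A$ is a connected component of $u^{-1}(c)$; $A\cap V_0=\emptyset$; and there is $\delta>0$ such that either $u\le c$ on the whole $\delta$-neighborhood $A_\delta$ of $A$ in $\mathcal{SG}$, or $u\ge c$ on all of $A_\delta$. $\mathrm{Extr}(u)$ is the set of extreme sets. Function $\psi$: $\varphi_{-1}(x)=\frac12(5-\sqrt{25-4x})$, $\psi(x)=\frac32\lim_{m\to\infty}5^m\varphi_{-1}^m(x)$ ($m$-fold iterate), a strictly increasing function on $(-\infty,25/4)$. The smallest $\lambda$ admitting a nonzero $u\in E(\lambda)$ with $u|_{V_0}=0$ is $\lambda_1^D=\psi(6)=5\psi(2)$. For $0<\lambda<\lambda_1^D$ the maps $\tau^D_\lambda(u)=u|_{V_0}=(u(p_1),u(p_2),u(p_3))$ and $\tau^N_\lambda(u)=((\mathrm du)_{p_1},(\mathrm du)_{p_2},(\mathrm du)_{p_3})$ are linear bijections $E(\lambda)\to\mathbb R^3$.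 Cones in $\mathbb R^3$ ($0<\lambda<\lambda_1^D$): $\mathbf A_\lambda$ is the set of $\mathbf a$ such that $(\tau^D_\lambda)^{-1}(\mathbf a)$ has at least one extreme set; $\mathbf B_\lambda$ is the set of $\mathbf a$ such that $(\tau^D_\lambda)^{-1}(\mathbf a)$ has exactly one extreme set $A$ with $A\cap V_1\ne\emptyset$; $\mathbf C_\lambda=\tau^D_\lambda\circ(\tau^N_\lambda)^{-1}(\mathbf C)$ where $\mathbf C=\{\mathbf a: \text{all } a_i>0\text{ or all }a_i<0\}$. $T^i_\lambda(\mathbf a)=\big((\tau^D_\lambda)^{-1}(\mathbf a)\circ F_i\big)|_{V_0}$, an (invertible) linear map of $\mathbb R^3$. Projective plane: $\mathbb R\mathrm P^2=\mathbb R^2\cup L_\infty$, $L_\infty$ the line at infinity, $[\boldsymbol\xi]_\infty$ the point at infinity in direction $\boldsymbol\xi$. $\pi:\mathbb R^3\setminus\{\mathbf0\}\to\mathbb R\mathrm P^2$ is $\pi(\mathbf x)=(\mathbf1^{\mathrm t}\mathbf x)^{-1}Q^{\mathrm t}\mathbf x$ if $\mathbf1^{\mathrm t}\mathbf x\ne0$ and $[Q^{\mathrm t}\mathbf x]_\infty$ otherwise, with $\mathbf1=(1,1,1)^{\mathrm t}$, $Q^{\mathrm t}=\frac12\begin{pmatrix}0&-\sqrt3&\sqrt3\\2&-1&-1\end{pmatrix}$ (two vectors have the same image iff they are nonzero multiples of each other). $\mathcal A_\lambda=\pi(\mathbf A_\lambda)$, $\mathcal B_\lambda=\pi(\mathbf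 B_\lambda)$, $\mathcal C_\lambda=\pi(\mathbf C_\lambda)$, $\mathcal T^i_\lambda=\pi\circ T^i_\lambda\circ\pi^{-1}$. $\boldsymbol\theta$ is the origin of $\mathbb R^2$. For $\alpha\in(0,6)$: $\boldsymbol\zeta_{\alpha,23}=\frac{\alpha}{6-\alpha}(0,-1)^{\mathrm t}$, $\boldsymbol\zeta_{\alpha,31}=\frac{\alpha}{2(6-\alpha)}(\sqrt3,1)^{\mathrm t}$, $\boldsymbol\zeta_{\alpha,12}=\frac{\alpha}{2(6-\alpha)}(-\sqrt3,1)^{\mathrm t}$ (index order irrelevant); $\mathcal D_\alpha=\{(\xi^{(1)},\xi^{(2)})^{\mathrm t}\in\mathbb R^2:\frac{\alpha}{2(6-\alpha)}>\xi^{(2)}>\sqrt3|\xi^{(1)}|-\frac{\alpha}{6-\alpha}\}$ is the open triangle with these vertices; $\mathcal L_{\alpha,ij}$ is the open segment joining $\boldsymbol\theta$ and $\boldsymbol\zeta_{\alpha,ij}$; $\mathcal G_{\alpha,i}$ is the open triangle with vertices $\boldsymbol\theta,\boldsymbol\zeta_{\alpha,ki},\boldsymbol\zeta_{\alpha,ij}$, $\{i,j,k\}=S$. *)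

theory Defs
  imports "HOL-Analysis.Analysis"
begin

section \<open>The Sierpinski gasket\<close>

text \<open>The index set \<open>S = {1, 2, 3}\<close> is the numeral type \<^typ>\<open>3\<close>, and \<open>p i\<close> are the vertices.
  Everything below is parametrised by the vertices, so the triangle may have any position and size.\<close>

definition equilateral :: "(3 \<Rightarrow> real^2) \<Rightarrow> bool" where
  "equilateral p \<longleftrightarrow> (\<exists>s>0. \<forall>i j. i \<noteq> j \<longrightarrow> dist (p i) (p j) = s)"

definition sgF :: "(3 \<Rightarrow> real^2) \<Rightarrow> 3 \<Rightarrow> real^2 \<Rightarrow> real^2" where
  "sgF p i x = (1/2) *\<^sub>R (x - p i) + p i"

definition SG :: "(3 \<Rightarrow> real^2) \<Rightarrow> (real^2) set" where
  "SG p = (THE K. K \<noteq> {} \<and> compact K \<and> K = (\<Union>i. sgF p i ` K))"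

definition words :: "nat \<Rightarrow> 3 list set" where
  "words m = {w. length w = m}"

text \<open>\<open>foldr (sgF p) [w\<^sub>1, \<dots>, w\<^sub>m]\<close> is the composition \<open>F\<^sub>w\<^sub>1 \<circ> \<dots> \<circ> F\<^sub>w\<^sub>m\<close>.\<close>

definition sgFw :: "(3 \<Rightarrow> real^2) \<Rightarrow> 3 list \<Rightarrow> real^2 \<Rightarrow> real^2" where
  "sgFw p w = foldr (sgF p) w"

definition V0 :: "(3 \<Rightarrow> real^2) \<Rightarrow> (real^2) set" where
  "V0 p = range p"

definition Vm :: "(3 \<Rightarrow> real^2) \<Rightarrow> nat \<Rightarrow> (real^2) set" where
  "Vm p m = (\<Union>w\<in>words m. sgFw p w ` V0 p)"

definition nbr :: "(3 \<Rightarrow> real^2) \<Rightarrow> nat \<Rightarrow> real^2 \<Rightarrow> real^2 \<Rightarrow> bool" where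
  "nbr p m x y \<longleftrightarrow> x \<noteq> y \<and> (\<exists>w\<in>words m. x \<in> sgFw p w ` V0 p \<and> y \<in> sgFw p w ` V0 p)"

definition graph_lap :: "(3 \<Rightarrow> real^2) \<Rightarrow> nat \<Rightarrow> (real^2 \<Rightarrow> real) \<Rightarrow> real^2 \<Rightarrow> real" where
  "graph_lap p m u x = (\<Sum>y | nbr p m x y. u y - u x)"


section \<open>The Laplacian, normal derivatives and eigenfunctions\<close>

text \<open>A function on the gasket is represented by a total function which is \<open>extensional\<close>
  (equal to \<^const>\<open>undefined\<close> off \<open>SG p\<close>), so that functions which agree on the gasket are equal
  and \<open>eigenspace\<close> below really is in bijection with a space of functions on the gasket.\<close>

definition C_SG :: "(3 \<Rightarrow> real^2) \<Rightarrow> (real^2 \<Rightarrow> real) set" where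
  "C_SG p = {u \<in> extensional (SG p). continuous_on (SG p) u}"

definition has_laplacian ::
    "(3 \<Rightarrow> real^2) \<Rightarrow> (real^2 \<Rightarrow> real) \<Rightarrow> (real^2 \<Rightarrow> real) \<Rightarrow> bool" where
  "has_laplacian p u f \<longleftrightarrow> u \<in> C_SG p \<and> f \<in> C_SG p \<and>
     (\<lambda>m. Max ((\<lambda>x. \<bar>3/2 * 5^m * graph_lap p m u x - f x\<bar>) ` (Vm p m - V0 p))) \<longlonglongrightarrow> 0"

definition dom_lap :: "(3 \<Rightarrow> real^2) \<Rightarrow> (real^2 \<Rightarrow> real) set" where
  "dom_lap p = {u. \<exists>f. has_laplacian p u f}"

definition laplacian :: "(3 \<Rightarrow> real^2) \<Rightarrow> (real^2 \<Rightarrow> real) \<Rightarrow> real^2 \<Rightarrow> real" where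
  "laplacian p u = (THE f. has_laplacian p u f)"

definition normal_deriv :: "(3 \<Rightarrow> real^2) \<Rightarrow> (real^2 \<Rightarrow> real) \<Rightarrow> 3 \<Rightarrow> real" where
  "normal_deriv p u i =
     lim (\<lambda>m. (5/3)^m * (2 * u (p i) - (\<Sum>j\<in>-{i}. u ((sgF p i ^^ m) (p j)))))"

definition eigenspace :: "(3 \<Rightarrow> real^2) \<Rightarrow> real \<Rightarrow> (real^2 \<Rightarrow> real) set" where
  "eigenspace p l = {u \<in> dom_lap p. \<forall>x \<in> SG p - V0 p. - laplacian p u x = l * u x}"

definition eigenfunction :: "(3 \<Rightarrow> real^2) \<Rightarrow> real \<Rightarrow> (real^2 \<Rightarrow> real) \<Rightarrow> bool" where
  "eigenfunction p l u \<longleftrightarrow> u \<in> eigenspace p l \<and> (\<exists>x\<in>SG p. u x \<noteq> 0)"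

definition lambda1D :: "(3 \<Rightarrow> real^2) \<Rightarrow> real" where
  "lambda1D p = (LEAST l. \<exists>u. eigenfunction p l u \<and> (\<forall>x\<in>V0 p. u x = 0))"


section \<open>Extreme sets\<close>

definition sg_nhd :: "(3 \<Rightarrow> real^2) \<Rightarrow> real \<Rightarrow> (real^2) set \<Rightarrow> (real^2) set" where
  "sg_nhd p d A = {x \<in> SG p. \<exists>a\<in>A. dist x a < d}"

definition Extr :: "(3 \<Rightarrow> real^2) \<Rightarrow> (real^2 \<Rightarrow> real) \<Rightarrow> (real^2) set set" where
  "Extr p u = {A. \<exists>c. A \<in> components {x \<in> SG p. u x = c} \<and> A \<inter> V0 p = {} \<and>
     (\<exists>d>0. (\<forall>x \<in> sg_nhd p d A. u x \<le> c) \<or> (\<forall>x \<in> sg_nhd p d A. u x \<ge> c))}"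


section \<open>The function psi\<close>

definition phi_m1 :: "real \<Rightarrow> real" where
  "phi_m1 x = 1/2 * (5 - sqrt (25 - 4 * x))"

definition psi :: "real \<Rightarrow> real" where
  "psi x = 3/2 * lim (\<lambda>m. 5^m * (phi_m1 ^^ m) x)"

definition psi_inv :: "real \<Rightarrow> real" where
  "psi_inv = inv_into {..<25/4} psi"


section \<open>Cones in three-space\<close>

definition tauD :: "(3 \<Rightarrow> real^2) \<Rightarrow> (real^2 \<Rightarrow> real) \<Rightarrow> real^3" where
  "tauD p u = (\<chi> i. u (p i))"

definition tauN :: "(3 \<Rightarrow> real^2) \<Rightarrow> (real^2 \<Rightarrow> real) \<Rightarrow> real^3" where
  "tauN p u = (\<chi> i. normal_deriv p u i)"

definition tauD_inv :: "(3 \<Rightarrow> real^2) \<Rightarrow> real \<Rightarrow> real^3 \<Rightarrow> real^2 \<Rightarrow> real" where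
  "tauD_inv p l = inv_into (eigenspace p l) (tauD p)"

definition tauN_inv :: "(3 \<Rightarrow> real^2) \<Rightarrow> real \<Rightarrow> real^3 \<Rightarrow> real^2 \<Rightarrow> real" where
  "tauN_inv p l = inv_into (eigenspace p l) (tauN p)"

definition coneA :: "(3 \<Rightarrow> real^2) \<Rightarrow> real \<Rightarrow> (real^3) set" where
  "coneA p l = {a. Extr p (tauD_inv p l a) \<noteq> {}}"

definition coneB :: "(3 \<Rightarrow> real^2) \<Rightarrow> real \<Rightarrow> (real^3) set" where
  "coneB p l = {a. \<exists>!A. A \<in> Extr p (tauD_inv p l a) \<and> A \<inter> Vm p 1 \<noteq> {}}"

definition coneC0 :: "(real^3) set" where
  "coneC0 = {a. (\<forall>i. a $ i > 0) \<or> (\<forall>i. a $ i < 0)}"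

definition coneC :: "(3 \<Rightarrow> real^2) \<Rightarrow> real \<Rightarrow> (real^3) set" where
  "coneC p l = (tauD p \<circ> tauN_inv p l) ` coneC0"

definition mapT :: "(3 \<Rightarrow> real^2) \<Rightarrow> real \<Rightarrow> 3 \<Rightarrow> real^3 \<Rightarrow> real^3" where
  "mapT p l i a = tauD p (tauD_inv p l a \<circ> sgF p i)"


section \<open>The projective plane\<close>

definition parallel :: "real^2 \<Rightarrow> real^2 \<Rightarrow> bool" where
  "parallel x y \<longleftrightarrow> x \<noteq> 0 \<and> y \<noteq> 0 \<and> (\<exists>c. x = c *\<^sub>R y)"

text \<open>Directions (nonzero vectors up to nonzero multiples) are the points of the line at infinity.\<close>

quotient_type direction = "real^2" / partial: parallel
proof (rule part_equivpI)
  have "parallel (axis 1 1) (axis 1 1)"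
    unfolding parallel_def by (auto simp: axis_eq_0_iff intro: exI[of _ 1])
  then show "\<exists>x. parallel x x" by blast
  show "symp parallel"
  proof (rule sympI)
    fix x y assume "parallel x y"
    then obtain c where c: "x \<noteq> 0" "y \<noteq> 0" "x = c *\<^sub>R y" unfolding parallel_def by blast
    then have "y = (1/c) *\<^sub>R x" by auto
    with c show "parallel y x" unfolding parallel_def by blast
  qed
  show "transp parallel"
    by (rule transpI) (auto simp: parallel_def)
qed

datatype proj_plane = Affine "real^2" | At_infinity direction

text \<open>The \<open>i\<close>-th column of the matrix \<open>Q\<^sup>t\<close>.\<close>

definition Qcol :: "3 \<Rightarrow> real^2" where
  "Qcol i = (1/2) *\<^sub>R (if i = 1 then vector [0, 2]
                      else if i = 2 then vector [- sqrt 3, -1]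
                      else vector [sqrt 3, -1])"

definition Qt :: "real^3^2" where
  "Qt = (\<chi> r i. Qcol i $ r)"

text \<open>Only meaningful at nonzero vectors; on these with coordinate sum 0, \<open>Qt *v x\<close> is nonzero.\<close>

definition proj :: "real^3 \<Rightarrow> proj_plane" where
  "proj x = (if (\<Sum>i\<in>UNIV. x $ i) \<noteq> 0
             then Affine (inverse (\<Sum>i\<in>UNIV. x $ i) *\<^sub>R (Qt *v x))
             else At_infinity (abs_direction (Qt *v x)))"

definition calA :: "(3 \<Rightarrow> real^2) \<Rightarrow> real \<Rightarrow> proj_plane set" where
  "calA p l = proj ` coneA p l"

definition calB :: "(3 \<Rightarrow> real^2) \<Rightarrow> real \<Rightarrow> proj_plane set" where
  "calB p l = proj ` coneB p l"

definition calC :: "(3 \<Rightarrow> real^2) \<Rightarrow> real \<Rightarrow> proj_plane set" where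
  "calC p l = proj ` coneC p l"

text \<open>\<open>inv_into\<close> picks a representative of the projective point; since \<open>mapT\<close> is linear and
  invertible for \<open>0 < l < lambda1D p\<close>, the result does not depend on the choice.\<close>

definition calT :: "(3 \<Rightarrow> real^2) \<Rightarrow> real \<Rightarrow> 3 \<Rightarrow> proj_plane \<Rightarrow> proj_plane" where
  "calT p l i = proj \<circ> mapT p l i \<circ> inv_into (- {0}) proj"


section \<open>The polygonal regions\<close>

definition S1 :: "(3 \<times> 3) set" where
  "S1 = {(2, 3), (3, 1), (1, 2)}"

text \<open>Used only for \<open>i \<noteq> j\<close>; symmetric in \<open>i\<close> and \<open>j\<close>.\<close>

definition zeta :: "real \<Rightarrow> 3 \<Rightarrow> 3 \<Rightarrow> real^2" where
  "zeta \<alpha> i j =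
     (if {i, j} = {2, 3} then (\<alpha> / (6 - \<alpha>)) *\<^sub>R vector [0, -1]
      else if {i, j} = {3, 1} then (\<alpha> / (2 * (6 - \<alpha>))) *\<^sub>R vector [sqrt 3, 1]
      else (\<alpha> / (2 * (6 - \<alpha>))) *\<^sub>R vector [- sqrt 3, 1])"

definition calD :: "real \<Rightarrow> (real^2) set" where
  "calD \<alpha> = {\<xi>. \<alpha> / (2 * (6 - \<alpha>)) > \<xi> $ 2 \<and> \<xi> $ 2 > sqrt 3 * \<bar>\<xi> $ 1\<bar> - \<alpha> / (6 - \<alpha>)}"

definition calL :: "real \<Rightarrow> 3 \<Rightarrow> 3 \<Rightarrow> (real^2) set" where
  "calL \<alpha> i j = open_segment 0 (zeta \<alpha> i j)"

definition calG :: "real \<Rightarrow> 3 \<Rightarrow> (real^2) set" where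
  "calG \<alpha> i = interior (convex hull (insert 0 (zeta \<alpha> i ` (- {i}))))"

end

(* Spectral decimation makes an eigenfunction u of eigenvalue psi(alpha), 0 <= alpha < 6, explicit:
   with boundary values a it restricts on the cell i to the eigenfunction with parameter
   phi_m1(alpha) and boundary values tstep (phi_m1 alpha) i a, and its normal derivative at p_i is
   a positive multiple of the linear form flux alpha a i = (6 - alpha)/2 * a_i - (a_1 + a_2 + a_3).
   The identity behind everything is that the flux of the cell i at its corner F_i(p_j) is a
   positive multiple of a_j - a_i.

   - If all fluxes are negative, then no vertex is a maximum point, so the maximum is attained on an
     extreme set.  If some flux is nonnegative, then this property passes to every cell, and
     u <= max a follows.
   - Conversely let A be an extreme set on which u has a local maximum.  If A contains F_i(p_j), then
     both fluxes there vanish, hence a_i = a_j >= a_k, and comparing values near the junction makes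
     all fluxes negative.  Otherwise A lies inside one cell i; if all fluxes of that cell are
     negative, then so are those of u, and a_i is the strict maximum of a.  Iterating, A meets some
     V_m or is contained in a cell on which its value is the global maximum.
   - The strict maximum of a determines the cell containing an extreme set that misses V_1.  Hence
     two different extreme sets would lie in the same nested sequence of cells.

   Uniqueness of eigenfunctions with given boundary values is a maximum principle for u / v, where v
   is the (positive) eigenfunction with boundary values 1 and a slightly larger eigenvalue. *)

theory Submission
  imports Defs
begin

section \<open>The gasket and barycentric coordinates\<close>

text \<open>The step formula solves the graph eigenvalue equation at the three junctions: each
  junction value times 5 - b is the sum of its two corner values and of all three junction values,
  and the latter three add up to 2 * \<open>csum a\<close> / (2 - b). The pole b = 2 corresponds to
  \<alpha> = 6, and \<open>psi 6\<close> is the first Dirichlet eigenvalue. The form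
  \<open>flux\<close> is 2 a_i - a_j - a_k minus half of \<alpha> a_i: a junction is shared by two
  cells, each takes half of the eigenvalue term, and the equation there says that the two fluxes
  cancel. For fixed \<open>csum a\<close> the flux increases with a_i, so its sign is decided at the
  largest corner value. Passing to a cell replaces (\<alpha>, a) by a pair of the same kind, hence
  nearly every induction generalises over both. The obstacle is that an extreme set may miss every
  V_m, where no induction on the level reaches it. Scale arguments take over: at each zoom the
  radius of the neighbourhood doubles until it exceeds the diameter, and the distance between two
  candidates doubles although it is bounded by the diameter.\<close>

lemma sgF_eq: "sgF p i x = (1/2) *\<^sub>R (x + p i)"
  by (simp add: sgF_def algebra_simps flip: scaleR_add_left)

lemma dist_sgF: "dist (sgF p i x) (sgF p i y) = dist x y / 2"
proof -
  have "sgF p i x - sgF p i y = (1/2) *\<^sub>R (x - y)"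
    by (simp add: sgF_def algebra_simps)
  then show ?thesis by (simp add: dist_norm)
qed

lemma inj_sgF: "inj (sgF p i)"
  by (rule injI) (simp add: sgF_def)

lemma sgF_inject [simp]: "sgF p i x = sgF p i y \<longleftrightarrow> x = y"
  using inj_sgF by (auto dest: injD)

lemma sgF_fixed [simp]: "sgF p i (p i) = p i"
  by (simp add: sgF_def)

lemma continuous_on_sgF [continuous_intros]:
  "continuous_on S g \<Longrightarrow> continuous_on S (\<lambda>x. sgF p i (g x))"
  unfolding sgF_def by (intro continuous_intros)

lemma sgF_commute: "sgF p i (p j) = sgF p j (p i)"
  by (simp add: sgF_eq add.commute)

section \<open>The gasket as the unique fixed point of the Hutchinson operator
  \<open>sgH\<close>\<close>

definition sgH :: "(3 \<Rightarrow> real^2) \<Rightarrow> (real^2) set \<Rightarrow> (real^2) set" where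
  "sgH p X = (\<Union>i. sgF p i ` X)"

lemma compact_sgH: "compact X \<Longrightarrow> compact (sgH p X)"
  unfolding sgH_def
  by (intro compact_UN finite) (auto intro!: compact_continuous_image continuous_intros)

text \<open>The distance to \<open>L\<close> attains its maximum over \<open>K\<close> at some F_i
  y; F_i maps the point of \<open>L\<close> nearest to y into \<open>L\<close>, so this maximum is
  at most half of itself and vanishes. The other inclusion follows by exchanging the roles.\<close>

lemma sgH_unique:
  assumes "K \<noteq> {}" "compact K" "K = sgH p K" "L \<noteq> {}" "compact L" "L = sgH p L"
  shows "K \<subseteq> L"
proof -
  have cont: "continuous_on K (\<lambda>x. infdist x L)"
    by (intro continuous_intros)
  obtain x where x: "x \<in> K" "\<And>y. y \<in> K \<Longrightarrow> infdist y L \<le> infdist x L"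
    using continuous_attains_sup[OF assms(2,1) cont] by blast
  obtain i y where y: "y \<in> K" "x = sgF p i y"
    using x(1) assms(3) unfolding sgH_def by blast
  obtain z where z: "z \<in> L" "infdist y L = dist y z"
    using infdist_attains_inf[OF compact_imp_closed[OF assms(5)] assms(4)] by metis
  have "sgF p i z \<in> L"
    using z(1) assms(6) unfolding sgH_def by blast
  then have "infdist x L \<le> dist x (sgF p i z)"
    by (rule infdist_le)
  also have "\<dots> = infdist y L / 2"
    using y z by (simp add: dist_sgF)
  also have "\<dots> \<le> infdist x L / 2"
    using x(2)[OF y(1)] by simp
  finally have "infdist x L = 0"
    using infdist_nonneg[of x L] by linarith
  then have "infdist w L = 0" if "w \<in> K" for w
    using x(2)[OF that] infdist_nonneg[of w L] by linarith
  then show ?thesis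
    using in_closed_iff_infdist_zero[OF compact_imp_closed[OF assms(5)] assms(4)] by blast
qed

text \<open>The fixed point is the intersection of the decreasing iterates of \<open>sgH\<close> on
  the convex hull of the vertices. Starting from the hull also bounds the gasket by it, which makes
  barycentric coordinates nonnegative there.\<close>

lemma sgH_ex:
  "\<exists>K. K \<noteq> {} \<and> compact K \<and> K = sgH p K \<and> K \<subseteq> convex hull range p \<and> range p \<subseteq> K"
proof -
  define T where "T = convex hull range p"
  define C where "C n = (sgH p ^^ n) T" for n
  define K where "K = (\<Inter>n. C n)"
  have C0: "C 0 = T" and CS: "C (Suc n) = sgH p (C n)" for n
    by (simp_all add: C_def)
  have mono: "X \<subseteq> Y \<Longrightarrow> sgH p X \<subseteq> sgH p Y" for X Y
    unfolding sgH_def by blast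
  have "compact T"
    unfolding T_def by (intro finite_imp_compact_convex_hull) auto
  then have comp: "compact (C n)" for n
    by (induction n) (auto simp: C0 CS compact_sgH)
  have pT: "range p \<subseteq> T"
    unfolding T_def by (rule hull_subset)
  have pC: "range p \<subseteq> C n" for n
  proof (induction n)
    case 0
    then show ?case using pT C0 by simp
  next
    case (Suc n)
    have "p i \<in> sgF p i ` C n" for i
      using Suc by (intro image_eqI[where x = "p i"]) auto
    then show ?case
      unfolding CS sgH_def by blast
  qed
  have "convex T" unfolding T_def by simp
  then have HT: "sgH p T \<subseteq> T"
    using pT unfolding sgH_def sgF_eq
    by (auto simp: scaleR_add_right intro!: convexD[of T])
  have dec1: "C (Suc n) \<subseteq> C n" for n
    by (induction n) (use HT mono in \<open>auto simp: C0 CS\<close>)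
  have dec: "m \<le> n \<Longrightarrow> C n \<subseteq> C m" for m n
    using lift_Suc_antimono_le[of C, OF dec1] by blast
  have "K = sgH p K"
  proof
    show "sgH p K \<subseteq> K"
    proof
      fix x assume "x \<in> sgH p K"
      then have "x \<in> C (Suc n)" for n
        unfolding CS using mono[of K "C n"] K_def by blast
      then show "x \<in> K"
        unfolding K_def using dec1 by blast
    qed
    show "K \<subseteq> sgH p K"
    proof
      fix x assume x: "x \<in> K"
      \<comment> \<open>One index must serve all levels. If each of the three failed at some level,
        all would fail at the largest of these levels, because the \<open>C n\<close>
        decrease.\<close>
      have "\<exists>i. \<forall>n. x \<in> sgF p i ` C n"
      proof (rule ccontr)
        assume "\<not> ?thesis"
        then have "\<forall>i. \<exists>n. x \<notin> sgF p i ` C n" by blast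
        then obtain N where N: "\<And>i. x \<notin> sgF p i ` C (N i)" by metis
        define M where "M = Max (range N)"
        have "N i \<le> M" for i unfolding M_def by (rule Max_ge) auto
        then have "x \<notin> sgF p i ` C M" for i
          using N[of i] dec[of "N i" M] by blast
        then have "x \<notin> C (Suc M)" unfolding CS sgH_def by blast
        then show False using x unfolding K_def by blast
      qed
      then obtain i where i: "\<And>n. x \<in> sgF p i ` C n" by blast
      then obtain y where y: "x = sgF p i y" by blast
      then have "y \<in> C n" for n using i[of n] by auto
      then show "x \<in> sgH p K" unfolding sgH_def K_def y by blast
    qed
  qed
  moreover have "range p \<subseteq> K" using pC unfolding K_def by blast
  moreover have "compact K" unfolding K_def using comp by (intro compact_Inter) auto
  moreover have "K \<subseteq> T" unfolding K_def C0[symmetric] by blast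
  ultimately show ?thesis unfolding T_def by (intro exI[of _ K]) auto
qed

lemma SG_props:
  shows SG_compact: "compact (SG p)" and SG_fix: "SG p = sgH p (SG p)"
    and SG_hull: "SG p \<subseteq> convex hull range p" and SG_vertex: "p i \<in> SG p"
proof -
  obtain K where K: "K \<noteq> {}" "compact K" "K = sgH p K"
    "K \<subseteq> convex hull range p" "range p \<subseteq> K"
    using sgH_ex[of p] by blast
  have "SG p = K"
    unfolding SG_def
  proof (rule the_equality)
    show "K \<noteq> {} \<and> compact K \<and> K = (\<Union>i. sgF p i ` K)"
      using K unfolding sgH_def by simp
    fix L assume "L \<noteq> {} \<and> compact L \<and> L = (\<Union>i. sgF p i ` L)"
    then have L: "L \<noteq> {}" "compact L" "L = sgH p L"
      unfolding sgH_def by auto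
    then show "L = K"
      using sgH_unique[OF K(1-3) L] sgH_unique[OF L K(1-3)] by (rule_tac equalityI)
  qed
  with K show "compact (SG p)" "SG p = sgH p (SG p)" "SG p \<subseteq> convex hull range p" "p i \<in> SG p"
    by (simp_all only:) blast
qed

lemma sgF_in_SG [intro, simp]: "x \<in> SG p \<Longrightarrow> sgF p i x \<in> SG p"
  using SG_fix[of p] unfolding sgH_def by blast

lemma SG_cases:
  assumes "x \<in> SG p"
  obtains i y where "y \<in> SG p" "x = sgF p i y"
  using assms SG_fix[of p] unfolding sgH_def by blast

declare SG_vertex [simp, intro]

section \<open>Barycentric coordinates and the intersection of cells\<close>

definition barycenter :: "(3 \<Rightarrow> real^2) \<Rightarrow> real^2" where
  "barycenter p = (1/3) *\<^sub>R (\<Sum>i\<in>UNIV. p i)"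

text \<open>For side length s and centroid g the inner products of p_i - g and p_j - g are s^2/3 for
  i = j and - s^2/6 otherwise; the constants 1/3 and 2/s^2 turn these into 1 and 0.\<close>

definition bary :: "(3 \<Rightarrow> real^2) \<Rightarrow> 3 \<Rightarrow> real^2 \<Rightarrow> real" where
  "bary p i x = 1/3 + 2 / (dist (p 1) (p 2))\<^sup>2 * ((x - barycenter p) \<bullet> (p i - barycenter p))"

lemma bary_affine:
  "u + v = 1 \<Longrightarrow> bary p i (u *\<^sub>R x + v *\<^sub>R y) = u * bary p i x + v * bary p i y"
proof -
  assume "u + v = 1"
  then have v: "v = 1 - u" by simp
  have "u *\<^sub>R x + v *\<^sub>R y - barycenter p = u *\<^sub>R (x - barycenter p) + v *\<^sub>R (y - barycenter p)"
    unfolding v by (simp add: algebra_simps)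
  then have e: "(u *\<^sub>R x + v *\<^sub>R y - barycenter p) \<bullet> d =
      u * ((x - barycenter p) \<bullet> d) + v * ((y - barycenter p) \<bullet> d)" for d
    by (simp only: inner_add_left inner_scaleR_left)
  have "1/3 + c * (u * X + v * Y) = u * (1/3 + c * X) + v * (1/3 + c * Y)" for c X Y :: real
    unfolding v by (simp add: field_simps)
  then show ?thesis
    unfolding bary_def e .
qed

lemma continuous_on_bary [continuous_intros]:
  "continuous_on S g \<Longrightarrow> continuous_on S (\<lambda>x. bary p i (g x))"
  unfolding bary_def by (intro continuous_intros)

locale gasket =
  fixes p :: "3 \<Rightarrow> real^2"
  assumes equilateral: "equilateral p"
begin

lemma bary_vertex: "bary p i (p j) = (if i = j then 1 else 0)"
proof -
  obtain s where s: "s > 0" "\<And>i j. i \<noteq> j \<Longrightarrow> dist (p i) (p j) = s"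
    using equilateral unfolding equilateral_def by blast
  define G where "G i j = p i \<bullet> p j" for i j
  have sym: "G i j = G j i" for i j by (simp add: G_def inner_commute)
  have eq: "s\<^sup>2 = G i i + G j j - 2 * G i j" if "i \<noteq> j" for i j
  proof -
    have "(p i - p j) \<bullet> (p i - p j) = s\<^sup>2"
      using s(2)[OF that] by (simp add: dist_norm flip: power2_norm_eq_inner)
    then show ?thesis by (simp add: G_def inner_simps inner_commute)
  qed
  \<comment> \<open>Polarisation: the mixed products are expressed by the squared norms and s, so
    the position of the triangle drops out of the final comparison.\<close>
  have e12: "G 1 2 = (G 1 1 + G 2 2 - s\<^sup>2) / 2" and e13: "G 1 3 = (G 1 1 + G 3 3 - s\<^sup>2) / 2"
    and e23: "G 2 3 = (G 2 2 + G 3 3 - s\<^sup>2) / 2"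
    using eq[of 1 2] eq[of 1 3] eq[of 2 3] by simp_all
  note e = e12 e13 e23 trans[OF sym[of 2 1] e12] trans[OF sym[of 3 1] e13] trans[OF sym[of 3 2] e23]
  define H where "H i = G i 1 + G i 2 + G i 3" for i
  have b: "p i \<bullet> barycenter p = H i / 3" for i
    by (simp add: barycenter_def sum_3 inner_simps H_def G_def)
  have bb: "barycenter p \<bullet> barycenter p = (H 1 + H 2 + H 3) / 9"
    by (subst (1) barycenter_def) (simp add: sum_3 inner_simps b)
  have "(p j - barycenter p) \<bullet> (p i - barycenter p) = G j i - H j / 3 - H i / 3 + (H 1 + H 2 + H 3) / 9"
    unfolding inner_diff_left inner_diff_right bb b inner_commute[of "barycenter p" "p i"]
    by (simp add: G_def)
  also have "\<dots> = (if i = j then s\<^sup>2 / 3 else - s\<^sup>2 / 6)"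
    using exhaust_3[of i] exhaust_3[of j] unfolding H_def
    by (elim disjE; simp only: e) (simp_all add: field_simps)
  finally have "(p j - barycenter p) \<bullet> (p i - barycenter p) = (if i = j then s\<^sup>2 / 3 else - s\<^sup>2 / 6)" .
  then show ?thesis
    using s by (simp add: bary_def)
qed

lemma p_eq_iff [simp]: "p i = p j \<longleftrightarrow> i = j"
  using bary_vertex[of i j] bary_vertex[of i i] by (auto split: if_splits)

lemma bary_sgF: "bary p j (sgF p i x) = (bary p j x + (if i = j then 1 else 0)) / 2"
  using bary_affine[of "1/2" "1/2" p j x "p i"] bary_vertex[of j i]
  by (auto simp: sgF_eq scaleR_add_right field_simps)

lemma hull_bary:
  assumes "x \<in> convex hull range p"
  shows "bary p i x \<ge> 0" "x = (\<Sum>i\<in>UNIV. bary p i x *\<^sub>R p i)" "(\<Sum>i\<in>UNIV. bary p i x) = 1"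
proof -
  let ?T = "{x. (\<forall>i. bary p i x \<ge> 0) \<and> x = (\<Sum>i\<in>UNIV. bary p i x *\<^sub>R p i) \<and> (\<Sum>i\<in>UNIV. bary p i x) = 1}"
  have "convex ?T"
  proof (rule convexI)
    fix x y and u v :: real
    assume a: "x \<in> ?T" "y \<in> ?T" "0 \<le> u" "0 \<le> v" "u + v = 1"
    have b: "bary p i (u *\<^sub>R x + v *\<^sub>R y) = u * bary p i x + v * bary p i y" for i
      by (rule bary_affine[OF a(5)])
    have "u *\<^sub>R x + v *\<^sub>R y =
      u *\<^sub>R (\<Sum>i\<in>UNIV. bary p i x *\<^sub>R p i) + v *\<^sub>R (\<Sum>i\<in>UNIV. bary p i y *\<^sub>R p i)"
      using a by simp
    also have "\<dots> = (\<Sum>i\<in>UNIV. (u * bary p i x + v * bary p i y) *\<^sub>R p i)"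
      by (simp add: scaleR_sum_right sum.distrib scaleR_add_left)
    finally have "u *\<^sub>R x + v *\<^sub>R y = (\<Sum>i\<in>UNIV. bary p i (u *\<^sub>R x + v *\<^sub>R y) *\<^sub>R p i)"
      unfolding b .
    moreover have "(\<Sum>i\<in>UNIV. bary p i (u *\<^sub>R x + v *\<^sub>R y)) = 1"
      using a by (simp add: b sum.distrib flip: sum_distrib_left)
    moreover have "bary p i (u *\<^sub>R x + v *\<^sub>R y) \<ge> 0" for i
      using a by (simp add: b)
    ultimately show "u *\<^sub>R x + v *\<^sub>R y \<in> ?T"
      by blast
  qed
  moreover have "range p \<subseteq> ?T"
    by (auto simp: bary_vertex if_distrib[of "\<lambda>c. c *\<^sub>R _"] cong: if_cong)
  ultimately have "x \<in> ?T" using assms hull_minimal[of "range p" ?T convex] by blast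
  then show "bary p i x \<ge> 0" "x = (\<Sum>i\<in>UNIV. bary p i x *\<^sub>R p i)" "(\<Sum>i\<in>UNIV. bary p i x) = 1"
    by auto
qed

lemma SG_bary:
  assumes "x \<in> SG p"
  shows "bary p i x \<ge> 0" "x = (\<Sum>i\<in>UNIV. bary p i x *\<^sub>R p i)" "(\<Sum>i\<in>UNIV. bary p i x) = 1"
  using hull_bary assms SG_hull by blast+

lemma bary_le_1:
  assumes "x \<in> SG p"
  shows "bary p i x \<le> 1"
proof -
  have "bary p i x \<le> (\<Sum>i\<in>UNIV. bary p i x)"
    by (intro member_le_sum) (auto simp: SG_bary assms)
  then show ?thesis using SG_bary(3)[OF assms] by simp
qed

lemma bary_1_vertex:
  assumes "x \<in> SG p" "bary p i x = 1"
  shows "x = p i"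
proof -
  have "(\<Sum>j\<in>UNIV - {i}. bary p j x) = 0"
    using SG_bary(3)[OF assms(1)] assms(2) by (simp add: sum.remove[of UNIV i])
  then have 0: "bary p j x = 0" if "j \<noteq> i" for j
    using that by (subst (asm) sum_nonneg_eq_0_iff) (auto simp: SG_bary assms)
  have "x = (\<Sum>j\<in>UNIV. bary p j x *\<^sub>R p j)"
    by (rule SG_bary(2)[OF assms(1)])
  also have "\<dots> = (\<Sum>j\<in>UNIV. if j = i then p i else 0)"
    by (rule sum.cong) (auto simp: 0 assms)
  finally show ?thesis by simp
qed

lemma cell_vertex:
  assumes "y \<in> SG p" "sgF p i y = p j"
  shows "i = j" "y = p j"
proof -
  have "bary p j (sgF p i y) = 1"
    using assms bary_vertex[of j j] by simp
  then have "bary p j y + (if i = j then 1 else 0) = 2"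
    by (simp add: bary_sgF)
  then show "i = j" using bary_le_1[OF assms(1), of j] by (auto split: if_splits)
  then show "y = p j"
    using assms by (metis sgF_fixed sgF_inject)
qed

text \<open>In the cell i the i-th coordinate is at least 1/2, and in the cell j it is at most 1/2;
  the same holds with i and j exchanged. At a common point both bounds are attained, which only
  corners do. This finite ramification underlies all gluing and cutting below.\<close>

lemma cell_inter:
  assumes "x \<in> SG p" "y \<in> SG p" "i \<noteq> j" "sgF p i x = sgF p j y"
  shows "x = p j" "y = p i"
proof -
  have "bary p k (sgF p i x) = bary p k (sgF p j y)" for k
    by (simp add: assms(4))
  from this[of i] this[of j]
  have "bary p i x + 1 = bary p i y" "bary p j x = bary p j y + 1"
    using assms(3) by (auto simp: bary_sgF)
  then have "bary p i y = 1" "bary p j x = 1"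
    using SG_bary(1) bary_le_1 assms(1,2) by (smt (verit))+
  then show "x = p j" "y = p i"
    using bary_1_vertex assms by auto
qed

lemma junction_third:
  assumes "y \<in> SG p" "i \<noteq> j" "sgF p l y = sgF p i (p j)"
  shows "l = i \<or> l = j"
proof (rule ccontr)
  assume l: "\<not> ?thesis"
  then have "p j = p l" using cell_inter(2)[OF assms(1) SG_vertex, of l i j] assms(3) by blast
  with l show False by simp
qed

end

section \<open>Graph approximations\<close>

lemma Vm_0: "Vm p 0 = V0 p"
  by (simp add: Vm_def words_def sgFw_def)

lemma words_Suc: "words (Suc m) = (\<Union>i. (#) i ` words m)"
  unfolding words_def by (auto simp: length_Suc_conv)

lemma sgFw_Cons: "sgFw p (i # w) = sgF p i \<circ> sgFw p w"
  by (simp add: sgFw_def)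

lemma Vm_Suc: "Vm p (Suc m) = (\<Union>i. sgF p i ` Vm p m)"
  unfolding Vm_def words_Suc by (auto simp: sgFw_Cons)

lemma Vm_subset_SG: "Vm p m \<subseteq> SG p"
  by (induction m) (auto simp: Vm_0 V0_def Vm_Suc)

lemma Vm_in_SG: "x \<in> Vm p m \<Longrightarrow> x \<in> SG p"
  using Vm_subset_SG by blast

lemma finite_Vm: "finite (Vm p m)"
  by (induction m) (auto simp: Vm_0 V0_def Vm_Suc)

lemma Vm_mono_Suc: "Vm p m \<subseteq> Vm p (Suc m)"
proof (induction m)
  case 0
  have "p i \<in> sgF p i ` range p" for i
    by (rule image_eqI[where x = "p i"]) auto
  then show ?case by (auto simp: Vm_0 V0_def Vm_Suc)
next
  case (Suc m)
  show ?case
  proof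
    fix x assume "x \<in> Vm p (Suc m)"
    then obtain i y where "y \<in> Vm p m" "x = sgF p i y" by (auto simp: Vm_Suc)
    then have "x \<in> sgF p i ` Vm p (Suc m)" using Suc by blast
    then show "x \<in> Vm p (Suc (Suc m))" by (subst Vm_Suc) blast
  qed
qed

lemma Vm_mono: "m \<le> n \<Longrightarrow> Vm p m \<subseteq> Vm p n"
  using lift_Suc_mono_le[of "Vm p", OF Vm_mono_Suc] by blast

lemma nbr_0: "nbr p 0 x y \<longleftrightarrow> x \<noteq> y \<and> x \<in> V0 p \<and> y \<in> V0 p"
  by (simp add: nbr_def words_def sgFw_def)

text \<open>Splitting off the outermost map of the word turns neighbours of level m + 1 into
  neighbours of level m inside a cell, which is the recursion that the inductions on the level
  follow.\<close>

lemma nbr_Suc: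
  "nbr p (Suc m) x y \<longleftrightarrow> (\<exists>i x' y'. x = sgF p i x' \<and> y = sgF p i y' \<and> nbr p m x' y')"
proof
  assume "nbr p (Suc m) x y"
  then obtain i w a b where "x \<noteq> y" "w \<in> words m" "a \<in> V0 p" "b \<in> V0 p"
    "x = sgF p i (sgFw p w a)" "y = sgF p i (sgFw p w b)"
    unfolding nbr_def words_Suc by (auto simp: sgFw_Cons)
  then show "\<exists>i x' y'. x = sgF p i x' \<and> y = sgF p i y' \<and> nbr p m x' y'"
    unfolding nbr_def by (intro exI[of _ i] exI[of _ "sgFw p w a"] exI[of _ "sgFw p w b"]) auto
next
  assume "\<exists>i x' y'. x = sgF p i x' \<and> y = sgF p i y' \<and> nbr p m x' y'"
  then obtain i x' y' where i: "x = sgF p i x'" "y = sgF p i y'" "nbr p m x' y'" by blast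
  then obtain w a b where "x' \<noteq> y'" "w \<in> words m" "a \<in> V0 p" "b \<in> V0 p"
    "x' = sgFw p w a" "y' = sgFw p w b"
    unfolding nbr_def by blast
  with i have "i # w \<in> words (Suc m)" "x = sgFw p (i # w) a" "y = sgFw p (i # w) b" "x \<noteq> y"
    by (auto simp: words_def sgFw_Cons)
  then show "nbr p (Suc m) x y"
    unfolding nbr_def using \<open>a \<in> V0 p\<close> \<open>b \<in> V0 p\<close> by blast
qed

lemma nbr_Vm: "nbr p m x y \<Longrightarrow> x \<in> Vm p m \<and> y \<in> Vm p m"
  unfolding nbr_def Vm_def by blast

lemma finite_nbr: "finite {y. nbr p m x y}"
  by (rule finite_subset[OF _ finite_Vm[of p m]]) (auto dest: nbr_Vm)

lemma graph_lap_cong: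
  assumes "x \<in> SG p" "\<And>y. y \<in> SG p \<Longrightarrow> u y = v y"
  shows "graph_lap p m u x = graph_lap p m v x"
  unfolding graph_lap_def
  by (rule sum.cong) (auto simp: assms dest!: nbr_Vm Vm_in_SG)

lemma graph_lap_diff: "graph_lap p m (\<lambda>x. u x - v x) x = graph_lap p m u x - graph_lap p m v x"
  unfolding graph_lap_def by (simp add: sum_subtractf[symmetric] algebra_simps)

lemma graph_lap_minus: "graph_lap p m (\<lambda>x. - u x) x = - graph_lap p m u x"
  unfolding graph_lap_def sum_negf[symmetric] by (intro sum.cong) auto

text \<open>Up to the factor (5/3)^m these are the terms whose limit is the normal derivative; on
  the graph of level m it is minus the graph Laplacian at the vertex
  (\<open>graph_lap_vertex\<close>). The second reading makes it the share of one cell in the sum at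
  a junction.\<close>

definition vflux :: "(3 \<Rightarrow> real^2) \<Rightarrow> nat \<Rightarrow> (real^2 \<Rightarrow> real) \<Rightarrow> 3 \<Rightarrow> real" where
  "vflux p m u j = 2 * u (p j) - (\<Sum>k\<in>-{j}. u ((sgF p j ^^ m) (p k)))"

lemma vflux_Suc: "vflux p (Suc m) u j = vflux p m (u \<circ> sgF p j) j"
  by (simp add: vflux_def)

section \<open>The graph Laplacian inside a cell, at a vertex and at a junction\<close>

context gasket
begin

lemma V0_iff: "x \<in> V0 p \<longleftrightarrow> (\<exists>i. x = p i)"
  by (auto simp: V0_def)

lemma sgF_notin_V0:
  assumes "x \<in> SG p" "x \<notin> V0 p"
  shows "sgF p i x \<notin> V0 p"
  using assms cell_vertex(2)[OF assms(1), of i] by (auto simp: V0_iff)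

lemma junction_notin_V0: "i \<noteq> j \<Longrightarrow> sgF p i (p j) \<notin> V0 p"
  using cell_vertex[OF SG_vertex, of i j] by (auto simp: V0_iff)

lemma Vm_Suc_cases:
  assumes "x \<in> Vm p (Suc m) - V0 p"
  obtains (cell) i y where "y \<in> Vm p m - V0 p" "x = sgF p i y"
    | (junction) i j where "i \<noteq> j" "x = sgF p i (p j)"
proof -
  obtain i y where iy: "y \<in> Vm p m" "x = sgF p i y"
    using assms by (auto simp: Vm_Suc)
  show ?thesis
  proof (cases "y \<in> V0 p")
    case True
    then obtain j where "y = p j" by (auto simp: V0_iff)
    then show ?thesis using iy assms junction[of i j] by (cases "i = j") (auto simp: V0_iff)
  next
    case False
    then show ?thesis using iy cell by blast
  qed
qed

lemma V1_cases:
  assumes "x \<in> Vm p 1 - V0 p"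
  obtains i j where "i \<noteq> j" "x = sgF p i (p j)"
  using Vm_Suc_cases[of x 0] assms by (auto simp: Vm_0)

lemma junction_in_V1: "sgF p i (p j) \<in> Vm p 1"
  using Vm_Suc[of p 0] by (auto simp: Vm_0 V0_def)

lemma cell_inter_V0:
  assumes "x \<in> SG p" "x \<notin> V0 p" "y \<in> SG p" "sgF p i x = sgF p j y"
  shows "i = j" "x = y"
proof -
  show "i = j"
    using cell_inter(1)[OF assms(1,3) _ assms(4)] assms(2) by (auto simp: V0_iff)
  then show "x = y" using assms(4) by simp
qed

text \<open>A point of a cell other than its corners lies in no second cell, so its neighbours come
  from words with the same first letter.\<close>

lemma nbr_cell:
  assumes "x \<in> SG p" "x \<notin> V0 p"
  shows "{y. nbr p (Suc m) (sgF p i x) y} = sgF p i ` {y. nbr p m x y}"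
proof -
  have "\<exists>y'. y = sgF p i y' \<and> nbr p m x y'" if "nbr p (Suc m) (sgF p i x) y" for y
  proof -
    obtain j x' y' where *: "sgF p i x = sgF p j x'" "y = sgF p j y'" "nbr p m x' y'"
      using \<open>nbr p (Suc m) (sgF p i x) y\<close> unfolding nbr_Suc by blast
    have "x' \<in> SG p" using nbr_Vm[OF *(3)] Vm_in_SG by blast
    from cell_inter_V0[OF assms this *(1)] * show ?thesis by blast
  qed
  then have "{y. nbr p (Suc m) (sgF p i x) y} \<subseteq> sgF p i ` {y. nbr p m x y}" by blast
  moreover have "sgF p i ` {y. nbr p m x y} \<subseteq> {y. nbr p (Suc m) (sgF p i x) y}"
    unfolding nbr_Suc by blast
  ultimately show ?thesis by (rule equalityI)
qed

lemma graph_lap_cell: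
  assumes "x \<in> SG p" "x \<notin> V0 p"
  shows "graph_lap p (Suc m) u (sgF p i x) = graph_lap p m (u \<circ> sgF p i) x"
  unfolding graph_lap_def nbr_cell[OF assms]
  by (subst sum.reindex) (auto intro: inj_on_subset[OF inj_sgF])

lemma nbr_vertex: "{y. nbr p m (p j) y} = (\<lambda>k. (sgF p j ^^ m) (p k)) ` (- {j})"
proof (induction m)
  case 0
  show ?case by (auto simp: nbr_0 V0_def)
next
  case (Suc m)
  have "{y. nbr p (Suc m) (p j) y} = sgF p j ` {y. nbr p m (p j) y}"
  proof -
    have "\<exists>y'. y = sgF p j y' \<and> nbr p m (p j) y'" if "nbr p (Suc m) (p j) y" for y
    proof -
      obtain i x' y' where *: "p j = sgF p i x'" "y = sgF p i y'" "nbr p m x' y'"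
        using \<open>nbr p (Suc m) (p j) y\<close> unfolding nbr_Suc by blast
      have "x' \<in> SG p" using nbr_Vm[OF *(3)] Vm_in_SG by blast
      from cell_vertex[OF this *(1)[symmetric]] * show ?thesis by blast
    qed
    then have "{y. nbr p (Suc m) (p j) y} \<subseteq> sgF p j ` {y. nbr p m (p j) y}" by blast
    moreover have "nbr p (Suc m) (p j) (sgF p j y)" if "nbr p m (p j) y" for y
      unfolding nbr_Suc using that by (intro exI[of _ j] exI[of _ "p j"] exI[of _ y]) simp
    ultimately show ?thesis by blast
  qed
  then show ?case unfolding Suc by auto
qed

lemma inj_funpow_sgF: "inj (sgF p j ^^ m)"
  by (intro inj_fn inj_sgF)

lemma card_compl_singleton_3: "card (- {j :: 3}) = 2"
  by (simp add: Compl_eq_Diff_UNIV card_Diff_subset)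

lemma graph_lap_vertex: "graph_lap p m u (p j) = - vflux p m u j"
proof -
  have "inj_on (\<lambda>k. (sgF p j ^^ m) (p k)) (- {j})"
    by (rule inj_onI) (auto dest: injD[OF inj_funpow_sgF])
  then show ?thesis
    unfolding graph_lap_def nbr_vertex
    by (subst sum.reindex) (auto simp: vflux_def sum_subtractf card_compl_singleton_3)
qed

lemma nbr_junction:
  assumes "i \<noteq> j"
  shows "{y. nbr p (Suc m) (sgF p i (p j)) y} =
    sgF p i ` {y. nbr p m (p j) y} \<union> sgF p j ` {y. nbr p m (p i) y}"
proof -
  have "(\<exists>y'. y = sgF p i y' \<and> nbr p m (p j) y') \<or> (\<exists>y'. y = sgF p j y' \<and> nbr p m (p i) y')"
    if y: "nbr p (Suc m) (sgF p i (p j)) y" for y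
  proof -
    obtain l x' y' where *: "sgF p i (p j) = sgF p l x'" "y = sgF p l y'" "nbr p m x' y'"
      using y unfolding nbr_Suc by blast
    have x': "x' \<in> SG p" using nbr_Vm[OF *(3)] Vm_in_SG by blast
    have "l = i \<or> l = j" using junction_third[OF x' assms] *(1) by simp
    then show ?thesis
    proof
      assume "l = i"
      then show ?thesis using * by auto
    next
      assume "l = j"
      then have "x' = p i" using *(1) sgF_commute[of p i j] by simp
      then show ?thesis using * \<open>l = j\<close> by auto
    qed
  qed
  then have "{y. nbr p (Suc m) (sgF p i (p j)) y} \<subseteq>
    sgF p i ` {y. nbr p m (p j) y} \<union> sgF p j ` {y. nbr p m (p i) y}" by blast
  moreover have "nbr p (Suc m) (sgF p i (p j)) (sgF p i y)" if "nbr p m (p j) y" for y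
    unfolding nbr_Suc using that by blast
  moreover have "nbr p (Suc m) (sgF p i (p j)) (sgF p j y)" if "nbr p m (p i) y" for y
    unfolding nbr_Suc sgF_commute[of p i j] using that by blast
  ultimately show ?thesis by blast
qed

lemma graph_lap_junction:
  assumes "i \<noteq> j"
  shows "graph_lap p (Suc m) u (sgF p i (p j)) =
    - vflux p m (u \<circ> sgF p i) j - vflux p m (u \<circ> sgF p j) i"
proof -
  \<comment> \<open>The two cells meet only in the junction, which is not its own neighbour, so the
    sum splits.\<close>
  have "sgF p i ` {y. nbr p m (p j) y} \<inter> sgF p j ` {y. nbr p m (p i) y} = {}"
  proof -
    have False if "nbr p m (p j) x" "nbr p m (p i) y" "sgF p i x = sgF p j y" for x y
    proof -
      have "x \<in> SG p" "y \<in> SG p" using that nbr_Vm Vm_in_SG by blast+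
      then have "x = p j" using cell_inter(1) that assms by blast
      then show False using that(1) by (simp add: nbr_def)
    qed
    then show ?thesis by blast
  qed
  then have "graph_lap p (Suc m) u (sgF p i (p j)) =
     graph_lap p m (u \<circ> sgF p i) (p j) + graph_lap p m (u \<circ> sgF p j) (p i)"
    unfolding graph_lap_def nbr_junction[OF assms]
    by (subst sum.union_disjoint)
       (auto simp: finite_nbr sum.reindex inj_on_subset[OF inj_sgF] sgF_commute[of p j i])
  then show ?thesis by (simp add: graph_lap_vertex)
qed

section \<open>Density of the vertices\<close>

definition diam :: real where "diam = diameter (SG p)"

lemma dist_le_diam: "x \<in> SG p \<Longrightarrow> y \<in> SG p \<Longrightarrow> dist x y \<le> diam"
  unfolding diam_def by (intro diameter_bounded_bound compact_imp_bounded SG_compact)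

lemma diam_nonneg: "diam \<ge> 0"
  unfolding diam_def by (intro diameter_ge_0 compact_imp_bounded SG_compact)

text \<open>The approximating points avoid \<open>V0 p\<close> because hypotheses on Laplacians
  concern \<open>Vm p m - V0 p\<close> only. At level 0 that set is empty, so the induction starts
  at level 1.\<close>

lemma dense_aux: "x \<in> SG p \<Longrightarrow> \<exists>y\<in>Vm p (Suc m) - V0 p. dist x y \<le> diam / 2 ^ m"
proof (induction m arbitrary: x)
  case 0
  have "sgF p 1 (p 2) \<in> Vm p (Suc 0) - V0 p"
    using junction_in_V1 junction_notin_V0[of 1 2] by simp
  then show ?case using dist_le_diam[OF 0] Vm_in_SG by fastforce
next
  case (Suc m)
  obtain i x' where x': "x' \<in> SG p" "x = sgF p i x'" using SG_cases[OF Suc.prems] by metis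
  obtain y where y: "y \<in> Vm p (Suc m) - V0 p" "dist x' y \<le> diam / 2 ^ m"
    using Suc.IH[OF x'(1)] by blast
  have "sgF p i y \<in> Vm p (Suc (Suc m)) - V0 p"
    using y sgF_notin_V0[OF Vm_in_SG] Vm_Suc[of p "Suc m"] by blast
  moreover have "dist x (sgF p i y) \<le> diam / 2 ^ Suc m"
    using y(2) unfolding x' dist_sgF by simp
  ultimately show ?case by blast
qed

lemma diam_small:
  assumes "e > 0"
  obtains m where "diam / 2 ^ m < e"
proof -
  obtain m where "(1/2) ^ m < e / (diam + 1)"
    using real_arch_pow_inv[of "e / (diam + 1)" "1/2"] assms diam_nonneg by auto
  then have "(diam + 1) * (1/2) ^ m < e"
    using diam_nonneg by (simp add: field_simps)
  moreover have "diam * (1/2) ^ m \<le> (diam + 1) * (1/2) ^ m"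
    by (intro mult_right_mono) auto
  ultimately have "diam / 2 ^ m < e" by (simp add: power_one_over field_simps)
  then show ?thesis by (rule that)
qed

lemma dense:
  assumes "x \<in> SG p" "e > 0"
  obtains m y where "y \<in> Vm p m - V0 p" "dist x y < e"
proof -
  obtain m where m: "diam / 2 ^ m < e" using diam_small assms by blast
  with dense_aux[OF assms(1), of m] that show ?thesis by (meson le_less_trans)
qed

lemma continuous_le_by_density:
  assumes "continuous_on (SG p) u" "\<And>m y. y \<in> Vm p m - V0 p \<Longrightarrow> u y \<le> c" "x \<in> SG p"
  shows "u x \<le> (c :: real)"
proof (rule ccontr)
  assume "\<not> u x \<le> c"
  then obtain d where d: "d > 0" "\<And>y. y \<in> SG p \<Longrightarrow> dist y x < d \<Longrightarrow> dist (u y) (u x) < u x - c"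
    using assms(1,3) unfolding continuous_on_iff by (metis diff_gt_0_iff_gt not_le_imp_less)
  obtain m y where y: "y \<in> Vm p m - V0 p" "dist x y < d" using dense assms(3) d(1) by blast
  then have "dist (u y) (u x) < u x - c" using d(2)[of y] Vm_in_SG by (auto simp: dist_commute)
  then show False using assms(2)[OF y(1)] by (simp add: dist_real_def)
qed

end

section \<open>The spectral decimation step\<close>

text \<open>\<open>phi_m1 x\<close> is the smaller root z of z * (5 - z) = x, the relation between
  graph eigenvalues of consecutive levels. Through it the square root disappears from the
  algebra.\<close>

lemma phi_quad: "x \<le> 25/4 \<Longrightarrow> phi_m1 x * (5 - phi_m1 x) = x"
proof -
  assume "x \<le> 25/4"
  then have "sqrt (25 - 4 * x) * sqrt (25 - 4 * x) = 25 - 4 * x" by simp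
  then show ?thesis unfolding phi_m1_def by (simp add: field_simps)
qed

lemma phi_le: "x \<le> 25/4 \<Longrightarrow> phi_m1 x \<le> 5/2"
  by (simp add: phi_m1_def)

lemma phi_mono: "x \<le> y \<Longrightarrow> phi_m1 x \<le> phi_m1 y"
  by (simp add: phi_m1_def)

lemma phi_strict_mono: "x < y \<Longrightarrow> phi_m1 x < phi_m1 y"
  by (simp add: phi_m1_def)

lemma phi_0 [simp]: "phi_m1 0 = 0"
  by (simp add: phi_m1_def)

lemma phi_6: "phi_m1 6 = 2"
  by (simp add: phi_m1_def)

lemma phi_nonneg: "x \<ge> 0 \<Longrightarrow> phi_m1 x \<ge> 0"
  using phi_mono[of 0 x] by simp

lemma phi_pos: "x > 0 \<Longrightarrow> phi_m1 x > 0"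
  using phi_strict_mono[of 0 x] by simp

lemma phi_nonpos: "x \<le> 0 \<Longrightarrow> phi_m1 x \<le> 0"
  using phi_mono[of x 0] by simp

lemma phi_less_2: "x < 6 \<Longrightarrow> phi_m1 x < 2"
  using phi_strict_mono[of x 6] phi_6 by simp

lemma phi_contract: "0 \<le> x \<Longrightarrow> x \<le> 25/4 \<Longrightarrow> phi_m1 x \<le> 2/5 * x"
proof -
  assume x: "0 \<le> x" "x \<le> 25/4"
  have "phi_m1 x * (5/2) \<le> phi_m1 x * (5 - phi_m1 x)"
    using phi_le[OF x(2)] phi_nonneg[OF x(1)] by (intro mult_left_mono) auto
  then show ?thesis using phi_quad[OF x(2)] by simp
qed

lemma phi_half: "x \<le> 2 \<Longrightarrow> phi_m1 x \<le> 1/2"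
proof -
  assume x: "x \<le> 2"
  have "(3::real) \<le> sqrt (25 - 4 * 2)" by (rule real_le_rsqrt) simp
  moreover have "(4::real) \<le> sqrt (25 - 4 * 2)" by (rule real_le_rsqrt) simp
  ultimately have "phi_m1 2 \<le> 1/2" unfolding phi_m1_def by simp
  then show ?thesis using phi_mono[OF x] by linarith
qed

lemma phi_quarter: "0 \<le> x \<Longrightarrow> x \<le> 2 \<Longrightarrow> phi_m1 x \<le> x / 4"
proof -
  assume x: "0 \<le> x" "x \<le> 2"
  have "phi_m1 x * 4 \<le> phi_m1 x * (5 - phi_m1 x)"
    using phi_half[OF x(2)] phi_nonneg[OF x(1)] by (intro mult_left_mono) auto
  then show ?thesis using phi_quad[of x] x(2) by simp
qed

lemma phi_pow_bounds:
  assumes "0 \<le> x" "x \<le> 25/4"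
  shows "0 \<le> (phi_m1 ^^ m) x" "(phi_m1 ^^ m) x \<le> (2/5) ^ m * x"
proof -
  have "0 \<le> (phi_m1 ^^ m) x \<and> (phi_m1 ^^ m) x \<le> (2/5) ^ m * x"
  proof (induction m)
    case 0
    then show ?case using assms by simp
  next
    case (Suc m)
    have "(2/5::real) ^ m * x \<le> 1 * x" using assms by (intro mult_right_mono power_le_one) auto
    then have "(phi_m1 ^^ m) x \<le> 25/4" using Suc assms by linarith
    then have "phi_m1 ((phi_m1 ^^ m) x) \<le> 2/5 * (phi_m1 ^^ m) x" using Suc phi_contract by blast
    then show ?case using Suc phi_nonneg by auto
  qed
  then show "0 \<le> (phi_m1 ^^ m) x" "(phi_m1 ^^ m) x \<le> (2/5) ^ m * x" by auto
qed

section \<open>Corner values and fluxes under one decimation step\<close>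

definition csum :: "real^3 \<Rightarrow> real" where
  "csum a = (\<Sum>i\<in>UNIV. a $ i)"

text \<open>The spectral decimation step: corner values on the cell \<open>i\<close>, where \<open>b\<close> is the eigenvalue
  of the graph Laplacian on the finer level.\<close>

definition tstep :: "real \<Rightarrow> 3 \<Rightarrow> real^3 \<Rightarrow> real^3" where
  "tstep b i a = (\<chi> j. if j = i then a $ i
     else (a $ i + a $ j) / (5 - b) + 2 * csum a / ((2 - b) * (5 - b)))"

text \<open>A positive multiple of the normal derivative at the vertex \<open>i\<close>.\<close>

definition flux :: "real \<Rightarrow> real^3 \<Rightarrow> 3 \<Rightarrow> real" where
  "flux \<alpha> a i = (6 - \<alpha>) / 2 * a $ i - csum a"

lemma tstep_same [simp]: "tstep b i a $ i = a $ i"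
  by (simp add: tstep_def)

lemma tstep_commute: "tstep b i a $ j = tstep b j a $ i"
  by (simp add: tstep_def add.commute)

lemma csum_minus: "csum (- a) = - csum a"
  by (simp add: csum_def sum_negf)

lemma tstep_minus: "tstep b i (- a) = - tstep b i a"
  by (simp add: tstep_def vec_eq_iff csum_minus diff_divide_distrib add_divide_distrib)

lemma flux_minus: "flux \<alpha> (- a) i = - flux \<alpha> a i"
  by (simp add: flux_def csum_minus)

lemma csum_scale: "csum (c *\<^sub>R a) = c * csum a"
  by (simp add: csum_def sum_distrib_left)

lemma flux_scale: "flux \<alpha> (c *\<^sub>R a) i = c * flux \<alpha> a i"
  by (simp add: flux_def csum_scale algebra_simps)

text \<open>A discrete Gauss-Green formula. For \<alpha> > 0 fluxes of one sign therefore force a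
  nonzero \<open>csum a\<close>; for \<alpha> = 0 they add up to zero and cannot all have one
  sign.\<close>

lemma sum_flux: "(\<Sum>i\<in>UNIV. flux \<alpha> a i) = - \<alpha> / 2 * csum a"
  by (simp add: flux_def csum_def sum_3 field_simps)

lemma third_index:
  fixes i j :: 3
  assumes "i \<noteq> j"
  obtains k where "k \<noteq> i" "k \<noteq> j" "UNIV = {i, j, k}"
proof -
  have "\<exists>k. k \<noteq> i \<and> k \<noteq> j \<and> UNIV = {i, j, k}"
    using assms exhaust_3[of i] exhaust_3[of j] unfolding UNIV_3
    by (elim disjE) (force simp: insert_commute)+
  then show ?thesis using that by blast
qed

lemma csum_third:
  assumes "UNIV = {i, j, k}" "i \<noteq> j" "k \<noteq> i" "k \<noteq> j"
  shows "csum a = a $ i + a $ j + a $ k"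
  unfolding csum_def assms(1) using assms(2-) by simp

text \<open>Zooming into a corner multiplies its flux by a factor that is positive for b < 2 and
  independent of \<open>a\<close>; at b = 0 it is the resistance factor 3/5.\<close>

lemma flux_tstep_same:
  assumes "b < 2"
  shows "flux b (tstep b i a) i = (6 - b) / ((2 - b) * (5 - b)) * flux (b * (5 - b)) a i"
proof -
  obtain j where "i \<noteq> j" by (metis zero_neq_one)
  then obtain k where k: "UNIV = {i, j, k}" "i \<noteq> j" "k \<noteq> i" "k \<noteq> j" using third_index by metis
  \<comment> \<open>The reciprocals become variables with polynomial relations, so
    \<open>algebra\<close> can treat the rational identity as membership in a polynomial
    ideal.\<close>
  define x where "x = 1 / (5 - b)"
  define y where "y = 1 / (2 - b)"
  have x: "x * (5 - b) = 1" and y: "y * (2 - b) = 1" using assms by (auto simp: x_def y_def)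
  have j: "tstep b i a $ j = (a $ i + a $ j) * x + 2 * csum a * x * y"
    and k': "tstep b i a $ k = (a $ i + a $ k) * x + 2 * csum a * x * y"
    using k by (simp_all add: tstep_def x_def y_def)
  have q: "(6 - b) / ((2 - b) * (5 - b)) = (6 - b) * x * y"
    by (simp add: x_def y_def)
  show ?thesis
    unfolding flux_def q csum_third[OF k] tstep_same j k'
    using x y by algebra
qed

text \<open>The third corner value cancels. What remains is antisymmetric in i and j, so the two
  cells have opposite fluxes at their common corner, which is the matching condition there
  (\<open>flux_junction\<close>).\<close>

lemma flux_tstep_other:
  assumes "b < 2" "i \<noteq> j"
  shows "flux b (tstep b i a) j = (6 - b) / (2 * (5 - b)) * (a $ j - a $ i)"
proof -
  obtain k where k: "UNIV = {i, j, k}" "i \<noteq> j" "k \<noteq> i" "k \<noteq> j" using third_index assms by metis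
  define x where "x = 1 / (5 - b)"
  define y where "y = 1 / (2 - b)"
  have x: "x * (5 - b) = 1" and y: "y * (2 - b) = 1" using assms by (auto simp: x_def y_def)
  have j: "tstep b i a $ j = (a $ i + a $ j) * x + 2 * csum a * x * y"
    and k': "tstep b i a $ k = (a $ i + a $ k) * x + 2 * csum a * x * y"
    using k by (simp_all add: tstep_def x_def y_def)
  have q: "(6 - b) / (2 * (5 - b)) = (6 - b) * x / 2"
    by (simp add: x_def)
  show ?thesis
    unfolding flux_def q csum_third[OF k] tstep_same j k'
    using x y by algebra
qed

lemma tstep_diff:
  assumes "j \<noteq> i" "k \<noteq> i"
  shows "tstep b i a $ j - tstep b i a $ k = (a $ j - a $ k) / (5 - b)"
  using assms by (simp add: tstep_def diff_divide_distrib add_divide_distrib)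

text \<open>The form separates the oscillation of \<open>a\<close> from its size: the first term
  involves differences only, and the second carries the small factor b.\<close>

lemma tstep_minus_corner:
  assumes "b < 2" "UNIV = {i, j, k}" "i \<noteq> j" "k \<noteq> i" "k \<noteq> j"
  shows "tstep b i a $ j - a $ i =
    ((4 - b) * (a $ j - a $ i) + 2 * (a $ k - a $ i)) / ((2 - b) * (5 - b)) + b * a $ i / (2 - b)"
proof -
  define x where "x = 1 / (5 - b)"
  define y where "y = 1 / (2 - b)"
  have x: "x * (5 - b) = 1" and y: "y * (2 - b) = 1" using assms by (auto simp: x_def y_def)
  have j: "tstep b i a $ j = (a $ i + a $ j) * x + 2 * csum a * x * y"
    using assms by (simp add: tstep_def x_def y_def)
  have d: "z / ((2 - b) * (5 - b)) = z * x * y" "z / (2 - b) = z * y" for z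
    by (simp_all add: x_def y_def)
  show ?thesis
    unfolding csum_third[OF assms(2-)] j d
    using x y by algebra
qed

section \<open>The eigenfunction with given boundary values\<close>

context gasket
begin

section \<open>Gluing across cells and the approximants of the eigenfunction\<close>

definition cellidx :: "real^2 \<Rightarrow> 3" where
  "cellidx x = (SOME i. x \<in> sgF p i ` SG p)"

text \<open>The map 2 x - p_i inverts F_i. The chosen cell is ambiguous only at junctions, where the
  compatibility assumed in \<open>glue_cell\<close> makes the choice irrelevant.\<close>

definition glue :: "(3 \<Rightarrow> real^2 \<Rightarrow> real) \<Rightarrow> real^2 \<Rightarrow> real" where
  "glue v x = v (cellidx x) (2 *\<^sub>R x - p (cellidx x))"

lemma glue_cell:
  assumes "\<And>i j. v i (p j) = v j (p i)" "y \<in> SG p"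
  shows "glue v (sgF p i y) = v i y"
proof -
  let ?j = "cellidx (sgF p i y)"
  have "sgF p i y \<in> sgF p ?j ` SG p"
    unfolding cellidx_def by (rule someI[of _ i]) (use assms in blast)
  then obtain z where z: "z \<in> SG p" "sgF p i y = sgF p ?j z" by blast
  have "2 *\<^sub>R sgF p ?j z - p ?j = z"
    by (simp add: sgF_eq)
  then have g: "glue v (sgF p i y) = v ?j z"
    unfolding glue_def z(2)[symmetric] by simp
  show ?thesis
  proof (cases "i = ?j")
    case True
    then show ?thesis using g z by (metis sgF_inject)
  next
    case False
    then have "y = p ?j" "z = p i" using cell_inter[OF assms(2) z(1) False z(2)] by auto
    then show ?thesis using g assms(1) by metis
  qed
qed

lemma continuous_on_cells:
  fixes u :: "real^2 \<Rightarrow> real"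
  assumes "\<And>i. continuous_on (SG p) (u \<circ> sgF p i)"
  shows "continuous_on (SG p) u"
proof -
  have "continuous_on (sgF p i ` SG p) u" for i
  proof -
    have "(\<lambda>x. 2 *\<^sub>R x - p i) ` sgF p i ` SG p = SG p"
      by (simp add: sgF_eq image_image)
    then have "continuous_on ((\<lambda>x. 2 *\<^sub>R x - p i) ` sgF p i ` SG p) (u \<circ> sgF p i)"
      using assms[of i] by (simp only:)
    moreover have "continuous_on (sgF p i ` SG p) (\<lambda>x. 2 *\<^sub>R x - p i)"
      by (intro continuous_intros)
    ultimately have "continuous_on (sgF p i ` SG p) ((u \<circ> sgF p i) \<circ> (\<lambda>x. 2 *\<^sub>R x - p i))"
      by (rule continuous_on_compose[rotated])
    then show ?thesis
      by (rule continuous_on_eq) (simp add: sgF_eq)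
  qed
  then have "continuous_on (\<Union>i\<in>UNIV. sgF p i ` SG p) u"
    by (intro continuous_on_closed_Union)
       (auto intro!: compact_imp_closed compact_continuous_image SG_compact continuous_intros)
  then show ?thesis using SG_fix[of p] unfolding sgH_def by simp
qed

text \<open>On the gasket the approximant of level m has the final values on V_m and is affine on
  each cell of level m. The recursion runs from the outermost cell inwards, so the parameter and the
  corner values change together.\<close>

primrec uapp :: "nat \<Rightarrow> real \<Rightarrow> real^3 \<Rightarrow> real^2 \<Rightarrow> real" where
  "uapp 0 = (\<lambda>\<alpha> a x. \<Sum>i\<in>UNIV. a $ i * bary p i x)"
| "uapp (Suc m) = (\<lambda>\<alpha> a. glue (\<lambda>i. uapp m (phi_m1 \<alpha>) (tstep (phi_m1 \<alpha>) i a)))"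

lemma uapp_vertex: "uapp m \<alpha> a (p j) = a $ j"
proof (induction m arbitrary: \<alpha> a j)
  case 0
  show ?case by (simp add: bary_vertex if_distrib[of "(*) _"] cong: if_cong)
next
  case (Suc m)
  have "glue (\<lambda>i. uapp m (phi_m1 \<alpha>) (tstep (phi_m1 \<alpha>) i a)) (sgF p j (p j)) = a $ j"
    by (subst glue_cell) (auto simp: Suc tstep_commute[of _ _ a])
  then show ?case by simp
qed

lemma uapp_cell:
  "y \<in> SG p \<Longrightarrow> uapp (Suc m) \<alpha> a (sgF p i y) = uapp m (phi_m1 \<alpha>) (tstep (phi_m1 \<alpha>) i a) y"
  by (simp, subst glue_cell) (auto simp: uapp_vertex tstep_commute[of _ _ a])

lemma uapp_continuous: "continuous_on (SG p) (uapp m \<alpha> a)"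
proof (induction m arbitrary: \<alpha> a)
  case 0
  show ?case by (auto intro!: continuous_intros)
next
  case (Suc m)
  show ?case
  proof (rule continuous_on_cells)
    fix i
    show "continuous_on (SG p) (uapp (Suc m) \<alpha> a \<circ> sgF p i)"
      by (rule continuous_on_eq[OF Suc]) (simp only: o_def uapp_cell)
  qed
qed

lemma uapp_minus: "uapp m \<alpha> (- a) x = - uapp m \<alpha> a x"
  by (induction m arbitrary: \<alpha> a x) (auto simp: sum_negf glue_def tstep_minus)

section \<open>Uniform convergence of the approximants\<close>

lemma row_sum:
  fixes b c :: real
  assumes "b < 2"
  shows "2 * c / (5 - b) + 2 * (3 * c) / ((2 - b) * (5 - b)) = 2 * c / (2 - b)"
proof -
  define x where "x = 1 / (5 - b)"
  define y where "y = 1 / (2 - b)"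
  have x: "x * (5 - b) = 1" and y: "y * (2 - b) = 1" using assms by (auto simp: x_def y_def)
  have "2 * c * y = 2 * c * x + 2 * (3 * c) * x * y"
    using x y by algebra
  then show ?thesis by (simp add: x_def y_def mult.commute)
qed

text \<open>The constants come from b \<le> 1/2, which \<alpha> \<le> 2 provides: 5/6 bounds (6 - b)
  / ((2 - b) * (5 - b)), which is 22/27 at b = 1/2; 1/6 is 1/4 divided by 3/2, by b \<le>
  \<alpha>/4; and 4/3 is 2 / (2 - 1/2), the value of the step off the corner at the constant vector
  1.\<close>

lemma tstep_osc:
  assumes "0 \<le> \<alpha>" "\<alpha> \<le> 2" "\<And>i j. \<bar>a $ i - a $ j\<bar> \<le> d" "\<And>i. \<bar>a $ i\<bar> \<le> M"
  defines "b \<equiv> phi_m1 \<alpha>"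
  shows "\<bar>tstep b i a $ j - a $ i\<bar> \<le> 5/6 * d + \<alpha> * M / 6"
    and "\<bar>tstep b i a $ j - tstep b i a $ k\<bar> \<le> 5/6 * d + \<alpha> * M / 6"
    and "\<bar>tstep b i a $ j\<bar> \<le> 4/3 * M"
proof -
  have b: "0 \<le> b" "b \<le> 1/2" "b \<le> \<alpha> / 4"
    using assms phi_nonneg phi_half phi_quarter unfolding b_def by auto
  have d: "0 \<le> d" using assms(3)[of 1 1] by simp
  have M: "0 \<le> M" using assms(4)[of 1] by linarith
  have D: "(2 - b) * (5 - b) > 0" using b by (intro mult_pos_pos) auto
  have r: "(6 - b) / ((2 - b) * (5 - b)) \<le> 5/6"
  proof -
    have "(1/2 - b) * (53/2 - 5 * b) \<ge> 0" using b by (intro mult_nonneg_nonneg) auto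
    moreover have "5 * ((2 - b) * (5 - b)) - (6 - b) * 6 = (1/2 - b) * (53/2 - 5 * b) + 3/4"
      by (simp add: field_simps)
    ultimately have "(6 - b) * 6 \<le> 5 * ((2 - b) * (5 - b))" by linarith
    then show ?thesis using D by (simp add: divide_le_eq)
  qed
  have bM: "b * M / (2 - b) \<le> \<alpha> * M / 6"
  proof -
    have "b * M / (2 - b) \<le> b * M / (3/2)"
      using b M by (intro divide_left_mono) auto
    also have "\<dots> \<le> (\<alpha> / 4) * M / (3/2)"
      using b M by (intro divide_right_mono mult_right_mono) auto
    finally show ?thesis by (simp add: mult.commute)
  qed
  have aM: "0 \<le> \<alpha> * M" using assms(1) M by simp
  show 1: "\<bar>tstep b i a $ j - a $ i\<bar> \<le> 5/6 * d + \<alpha> * M / 6" for j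
  proof (cases "j = i")
    case True
    then show ?thesis using d aM by simp
  next
    case False
    then obtain k where k: "UNIV = {i, j, k}" "i \<noteq> j" "k \<noteq> i" "k \<noteq> j" using third_index by metis
    have "\<bar>(4 - b) * (a $ j - a $ i) + 2 * (a $ k - a $ i)\<bar> \<le> (4 - b) * d + 2 * d"
    proof (rule order_trans[OF abs_triangle_ineq], rule add_mono)
      show "\<bar>(4 - b) * (a $ j - a $ i)\<bar> \<le> (4 - b) * d"
        unfolding abs_mult using b assms(3) by (intro mult_mono) auto
      show "\<bar>2 * (a $ k - a $ i)\<bar> \<le> 2 * d"
        unfolding abs_mult using assms(3)[of k i] by simp
    qed
    then have "\<bar>((4 - b) * (a $ j - a $ i) + 2 * (a $ k - a $ i)) / ((2 - b) * (5 - b))\<bar>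
        \<le> ((4 - b) * d + 2 * d) / ((2 - b) * (5 - b))"
      unfolding abs_divide using D by (simp add: divide_right_mono)
    also have "\<dots> = (6 - b) / ((2 - b) * (5 - b)) * d"
      by (simp add: algebra_simps)
    also have "\<dots> \<le> 5/6 * d" by (rule mult_right_mono[OF r d])
    finally have t1: "\<bar>((4 - b) * (a $ j - a $ i) + 2 * (a $ k - a $ i)) / ((2 - b) * (5 - b))\<bar> \<le> 5/6 * d" .
    have "\<bar>b * a $ i / (2 - b)\<bar> = b * \<bar>a $ i\<bar> / (2 - b)"
      using b by (simp add: abs_mult abs_divide)
    also have "\<dots> \<le> b * M / (2 - b)"
      using b assms(4) by (intro divide_right_mono mult_left_mono) auto
    finally have t2: "\<bar>b * a $ i / (2 - b)\<bar> \<le> b * M / (2 - b)" .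
    have "b < 2" using b by simp
    show ?thesis
      unfolding tstep_minus_corner[OF \<open>b < 2\<close> k] using t1 t2 bM by linarith
  qed
  show "\<bar>tstep b i a $ j - tstep b i a $ k\<bar> \<le> 5/6 * d + \<alpha> * M / 6"
  proof (cases "j = i \<or> k = i")
    case True
    then show ?thesis using 1[of j] 1[of k] by (auto simp: abs_minus_commute)
  next
    case False
    then have "\<bar>tstep b i a $ j - tstep b i a $ k\<bar> = \<bar>a $ j - a $ k\<bar> / (5 - b)"
      using b by (simp add: tstep_diff)
    also have "\<dots> \<le> d / 2" using b assms(3) d by (intro frac_le) auto
    finally show ?thesis using d aM by simp
  qed
  show "\<bar>tstep b i a $ j\<bar> \<le> 4/3 * M"
  proof (cases "j = i")
    case True
    then show ?thesis using assms(4)[of i] M by simp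
  next
    case False
    have "\<bar>csum a\<bar> \<le> (\<Sum>i\<in>UNIV. \<bar>a $ i\<bar>)" unfolding csum_def by (rule sum_abs)
    also have "\<dots> \<le> 3 * M" using assms(4)[of 1] assms(4)[of 2] assms(4)[of 3] by (simp add: sum_3)
    finally have S: "\<bar>csum a\<bar> \<le> 3 * M" .
    have "\<bar>tstep b i a $ j\<bar> \<le> \<bar>a $ i + a $ j\<bar> / (5 - b) + 2 * \<bar>csum a\<bar> / ((2 - b) * (5 - b))"
      using False b by (auto simp: tstep_def abs_mult intro!: order_trans[OF abs_triangle_ineq])
    also have "\<dots> \<le> (2 * M) / (5 - b) + 2 * (3 * M) / ((2 - b) * (5 - b))"
      using S b assms(4)[of i] assms(4)[of j] D by (intro add_mono divide_right_mono) auto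
    also have "\<dots> = 2 * M / (2 - b)" using b by (subst row_sum) auto
    also have "\<dots> \<le> 2 * M / (3/2)" using b M by (intro divide_left_mono) auto
    finally show ?thesis by simp
  qed
qed

lemma bary_comb_bound:
  assumes "x \<in> SG p" "\<And>j. \<bar>a $ j - c\<bar> \<le> d"
  shows "\<bar>(\<Sum>j\<in>UNIV. a $ j * bary p j x) - c\<bar> \<le> d"
proof -
  have "(\<Sum>j\<in>UNIV. a $ j * bary p j x) - c = (\<Sum>j\<in>UNIV. (a $ j - c) * bary p j x)"
    using SG_bary(3)[OF assms(1)]
    by (simp add: left_diff_distrib sum_subtractf flip: sum_distrib_left)
  also have "\<bar>\<dots>\<bar> \<le> (\<Sum>j\<in>UNIV. d * bary p j x)"
    by (rule order_trans[OF sum_abs], rule sum_mono)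
       (auto simp: abs_mult SG_bary(1)[OF assms(1)] intro!: mult_right_mono assms)
  also have "\<dots> = d"
    using SG_bary(3)[OF assms(1)] by (simp flip: sum_distrib_left)
  finally show ?thesis .
qed

text \<open>The quantity d + \<alpha> * M shrinks by 5/6 on passing to a cell: the oscillation
  becomes 5/6 d + \<alpha> M / 6, and although M may grow by 4/3, the parameter drops to a quarter
  or less, so \<alpha> M becomes at most a third of itself.\<close>

lemma uapp_diff:
  assumes "0 \<le> \<alpha>" "\<alpha> \<le> 2" "\<And>i j. \<bar>a $ i - a $ j\<bar> \<le> d" "\<And>i. \<bar>a $ i\<bar> \<le> M" "x \<in> SG p"
  shows "\<bar>uapp (Suc m) \<alpha> a x - uapp m \<alpha> a x\<bar> \<le> 2 * (5/6) ^ m * (d + \<alpha> * M)"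
  using assms
proof (induction m arbitrary: \<alpha> a d M x)
  case 0
  have aM: "0 \<le> \<alpha> * M" using 0(1) order_trans[OF abs_ge_zero 0(4)] by simp
  obtain i y where y: "y \<in> SG p" "x = sgF p i y" using SG_cases[OF 0(5)] by metis
  have 1: "\<bar>(\<Sum>j\<in>UNIV. tstep (phi_m1 \<alpha>) i a $ j * bary p j y) - a $ i\<bar> \<le> 5/6 * d + \<alpha> * M / 6"
    by (rule bary_comb_bound[OF y(1)]) (rule tstep_osc(1)[OF 0(1-4)])
  have 2: "\<bar>(\<Sum>j\<in>UNIV. a $ j * bary p j x) - a $ i\<bar> \<le> d"
    by (rule bary_comb_bound[OF 0(5)]) (rule 0(3))
  have e: "uapp (Suc 0) \<alpha> a x = (\<Sum>j\<in>UNIV. tstep (phi_m1 \<alpha>) i a $ j * bary p j y)"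
    unfolding y(2) uapp_cell[OF y(1)] by simp
  have "0 \<le> d" using 0(3)[of 1 1] by simp
  then show ?case unfolding e using 1 2 aM by simp
next
  case (Suc m)
  obtain i y where y: "y \<in> SG p" "x = sgF p i y" using SG_cases[OF Suc.prems(5)] by metis
  let ?b = "phi_m1 \<alpha>"
  have M: "0 \<le> M" using order_trans[OF abs_ge_zero Suc.prems(4)] .
  have b: "0 \<le> ?b" "?b \<le> 2" "?b \<le> \<alpha> / 4"
    using phi_nonneg[OF Suc.prems(1)] phi_half[OF Suc.prems(2)] phi_quarter[OF Suc.prems(1,2)] by auto
  have "\<bar>uapp (Suc m) ?b (tstep ?b i a) y - uapp m ?b (tstep ?b i a) y\<bar>
      \<le> 2 * (5/6) ^ m * ((5/6 * d + \<alpha> * M / 6) + ?b * (4/3 * M))"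
    by (rule Suc.IH[OF b(1,2) tstep_osc(2)[OF Suc.prems(1-4)] tstep_osc(3)[OF Suc.prems(1-4)] y(1)])
  also have "\<dots> \<le> 2 * (5/6) ^ m * (5/6 * (d + \<alpha> * M))"
  proof (rule mult_left_mono)
    have "?b * M \<le> \<alpha> / 4 * M" using b M by (intro mult_right_mono) auto
    moreover have "0 \<le> \<alpha> * M" using Suc.prems(1) M by simp
    ultimately show "(5/6 * d + \<alpha> * M / 6) + ?b * (4/3 * M) \<le> 5/6 * (d + \<alpha> * M)"
      by (simp add: algebra_simps)
  qed simp
  also have "\<dots> = 2 * (5/6) ^ Suc m * (d + \<alpha> * M)" by (simp only: power_Suc mult_ac)
  finally show ?case unfolding y(2) uapp_cell[OF y(1)] .
qed

definition U :: "real \<Rightarrow> real^3 \<Rightarrow> real^2 \<Rightarrow> real" where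
  "U \<alpha> a x = lim (\<lambda>m. uapp m \<alpha> a x)"

lemma uapp_uniform_limit:
  assumes "0 \<le> \<alpha>" "\<alpha> \<le> 2"
  shows "uniform_limit (SG p) (\<lambda>m. uapp m \<alpha> a) (U \<alpha> a) sequentially"
proof -
  define M where "M = (\<Sum>i\<in>UNIV. \<bar>a $ i\<bar>)"
  have M: "\<bar>a $ i\<bar> \<le> M" for i unfolding M_def by (rule member_le_sum) auto
  then have d: "\<bar>a $ i - a $ j\<bar> \<le> 2 * M" for i j using M[of i] M[of j] by linarith
  let ?f = "\<lambda>m x. uapp (Suc m) \<alpha> a x - uapp m \<alpha> a x"
  have "uniform_limit (SG p) (\<lambda>n x. \<Sum>m<n. ?f m x) (\<lambda>x. suminf (\<lambda>m. ?f m x)) sequentially"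
  proof (rule Weierstrass_m_test)
    show "norm (?f m x) \<le> 2 * (5/6) ^ m * (2 * M + \<alpha> * M)" if "x \<in> SG p" for m x
      using uapp_diff[OF assms d M that, of m] by (simp only: real_norm_def)
    show "summable (\<lambda>m. 2 * (5/6::real) ^ m * (2 * M + \<alpha> * M))"
      by (intro summable_mult summable_mult2 summable_geometric) auto
  qed
  moreover have "(\<Sum>m<n. ?f m x) = uapp n \<alpha> a x - uapp 0 \<alpha> a x" for n x
    by (rule sum_lessThan_telescope)
  ultimately have "uniform_limit (SG p) (\<lambda>n x. uapp n \<alpha> a x - uapp 0 \<alpha> a x) (\<lambda>x. suminf (\<lambda>m. ?f m x)) sequentially"
    by (simp only:)
  from uniform_limit_add[OF this uniform_limit_const[of "uapp 0 \<alpha> a"]]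
  have *: "uniform_limit (SG p) (\<lambda>n x. uapp n \<alpha> a x) (\<lambda>x. suminf (\<lambda>m. ?f m x) + uapp 0 \<alpha> a x) sequentially"
    by (simp only: diff_add_cancel)
  have "U \<alpha> a x = suminf (\<lambda>m. ?f m x) + uapp 0 \<alpha> a x" if "x \<in> SG p" for x
    unfolding U_def by (rule limI) (rule tendsto_uniform_limitI[OF * that])
  then show ?thesis using * by (subst uniform_limit_cong'[where g = "\<lambda>n x. uapp n \<alpha> a x"]) auto
qed

lemma phi_le_2: "\<alpha> \<le> 6 \<Longrightarrow> phi_m1 \<alpha> \<le> 2"
  using phi_mono[of \<alpha> 6] phi_6 by simp

text \<open>One passage to a cell brings the parameter from [0, 6] into [0, 2], where uniform
  convergence is known. At \<alpha> = 6 the step divides by 2 - b = 0 and takes the default quotient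
  0; the limit and its continuity survive, while the eigenvalue equation is only claimed below
  6.\<close>

lemma uapp_tendsto:
  assumes "0 \<le> \<alpha>" "\<alpha> \<le> 6" "x \<in> SG p"
  shows "(\<lambda>m. uapp m \<alpha> a x) \<longlonglongrightarrow> U \<alpha> a x"
proof -
  obtain i y where y: "y \<in> SG p" "x = sgF p i y" using SG_cases[OF assms(3)] by metis
  have "(\<lambda>m. uapp (Suc m) \<alpha> a x) \<longlonglongrightarrow> U (phi_m1 \<alpha>) (tstep (phi_m1 \<alpha>) i a) y"
    unfolding y(2) uapp_cell[OF y(1)]
    using assms by (intro tendsto_uniform_limitI[OF uapp_uniform_limit] phi_nonneg phi_le_2 y)
  then have "(\<lambda>m. uapp m \<alpha> a x) \<longlonglongrightarrow> U (phi_m1 \<alpha>) (tstep (phi_m1 \<alpha>) i a) y"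
    by (rule LIMSEQ_imp_Suc)
  then show ?thesis unfolding U_def using limI by metis
qed

lemma U_vertex [simp]: "U \<alpha> a (p j) = a $ j"
  unfolding U_def uapp_vertex by (rule limI) simp

lemma U_cell:
  assumes "0 \<le> \<alpha>" "\<alpha> \<le> 6" "y \<in> SG p"
  shows "U \<alpha> a (sgF p i y) = U (phi_m1 \<alpha>) (tstep (phi_m1 \<alpha>) i a) y"
proof (rule LIMSEQ_unique)
  show "(\<lambda>m. uapp (Suc m) \<alpha> a (sgF p i y)) \<longlonglongrightarrow> U \<alpha> a (sgF p i y)"
    using uapp_tendsto assms by (intro LIMSEQ_Suc) auto
  show "(\<lambda>m. uapp (Suc m) \<alpha> a (sgF p i y)) \<longlonglongrightarrow> U (phi_m1 \<alpha>) (tstep (phi_m1 \<alpha>) i a) y"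
    unfolding uapp_cell[OF assms(3)]
    using assms phi_le_2[OF assms(2)] by (intro uapp_tendsto phi_nonneg) auto
qed

lemma U_continuous:
  assumes "0 \<le> \<alpha>" "\<alpha> \<le> 6"
  shows "continuous_on (SG p) (U \<alpha> a)"
proof (rule continuous_on_cells)
  fix i
  let ?b = "phi_m1 \<alpha>"
  have "continuous_on (SG p) (U ?b (tstep ?b i a))"
    by (rule uniform_limit_theorem[OF _ uapp_uniform_limit])
       (use assms phi_nonneg phi_le_2 uapp_continuous in auto)
  then show "continuous_on (SG p) (U \<alpha> a \<circ> sgF p i)"
    by (rule continuous_on_eq) (simp add: U_cell assms)
qed

lemma U_minus:
  assumes "0 \<le> \<alpha>" "\<alpha> \<le> 6" "x \<in> SG p"
  shows "U \<alpha> (- a) x = - U \<alpha> a x"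
  using LIMSEQ_unique[OF uapp_tendsto[OF assms, of "- a", unfolded uapp_minus]
    tendsto_minus[OF uapp_tendsto[OF assms]]] .

lemma U_junction:
  assumes "0 \<le> \<alpha>" "\<alpha> \<le> 6"
  shows "U \<alpha> a (sgF p i (p j)) = tstep (phi_m1 \<alpha>) i a $ j"
  using U_cell[OF assms SG_vertex] by simp

lemma tstep_ge:
  assumes "0 \<le> b" "b < 2" "0 \<le> c" "\<And>j. c \<le> a $ j"
  shows "c \<le> tstep b i a $ j"
proof (cases "j = i")
  case True
  then show ?thesis using assms by simp
next
  case False
  have "c \<le> 2 * c / (2 - b)"
    using assms(1-3) by (simp add: field_simps)
  also have "\<dots> = 2 * c / (5 - b) + 2 * (3 * c) / ((2 - b) * (5 - b))"
    using row_sum[OF assms(2)] by simp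
  also have "\<dots> \<le> (a $ i + a $ j) / (5 - b) + 2 * csum a / ((2 - b) * (5 - b))"
    using assms(1,2) assms(4)[of i] assms(4)[of j] assms(4)[of 1] assms(4)[of 2] assms(4)[of 3]
    by (intro add_mono divide_right_mono mult_nonneg_nonneg) (auto simp: csum_def sum_3)
  finally show ?thesis using False by (simp add: tstep_def)
qed

text \<open>The coefficients of \<open>tstep\<close> are nonnegative and off the corner they add up
  to 2 / (2 - b) \<ge> 1, so a nonnegative lower bound survives each step. With data 1 this yields
  the positive comparison function for uniqueness.\<close>

lemma U_ge:
  assumes "0 \<le> \<alpha>" "\<alpha> < 6" "0 \<le> c" "\<And>j. c \<le> a $ j" "x \<in> SG p"
  shows "c \<le> U \<alpha> a x"
proof -
  have "c \<le> uapp m \<alpha> a x" for m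
    using assms
  proof (induction m arbitrary: \<alpha> a x)
    case 0
    have "c = (\<Sum>i\<in>UNIV. c * bary p i x)"
      using SG_bary(3)[OF 0(5)] by (simp flip: sum_distrib_left)
    also have "\<dots> \<le> (\<Sum>i\<in>UNIV. a $ i * bary p i x)"
      by (intro sum_mono mult_right_mono 0 SG_bary)
    finally show ?case by simp
  next
    case (Suc m)
    obtain i y where y: "y \<in> SG p" "x = sgF p i y" using SG_cases[OF Suc.prems(5)] by metis
    have b: "0 \<le> phi_m1 \<alpha>" "phi_m1 \<alpha> < 2" using Suc.prems phi_nonneg phi_less_2 by auto
    then have "c \<le> uapp m (phi_m1 \<alpha>) (tstep (phi_m1 \<alpha>) i a) y"
      using Suc.prems y by (intro Suc.IH tstep_ge) auto
    then show ?case unfolding y(2) uapp_cell[OF y(1)] .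
  qed
  then show ?thesis
    using assms by (intro LIMSEQ_le_const[OF uapp_tendsto]) auto
qed

end

section \<open>The function psi and the normal derivatives\<close>

lemma five_phi: "x \<le> 25/4 \<Longrightarrow> 5 * phi_m1 x = x + (phi_m1 x)\<^sup>2"
  using phi_quad[of x] by (simp add: algebra_simps power2_eq_square)

lemma phi_pow_le: "x \<le> 25/4 \<Longrightarrow> (phi_m1 ^^ m) x \<le> 25/4"
proof (induction m)
  case (Suc m)
  then show ?case using phi_le[of "(phi_m1 ^^ m) x"] by auto
qed simp

text \<open>By 5 z = x + z^2 for z = \<open>phi_m1 x\<close> the increments of the sequence defining
  \<open>psi\<close> are nonnegative. For 0 \<le> x the limit is thus a series whose terms increase
  with x, from which strict monotonicity and continuity are read off.\<close>

lemma five_pow_phi: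
  assumes "x \<le> 25/4"
  shows "5 ^ Suc m * (phi_m1 ^^ Suc m) x = 5 ^ m * (phi_m1 ^^ m) x + 5 ^ m * ((phi_m1 ^^ Suc m) x)\<^sup>2"
proof -
  have "5 ^ Suc m * (phi_m1 ^^ Suc m) x = 5 ^ m * (5 * phi_m1 ((phi_m1 ^^ m) x))"
    by simp
  also have "\<dots> = 5 ^ m * ((phi_m1 ^^ m) x + ((phi_m1 ^^ Suc m) x)\<^sup>2)"
    using five_phi[OF phi_pow_le[OF assms, of m]] by simp
  finally show ?thesis by (simp only: distrib_left)
qed

lemma incseq_phi: "x \<le> 25/4 \<Longrightarrow> incseq (\<lambda>m. 5 ^ m * (phi_m1 ^^ m) x)"
  using five_pow_phi[of x] by (intro incseq_SucI) (auto simp del: power_Suc funpow.simps)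

lemma phi_pow_mono: "x \<le> y \<Longrightarrow> (phi_m1 ^^ m) x \<le> (phi_m1 ^^ m) y"
  by (induction m) (auto intro: phi_mono)

text \<open>The iterates decay at least like (2/5)^m, and 5 * (2/5)^2 = 4/5 < 1.\<close>

lemma psi_term_bound:
  assumes "0 \<le> x" "x \<le> 25/4"
  shows "norm (5 ^ m * ((phi_m1 ^^ Suc m) x)\<^sup>2) \<le> (25/4) * (4/5) ^ m"
proof -
  have "((phi_m1 ^^ Suc m) x)\<^sup>2 \<le> ((2/5) ^ Suc m * (25/4))\<^sup>2"
  proof (rule power_mono)
    have "(phi_m1 ^^ Suc m) x \<le> (2/5) ^ Suc m * x" by (rule phi_pow_bounds(2)[OF assms])
    also have "\<dots> \<le> (2/5) ^ Suc m * (25/4)" using assms by (intro mult_left_mono) auto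
    finally show "(phi_m1 ^^ Suc m) x \<le> (2/5) ^ Suc m * (25/4)" .
    show "0 \<le> (phi_m1 ^^ Suc m) x" by (rule phi_pow_bounds(1)[OF assms])
  qed
  also have "((2/5) ^ Suc m * (25/4))\<^sup>2 = (25/4 :: real) * ((2/5) ^ m)\<^sup>2"
    by (simp add: power_mult_distrib power2_eq_square)
  finally have "5 ^ m * ((phi_m1 ^^ Suc m) x)\<^sup>2 \<le> 5 ^ m * ((25/4) * ((2/5) ^ m)\<^sup>2)"
    by (intro mult_left_mono) auto
  also have "\<dots> = (25/4) * (4/5) ^ m"
  proof -
    have "5 ^ m * (((2/5::real)) ^ m)\<^sup>2 = (5 * (2/5)\<^sup>2) ^ m"
      by (simp only: power_mult_distrib power_even_eq mult.commute flip: power_mult)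
    then show ?thesis by (simp add: power2_eq_square)
  qed
  finally show ?thesis by simp
qed

definition psi_ser :: "real \<Rightarrow> real" where
  "psi_ser x = (\<Sum>m. 5 ^ m * ((phi_m1 ^^ Suc m) x)\<^sup>2)"

lemma psi_partial_sum:
  assumes "x \<le> 25/4"
  shows "5 ^ m * (phi_m1 ^^ m) x = x + (\<Sum>k<m. 5 ^ k * ((phi_m1 ^^ Suc k) x)\<^sup>2)"
proof (induction m)
  case (Suc m)
  then show ?case using five_pow_phi[OF assms, of m] by (simp only: sum.lessThan_Suc)
qed simp

lemma psi_summable:
  assumes "0 \<le> x" "x \<le> 25/4"
  shows "summable (\<lambda>m. 5 ^ m * ((phi_m1 ^^ Suc m) x)\<^sup>2)"
  by (rule summable_comparison_test[OF _ summable_mult[OF summable_geometric[of "4/5"], of "25/4"]])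
     (use psi_term_bound[OF assms] in \<open>auto simp del: funpow.simps\<close>)

lemma psi_tendsto_ser:
  assumes "0 \<le> x" "x \<le> 25/4"
  shows "(\<lambda>m. 5 ^ m * (phi_m1 ^^ m) x) \<longlonglongrightarrow> x + psi_ser x"
  unfolding psi_partial_sum[OF assms(2)] psi_ser_def
  by (intro tendsto_intros summable_LIMSEQ psi_summable assms)

lemma psi_eq:
  assumes "0 \<le> x" "x \<le> 25/4"
  shows "psi x = 3/2 * (x + psi_ser x)"
  unfolding psi_def using limI[OF psi_tendsto_ser[OF assms]] by simp

lemma psi_tendsto:
  assumes "0 \<le> x" "x \<le> 25/4"
  shows "(\<lambda>m. 3/2 * 5 ^ m * (phi_m1 ^^ m) x) \<longlonglongrightarrow> psi x"
  unfolding psi_eq[OF assms] mult.assoc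
  by (intro tendsto_mult_left psi_tendsto_ser assms)

lemma psi_strict_mono:
  assumes "0 \<le> x" "x < y" "y \<le> 25/4"
  shows "psi x < psi y"
proof -
  have "psi_ser x \<le> psi_ser y"
    unfolding psi_ser_def
    using assms
    by (intro suminf_le psi_summable mult_left_mono power_mono phi_pow_mono phi_pow_bounds(1)) auto
  then show ?thesis using assms by (simp add: psi_eq)
qed

lemma psi_0 [simp]: "psi 0 = 0"
proof -
  have "(phi_m1 ^^ m) 0 = 0" for m by (induction m) auto
  then show ?thesis using psi_tendsto[of 0] by (simp add: LIMSEQ_const_iff)
qed

lemma psi_pos: "0 < x \<Longrightarrow> x \<le> 25/4 \<Longrightarrow> 0 < psi x"
  using psi_strict_mono[of 0 x] by simp

text \<open>\<open>psi_inv\<close> inverts on all of (-\<infinity>, 25/4), whereas strict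
  monotonicity is available on [0, 25/4]; this excludes nonpositive preimages of positive
  values.\<close>

lemma psi_nonpos:
  assumes "x \<le> 0"
  shows "psi x \<le> 0"
proof -
  have np: "(phi_m1 ^^ m) x \<le> 0" for m
    using assms by (induction m) (auto intro: phi_nonpos)
  have inc: "incseq (\<lambda>m. 5 ^ m * (phi_m1 ^^ m) x)"
    using assms by (intro incseq_phi) simp
  have ub: "5 ^ m * (phi_m1 ^^ m) x \<le> 0" for m
    using np by (simp add: mult_nonneg_nonpos)
  from incseq_convergent[OF inc, of 0] ub obtain L
    where L: "(\<lambda>m. 5 ^ m * (phi_m1 ^^ m) x) \<longlonglongrightarrow> L" by blast
  then have "L \<le> 0" using ub by (intro LIMSEQ_le_const2) auto
  then show ?thesis unfolding psi_def using limI[OF L] by simp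
qed

lemma continuous_on_psi: "continuous_on {0..25/4} psi"
proof -
  have c: "continuous_on {0..25/4} (phi_m1 ^^ m)" for m
  proof (induction m)
    case 0
    then show ?case by simp
  next
    case (Suc m)
    then show ?case unfolding funpow.simps o_def phi_m1_def by (intro continuous_intros) auto
  qed
  have "uniform_limit {0..25/4} (\<lambda>n x. \<Sum>m<n. 5 ^ m * ((phi_m1 ^^ Suc m) x)\<^sup>2) psi_ser sequentially"
    unfolding psi_ser_def
    by (rule Weierstrass_m_test[OF psi_term_bound]) (auto intro!: summable_mult summable_geometric)
  then have "continuous_on {0..25/4} psi_ser"
    by (rule uniform_limit_theorem[rotated]) (auto intro!: continuous_intros always_eventually c simp del: funpow.simps)
  then have "continuous_on {0..25/4} (\<lambda>x. 3/2 * (x + psi_ser x))"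
    by (intro continuous_intros)
  then show ?thesis by (rule continuous_on_eq) (simp add: psi_eq)
qed

text \<open>A shift of the defining limit by one index: the parameter \<open>phi_m1 \<alpha>\<close>
  of a cell belongs to a fifth of the eigenvalue.\<close>

lemma psi_phi:
  assumes "0 \<le> x" "x \<le> 25/4"
  shows "psi (phi_m1 x) = psi x / 5"
proof -
  have b: "0 \<le> phi_m1 x" "phi_m1 x \<le> 25/4" using phi_nonneg phi_le assms by fastforce+
  have "(\<lambda>m. 1/5 * (3/2 * 5 ^ Suc m * (phi_m1 ^^ Suc m) x)) \<longlonglongrightarrow> 1/5 * psi x"
    by (intro tendsto_mult_left LIMSEQ_Suc psi_tendsto assms)
  moreover have "1/5 * (3/2 * 5 ^ Suc m * (phi_m1 ^^ Suc m) x) = 3/2 * 5 ^ m * (phi_m1 ^^ m) (phi_m1 x)" for m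
    by (simp add: funpow_swap1)
  ultimately have "(\<lambda>m. 3/2 * 5 ^ m * (phi_m1 ^^ m) (phi_m1 x)) \<longlonglongrightarrow> 1/5 * psi x"
    by (simp only:)
  from LIMSEQ_unique[OF psi_tendsto[OF b] this] show ?thesis by simp
qed

lemma psi_surj:
  assumes "0 \<le> l" "l < psi 6"
  obtains \<alpha> where "0 \<le> \<alpha>" "\<alpha> < 6" "psi \<alpha> = l"
proof -
  have "\<exists>x\<ge>0. x \<le> 6 \<and> psi x = l"
    using assms by (intro IVT') (auto intro: continuous_on_subset[OF continuous_on_psi])
  then obtain x where "0 \<le> x" "x \<le> 6" "psi x = l" by blast
  moreover from this have "x \<noteq> 6" using assms by auto
  ultimately show ?thesis using that[of x] by simp
qed

lemma psi_inv_psi: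
  assumes "0 < \<alpha>" "\<alpha> < 25/4"
  shows "psi_inv (psi \<alpha>) = \<alpha>"
proof -
  let ?x = "psi_inv (psi \<alpha>)"
  have im: "psi \<alpha> \<in> psi ` {..<25/4}" using assms by auto
  have 1: "psi ?x = psi \<alpha>" unfolding psi_inv_def by (rule f_inv_into_f[OF im])
  have 2: "?x < 25/4" using inv_into_into[OF im] unfolding psi_inv_def by simp
  have "psi \<alpha> > 0" using assms by (intro psi_pos) auto
  then have 3: "?x > 0" using 1 psi_nonpos[of ?x] by linarith
  show ?thesis
    using psi_strict_mono[of ?x \<alpha>] psi_strict_mono[of \<alpha> ?x] 1 2 3 assms
    by (cases ?x \<alpha> rule: linorder_cases) auto
qed

section \<open>The factor of the flux after m zooms into a vertex, and its renormalised
  limit\<close>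

primrec Rfac :: "nat \<Rightarrow> real \<Rightarrow> real" where
  "Rfac 0 \<alpha> = 1"
| "Rfac (Suc m) \<alpha> = (6 - phi_m1 \<alpha>) / ((2 - phi_m1 \<alpha>) * (5 - phi_m1 \<alpha>)) * Rfac m (phi_m1 \<alpha>)"

lemma phi_range: "0 \<le> \<alpha> \<Longrightarrow> \<alpha> < 6 \<Longrightarrow> 0 \<le> phi_m1 \<alpha> \<and> phi_m1 \<alpha> < 2"
  using phi_nonneg phi_less_2 by auto

lemma Rfac_pos: "0 \<le> \<alpha> \<Longrightarrow> \<alpha> < 6 \<Longrightarrow> 0 < Rfac m \<alpha>"
proof (induction m arbitrary: \<alpha>)
  case (Suc m)
  then show ?case using phi_range[of \<alpha>] by (auto intro!: mult_pos_pos divide_pos_pos)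
qed simp

text \<open>Each factor is at least its value 3/5 at b = 0: the difference 5 (6 - b) - 3 (2 - b) (5
  - b) equals b (16 - 3 b).\<close>

lemma Rfac_incseq:
  assumes "0 \<le> \<alpha>" "\<alpha> < 6"
  shows "incseq (\<lambda>m. (5/3) ^ m * Rfac m \<alpha>)"
proof (rule incseq_SucI)
  fix m
  have "Rfac m \<alpha> \<le> 5/3 * Rfac (Suc m) \<alpha>"
    using assms
  proof (induction m arbitrary: \<alpha>)
    case 0
    let ?b = "phi_m1 \<alpha>"
    have b: "0 \<le> ?b" "?b < 2" using phi_range 0 by auto
    have "0 \<le> ?b * (16 - 3 * ?b)" using b by (intro mult_nonneg_nonneg) auto
    then have "3 * ((2 - ?b) * (5 - ?b)) \<le> 5 * (6 - ?b)" by (simp add: algebra_simps)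
    moreover have "(2 - ?b) * (5 - ?b) > 0" using b by (intro mult_pos_pos) auto
    ultimately show ?case by (simp add: le_divide_eq)
  next
    case (Suc m)
    let ?b = "phi_m1 \<alpha>"
    let ?r = "(6 - ?b) / ((2 - ?b) * (5 - ?b))"
    have b: "0 \<le> ?b" "?b < 2" using phi_range Suc.prems by auto
    then have "?r * Rfac m ?b \<le> ?r * (5/3 * Rfac (Suc m) ?b)"
      by (intro mult_left_mono Suc.IH divide_nonneg_nonneg mult_nonneg_nonneg) auto
    then show ?case by (simp only: Rfac.simps(2)[of _ \<alpha>] mult.left_commute)
  qed
  then have "(5/3) ^ m * Rfac m \<alpha> \<le> (5/3) ^ m * (5/3 * Rfac (Suc m) \<alpha>)"
    by (intro mult_left_mono) auto
  then show "(5/3) ^ m * Rfac m \<alpha> \<le> (5/3) ^ Suc m * Rfac (Suc m) \<alpha>"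
    by (simp only: power_Suc2 mult.assoc)
qed

text \<open>Since \<alpha> = b (5 - b) and 6 - \<alpha> = (2 - b) (3 - b), multiplication by (6 -
  \<alpha>) \<alpha> makes the product telescope and leaves a factor 3 - b \<le> 3 per level. As the
  iterates are O(5^(-m)), the right-hand side is O((3/5)^m).\<close>

lemma Rfac_bound:
  assumes "0 < \<alpha>" "\<alpha> < 6"
  shows "Rfac m \<alpha> * ((6 - \<alpha>) * \<alpha>) \<le> 3 ^ m * ((phi_m1 ^^ m) \<alpha> * (6 - (phi_m1 ^^ m) \<alpha>))"
  using assms
proof (induction m arbitrary: \<alpha>)
  case 0
  then show ?case by simp
next
  case (Suc m)
  let ?b = "phi_m1 \<alpha>"
  let ?z = "(phi_m1 ^^ m) ?b"
  have b: "0 < ?b" "?b < 2" using phi_pos phi_less_2 Suc.prems by auto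
  have q: "\<alpha> = ?b * (5 - ?b)" using phi_quad[of \<alpha>] Suc.prems by simp
  have q6: "6 - \<alpha> = (2 - ?b) * (3 - ?b)" by (subst q) (simp add: algebra_simps)
  have "Rfac (Suc m) \<alpha> * ((6 - \<alpha>) * \<alpha>) = (3 - ?b) * (Rfac m ?b * ((6 - ?b) * ?b))"
  proof -
    define x where "x = 1 / ((2 - ?b) * (5 - ?b))"
    have x: "x * ((2 - ?b) * (5 - ?b)) = 1" using b by (simp add: x_def)
    have "Rfac (Suc m) \<alpha> * ((6 - \<alpha>) * \<alpha>) = (6 - ?b) * x * Rfac m ?b * (((2 - ?b) * (3 - ?b)) * (?b * (5 - ?b)))"
      unfolding q6 by (subst (2) q) (simp add: x_def)
    also have "\<dots> = (3 - ?b) * (Rfac m ?b * ((6 - ?b) * ?b))" using x by algebra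
    finally show ?thesis .
  qed
  also have "\<dots> \<le> 3 * (3 ^ m * (?z * (6 - ?z)))"
  proof (rule mult_mono)
    show "Rfac m ?b * ((6 - ?b) * ?b) \<le> 3 ^ m * (?z * (6 - ?z))" using Suc.IH b by auto
    show "0 \<le> Rfac m ?b * ((6 - ?b) * ?b)" using Rfac_pos[of ?b m] b by (auto intro!: mult_nonneg_nonneg)
  qed (use b in auto)
  finally show ?case by (simp add: funpow_swap1)
qed

lemma Rfac_limit:
  assumes "0 \<le> \<alpha>" "\<alpha> < 6"
  obtains K where "K \<ge> 1" "(\<lambda>m. (5/3) ^ m * Rfac m \<alpha>) \<longlonglongrightarrow> K"
proof -
  have "\<exists>B. \<forall>m. (5/3) ^ m * Rfac m \<alpha> \<le> B"
  \<comment> \<open>The estimate from \<open>Rfac_bound\<close> is divided by \<alpha>, so the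
    harmonic case is computed directly.\<close>
  proof (cases "\<alpha> = 0")
    case True
    have "Rfac m 0 = (3/5) ^ m" for m by (induction m) auto
    then have "(5/3) ^ m * Rfac m \<alpha> \<le> 1" for m
      using True by (simp flip: power_mult_distrib)
    then show ?thesis by blast
  next
    case False
    have a: "0 < \<alpha>" "\<alpha> \<le> 25/4" using False assms by auto
    define C where "C = \<alpha> + psi_ser \<alpha>"
    have C: "5 ^ m * (phi_m1 ^^ m) \<alpha> \<le> C" for m
      unfolding C_def by (rule incseq_le[OF incseq_phi psi_tendsto_ser]) (use a in auto)
    have "(5/3) ^ m * Rfac m \<alpha> \<le> C * 6 / ((6 - \<alpha>) * \<alpha>)" for m
    proof -
      let ?z = "(phi_m1 ^^ m) \<alpha>"
      have z: "0 \<le> ?z" using phi_pow_bounds(1)[of \<alpha> m] a by simp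
      have "(5/3) ^ m * (Rfac m \<alpha> * ((6 - \<alpha>) * \<alpha>)) \<le> (5/3) ^ m * (3 ^ m * (?z * (6 - ?z)))"
        using Rfac_bound[of \<alpha> m] a assms by (intro mult_left_mono) auto
      also have "\<dots> = (5 ^ m * ?z) * (6 - ?z)" by (simp add: power_divide)
      also have "\<dots> \<le> (5 ^ m * ?z) * 6" using z by (intro mult_left_mono) auto
      also have "\<dots> \<le> C * 6" using C by simp
      finally have "(5/3) ^ m * Rfac m \<alpha> * ((6 - \<alpha>) * \<alpha>) \<le> C * 6" by (simp add: mult.assoc)
      then show ?thesis using a assms by (subst pos_le_divide_eq) auto
    qed
    then show ?thesis by blast
  qed
  then obtain B where "\<forall>m. (5/3) ^ m * Rfac m \<alpha> \<le> B" by blast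
  from incseq_convergent[OF Rfac_incseq[OF assms] this] obtain K
    where K: "(\<lambda>m. (5/3) ^ m * Rfac m \<alpha>) \<longlonglongrightarrow> K" "\<forall>m. (5/3) ^ m * Rfac m \<alpha> \<le> K" by blast
  from K(2)[rule_format, of 0] have "K \<ge> 1" by simp
  then show ?thesis using K that by blast
qed

context gasket
begin

lemma funpow_sgF_in_SG: "x \<in> SG p \<Longrightarrow> (sgF p j ^^ m) x \<in> SG p"
  by (induction m) auto

lemma vflux_cong: "(\<And>x. x \<in> SG p \<Longrightarrow> u x = v x) \<Longrightarrow> vflux p m u j = vflux p m v j"
  unfolding vflux_def by (auto simp: funpow_sgF_in_SG intro!: sum.cong)

text \<open>Exact at every level. The second term is the share of one cell in the eigenvalue term at
  a junction; multiplied by (5/3)^m it is O(3^(-m)), so only the flux is left in the normal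
  derivative.\<close>

lemma vflux_U:
  assumes "0 \<le> \<alpha>" "\<alpha> < 6"
  shows "vflux p m (U \<alpha> a) j = Rfac m \<alpha> * flux \<alpha> a j + (phi_m1 ^^ m) \<alpha> / 2 * a $ j"
  using assms
proof (induction m arbitrary: \<alpha> a)
  case 0
  have "(\<Sum>k\<in>-{j}. a $ k) = csum a - a $ j"
    unfolding csum_def by (simp add: Compl_eq_Diff_UNIV sum_diff1)
  moreover have "vflux p 0 (U \<alpha> a) j = 2 * a $ j - (\<Sum>k\<in>-{j}. a $ k)"
    by (simp add: vflux_def)
  ultimately show ?case by (simp add: flux_def field_simps)
next
  case (Suc m)
  let ?b = "phi_m1 \<alpha>"
  have b: "0 \<le> ?b" "?b < 2" using phi_range Suc.prems by auto
  have q: "\<alpha> = ?b * (5 - ?b)" using phi_quad[of \<alpha>] Suc.prems by simp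
  have "vflux p (Suc m) (U \<alpha> a) j = vflux p m (U ?b (tstep ?b j a)) j"
    unfolding vflux_Suc by (rule vflux_cong) (use Suc.prems in \<open>simp add: U_cell\<close>)
  also have "\<dots> = Rfac m ?b * flux ?b (tstep ?b j a) j + (phi_m1 ^^ m) ?b / 2 * a $ j"
    using Suc.IH b by simp
  also have "\<dots> = Rfac (Suc m) \<alpha> * flux \<alpha> a j + (phi_m1 ^^ Suc m) \<alpha> / 2 * a $ j"
    using flux_tstep_same[OF b(2), of j a] q by (simp add: funpow_swap1)
  finally show ?case .
qed

lemma flux_junction:
  assumes "0 \<le> \<alpha>" "\<alpha> < 6" "i \<noteq> j"
  defines "b \<equiv> phi_m1 \<alpha>"
  shows "flux b (tstep b i a) j = - flux b (tstep b j a) i"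
  using phi_range[OF assms(1,2)] assms(3) unfolding b_def
  by (subst (1 2) flux_tstep_other) (auto simp: right_diff_distrib)

text \<open>At a junction the two fluxes cancel and the two halves of the eigenvalue term add up; at
  all other points the equation is inherited from the cell.\<close>

lemma graph_lap_U:
  assumes "0 \<le> \<alpha>" "\<alpha> < 6" "x \<in> Vm p m - V0 p"
  shows "graph_lap p m (U \<alpha> a) x = - (phi_m1 ^^ m) \<alpha> * U \<alpha> a x"
  using assms
proof (induction m arbitrary: \<alpha> a x)
  case 0
  then show ?case by (simp add: Vm_0)
next
  case (Suc m)
  let ?b = "phi_m1 \<alpha>"
  have b: "0 \<le> ?b" "?b < 2" using phi_range Suc.prems by auto
  have cellU: "(U \<alpha> a \<circ> sgF p i) y = U ?b (tstep ?b i a) y" if "y \<in> SG p" for i y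
    using Suc.prems that by (simp add: U_cell)
  show ?case
    using Suc.prems(3)
  proof (cases rule: Vm_Suc_cases)
    case (cell i y)
    then have y: "y \<in> SG p" "y \<notin> V0 p" using Vm_in_SG by auto
    have "graph_lap p (Suc m) (U \<alpha> a) x = graph_lap p m (U ?b (tstep ?b i a)) y"
      unfolding cell(2) graph_lap_cell[OF y] by (rule graph_lap_cong[OF y(1)]) (rule cellU)
    also have "\<dots> = - (phi_m1 ^^ m) ?b * U ?b (tstep ?b i a) y"
      using Suc.IH[of ?b y] b cell(1) by simp
    finally show ?thesis
      unfolding cell(2) using Suc.prems(1,2) y(1) by (simp add: U_cell funpow_swap1)
  next
    case (junction i j)
    have vf: "vflux p m (U \<alpha> a \<circ> sgF p i) j = vflux p m (U ?b (tstep ?b i a)) j" for i j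
      by (rule vflux_cong) (rule cellU)
    have "graph_lap p (Suc m) (U \<alpha> a) x =
       - vflux p m (U ?b (tstep ?b i a)) j - vflux p m (U ?b (tstep ?b j a)) i"
      unfolding junction(2) graph_lap_junction[OF junction(1)] vf ..
    also have "\<dots> = - (phi_m1 ^^ m) ?b * tstep ?b i a $ j"
      using b flux_junction[OF Suc.prems(1,2) junction(1), of a]
      by (simp add: vflux_U tstep_commute[of _ j])
    finally show ?thesis
      unfolding junction(2) using Suc.prems(1,2) by (simp add: U_junction funpow_swap1)
  qed
qed

lemma vflux_U_tendsto:
  assumes "0 \<le> \<alpha>" "\<alpha> < 6"
  obtains K where "K \<ge> 1" "\<And>a j. (\<lambda>m. (5/3) ^ m * vflux p m (U \<alpha> a) j) \<longlonglongrightarrow> K * flux \<alpha> a j"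
proof -
  obtain K where K: "K \<ge> 1" "(\<lambda>m. (5/3) ^ m * Rfac m \<alpha>) \<longlonglongrightarrow> K"
    using Rfac_limit[OF assms] by blast
  have "(\<lambda>m. (5/3) ^ m * vflux p m (U \<alpha> a) j) \<longlonglongrightarrow> K * flux \<alpha> a j" for a j
  proof -
    have "(\<lambda>m. (1/3) ^ m * (5 ^ m * (phi_m1 ^^ m) \<alpha>)) \<longlonglongrightarrow> 0 * (\<alpha> + psi_ser \<alpha>)"
      by (rule tendsto_mult[OF LIMSEQ_power_zero psi_tendsto_ser]) (use assms in auto)
    from tendsto_add[OF tendsto_mult_right[OF K(2)] tendsto_mult_right[OF this]]
    have "(\<lambda>m. (5/3) ^ m * Rfac m \<alpha> * flux \<alpha> a j + (1/3) ^ m * (5 ^ m * (phi_m1 ^^ m) \<alpha>) * (a $ j / 2))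
      \<longlonglongrightarrow> K * flux \<alpha> a j + 0 * (\<alpha> + psi_ser \<alpha>) * (a $ j / 2)" .
    moreover have "(5/3) ^ m * vflux p m (U \<alpha> a) j =
      (5/3) ^ m * Rfac m \<alpha> * flux \<alpha> a j + (1/3) ^ m * (5 ^ m * (phi_m1 ^^ m) \<alpha>) * (a $ j / 2)" for m
      using vflux_U[OF assms, of m a j] by (simp add: power_divide distrib_left)
    ultimately show ?thesis by simp
  qed
  then show ?thesis using K that by blast
qed

end

section \<open>The eigenspaces below the first Dirichlet eigenvalue\<close>

context gasket
begin

section \<open>The Laplacian as a uniform limit, and its uniqueness\<close>

lemma has_laplacian_iff:
  assumes "u \<in> C_SG p" "f \<in> C_SG p"
  shows "has_laplacian p u f \<longleftrightarrow>
    (\<forall>e>0. \<exists>m0. \<forall>m\<ge>m0. \<forall>x\<in>Vm p m - V0 p. \<bar>3/2 * 5^m * graph_lap p m u x - f x\<bar> \<le> e)"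
proof
  let ?A = "\<lambda>m. (\<lambda>x. \<bar>3/2 * 5^m * graph_lap p m u x - f x\<bar>) ` (Vm p m - V0 p)"
  have fin: "finite (?A m)" for m using finite_Vm by blast
  {
    assume "has_laplacian p u f"
    then have lim: "(\<lambda>m. Max (?A m)) \<longlonglongrightarrow> 0" unfolding has_laplacian_def by blast
    show "\<forall>e>0. \<exists>m0. \<forall>m\<ge>m0. \<forall>x\<in>Vm p m - V0 p. \<bar>3/2 * 5^m * graph_lap p m u x - f x\<bar> \<le> e"
    proof (intro allI impI)
      fix e :: real assume "e > 0"
      then obtain m0 where m0: "\<And>m. m \<ge> m0 \<Longrightarrow> \<bar>Max (?A m)\<bar> < e"
        using LIMSEQ_D[OF lim] by fastforce
      have "\<bar>3/2 * 5^m * graph_lap p m u x - f x\<bar> \<le> e" if "m \<ge> m0" "x \<in> Vm p m - V0 p" for m x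
      proof -
        have "\<bar>3/2 * 5^m * graph_lap p m u x - f x\<bar> \<le> Max (?A m)"
          using that by (intro Max_ge fin) blast
        then show ?thesis using m0[OF that(1)] by linarith
      qed
      then show "\<exists>m0. \<forall>m\<ge>m0. \<forall>x\<in>Vm p m - V0 p. \<bar>3/2 * 5^m * graph_lap p m u x - f x\<bar> \<le> e" by blast
    qed
  }
  {
    assume r: "\<forall>e>0. \<exists>m0. \<forall>m\<ge>m0. \<forall>x\<in>Vm p m - V0 p. \<bar>3/2 * 5^m * graph_lap p m u x - f x\<bar> \<le> e"
    have "(\<lambda>m. Max (?A m)) \<longlonglongrightarrow> 0"
    proof (rule LIMSEQ_I)
      fix e :: real assume "e > 0"
      then obtain m0 where m0: "\<forall>m\<ge>m0. \<forall>x\<in>Vm p m - V0 p. \<bar>3/2 * 5^m * graph_lap p m u x - f x\<bar> \<le> e / 2"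
        using r half_gt_zero by blast
      \<comment> \<open>Level 0 is excluded because V_0 - V_0 is empty and \<open>Max\<close> of the
        empty set is unspecified.\<close>
      have "norm (Max (?A m) - 0) < e" if m: "m \<ge> max m0 1" for m
      proof -
        have "sgF p 1 (p 2) \<in> Vm p m - V0 p"
          using junction_in_V1 Vm_mono[of 1 m] junction_notin_V0[of 1 2] m by auto
        then have ne: "?A m \<noteq> {}" by blast
        then have "Max (?A m) \<in> ?A m" using fin by (intro Max_in)
        then have "0 \<le> Max (?A m)" "Max (?A m) \<le> e / 2" using m0 m by auto
        then show ?thesis using \<open>e > 0\<close> by simp
      qed
      then show "\<exists>m0. \<forall>m\<ge>m0. norm (Max (?A m) - 0) < e" by blast
    qed
    then show "has_laplacian p u f" using assms unfolding has_laplacian_def by blast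
  }
qed

text \<open>At a point of some V_k off V_0 both functions are limits of the same sequence;
  continuity and density extend the equality, also to V_0. This validates the definite description
  in \<open>laplacian\<close>.\<close>

lemma has_laplacian_unique:
  assumes f: "has_laplacian p u f" and g: "has_laplacian p u g"
  shows "f = g"
proof -
  have C: "u \<in> C_SG p" "f \<in> C_SG p" "g \<in> C_SG p" using f g unfolding has_laplacian_def by auto
  have V: "f x = g x" if x: "x \<in> Vm p k - V0 p" for k x
  proof (rule ccontr)
    assume ne: "f x \<noteq> g x"
    define e where "e = \<bar>f x - g x\<bar> / 3"
    have e: "e > 0" using ne by (simp add: e_def)
    obtain m1 where m1: "\<forall>m\<ge>m1. \<forall>x\<in>Vm p m - V0 p. \<bar>3/2 * 5^m * graph_lap p m u x - f x\<bar> \<le> e"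
      using has_laplacian_iff[OF C(1,2)] f e by blast
    obtain m2 where m2: "\<forall>m\<ge>m2. \<forall>x\<in>Vm p m - V0 p. \<bar>3/2 * 5^m * graph_lap p m u x - g x\<bar> \<le> e"
      using has_laplacian_iff[OF C(1,3)] g e by blast
    define m where "m = max k (max m1 m2)"
    have "x \<in> Vm p m - V0 p" "m \<ge> m1" "m \<ge> m2" using x Vm_mono[of k m p] by (auto simp: m_def)
    then have "\<bar>3/2 * 5^m * graph_lap p m u x - f x\<bar> \<le> e" "\<bar>3/2 * 5^m * graph_lap p m u x - g x\<bar> \<le> e"
      using m1 m2 by auto
    then have "\<bar>f x - g x\<bar> \<le> 2 * e" by linarith
    moreover have "\<bar>f x - g x\<bar> = 3 * e" by (simp add: e_def)
    ultimately show False using e by linarith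
  qed
  have "\<bar>f x - g x\<bar> \<le> 0" if "x \<in> SG p" for x
    by (rule continuous_le_by_density[OF _ _ that])
       (use C V in \<open>auto simp: C_SG_def intro!: continuous_intros\<close>)
  then show ?thesis
    using C unfolding C_SG_def by (intro extensionalityI[of f "SG p" g]) auto
qed

text \<open>The eigenvalue condition without the definite description: the candidate for the
  Laplacian is -l u itself. Values off the gasket do not enter, so it applies to \<open>U\<close>
  before restriction.\<close>

definition aeig :: "real \<Rightarrow> (real^2 \<Rightarrow> real) \<Rightarrow> bool" where
  "aeig l u \<longleftrightarrow>
    (\<forall>e>0. \<exists>m0. \<forall>m\<ge>m0. \<forall>x\<in>Vm p m - V0 p. \<bar>3/2 * 5^m * graph_lap p m u x + l * u x\<bar> \<le> e)"

lemma eigenspace_iff: "u \<in> eigenspace p l \<longleftrightarrow> u \<in> C_SG p \<and> aeig l u"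
proof
  assume u: "u \<in> eigenspace p l"
  then obtain f where f: "has_laplacian p u f" unfolding eigenspace_def dom_lap_def by blast
  then have "laplacian p u = f"
    unfolding laplacian_def using has_laplacian_unique by blast
  then have fl: "f x = - l * u x" if "x \<in> SG p - V0 p" for x
    using u that unfolding eigenspace_def by force
  have C: "u \<in> C_SG p" "f \<in> C_SG p" using f unfolding has_laplacian_def by auto
  have "\<bar>3/2 * 5^m * graph_lap p m u x + l * u x\<bar> = \<bar>3/2 * 5^m * graph_lap p m u x - f x\<bar>"
    if "x \<in> Vm p m - V0 p" for m x
    using fl[of x] that Vm_in_SG by auto
  then show "u \<in> C_SG p \<and> aeig l u"
    using C f unfolding has_laplacian_iff[OF C] aeig_def by auto
next
  assume u: "u \<in> C_SG p \<and> aeig l u"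
  define f where "f = restrict (\<lambda>x. - l * u x) (SG p)"
  have C: "u \<in> C_SG p" "f \<in> C_SG p"
    using u unfolding C_SG_def f_def
    by (auto intro!: continuous_intros cong: continuous_on_cong)
  have "\<bar>3/2 * 5^m * graph_lap p m u x + l * u x\<bar> = \<bar>3/2 * 5^m * graph_lap p m u x - f x\<bar>"
    if "x \<in> Vm p m - V0 p" for m x
    using that Vm_in_SG by (auto simp: f_def)
  then have f: "has_laplacian p u f"
    using u unfolding has_laplacian_iff[OF C] aeig_def by auto
  then have "laplacian p u = f"
    unfolding laplacian_def using has_laplacian_unique by blast
  then show "u \<in> eigenspace p l"
    using f unfolding eigenspace_def dom_lap_def by (auto simp: f_def)
qed

lemma aeig_cong: "(\<And>x. x \<in> SG p \<Longrightarrow> u x = v x) \<Longrightarrow> aeig l u = aeig l v"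
proof -
  assume uv: "\<And>x. x \<in> SG p \<Longrightarrow> u x = v x"
  have "(\<forall>x\<in>Vm p m - V0 p. \<bar>3/2 * 5^m * graph_lap p m u x + l * u x\<bar> \<le> e) \<longleftrightarrow>
    (\<forall>x\<in>Vm p m - V0 p. \<bar>3/2 * 5^m * graph_lap p m v x + l * v x\<bar> \<le> e)" for m e
  proof (rule ball_cong[OF refl])
    fix x assume "x \<in> Vm p m - V0 p"
    then have "x \<in> SG p" using Vm_in_SG by blast
    then show "\<bar>3/2 * 5^m * graph_lap p m u x + l * u x\<bar> \<le> e \<longleftrightarrow>
      \<bar>3/2 * 5^m * graph_lap p m v x + l * v x\<bar> \<le> e"
      using graph_lap_cong[of x p u v m] uv by simp
  qed
  then show ?thesis unfolding aeig_def by (simp only:)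
qed

lemma aeig_diff:
  assumes "aeig l u" "aeig l v"
  shows "aeig l (\<lambda>x. u x - v x)"
  unfolding aeig_def
proof (intro allI impI)
  fix e :: real assume "e > 0"
  then obtain m1 m2 where m:
    "\<forall>m\<ge>m1. \<forall>x\<in>Vm p m - V0 p. \<bar>3/2 * 5^m * graph_lap p m u x + l * u x\<bar> \<le> e / 2"
    "\<forall>m\<ge>m2. \<forall>x\<in>Vm p m - V0 p. \<bar>3/2 * 5^m * graph_lap p m v x + l * v x\<bar> \<le> e / 2"
    using assms unfolding aeig_def by (meson half_gt_zero)
  have "\<bar>3/2 * 5^m * graph_lap p m (\<lambda>x. u x - v x) x + l * (u x - v x)\<bar> \<le> e"
    if h: "m \<ge> max m1 m2" "x \<in> Vm p m - V0 p" for m x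
  proof -
    have e: "3/2 * 5^m * graph_lap p m (\<lambda>x. u x - v x) x + l * (u x - v x) =
      (3/2 * 5^m * graph_lap p m u x + l * u x) - (3/2 * 5^m * graph_lap p m v x + l * v x)"
      unfolding graph_lap_diff right_diff_distrib by linarith
    have "\<bar>3/2 * 5^m * graph_lap p m u x + l * u x\<bar> \<le> e / 2"
      "\<bar>3/2 * 5^m * graph_lap p m v x + l * v x\<bar> \<le> e / 2"
      using m h by auto
    then show ?thesis unfolding e by linarith
  qed
  then show "\<exists>m0. \<forall>m\<ge>m0. \<forall>x\<in>Vm p m - V0 p. \<bar>3/2 * 5^m * graph_lap p m (\<lambda>x. u x - v x) x + l * (u x - v x)\<bar> \<le> e"
    by blast
qed

lemma aeig_minus: "aeig l u \<Longrightarrow> aeig l (\<lambda>x. - u x)"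
proof -
  have "\<bar>3/2 * 5^m * graph_lap p m (\<lambda>x. - u x) x + l * - u x\<bar> = \<bar>3/2 * 5^m * graph_lap p m u x + l * u x\<bar>" for m x
    using abs_minus_cancel[of "3/2 * 5^m * graph_lap p m u x + l * u x"]
    by (simp add: graph_lap_minus)
  then show "aeig l u \<Longrightarrow> aeig l (\<lambda>x. - u x)" unfolding aeig_def by simp
qed

lemma aeig_spectral:
  assumes "continuous_on (SG p) u" "\<And>m x. x \<in> Vm p m - V0 p \<Longrightarrow> graph_lap p m u x = - c m * u x"
    and L: "(\<lambda>m. 3/2 * 5^m * c m) \<longlonglongrightarrow> L"
  shows "aeig L u"
  unfolding aeig_def
proof (intro allI impI)
  fix e :: real assume e: "e > 0"
  have "bounded (u ` SG p)"
    by (intro compact_imp_bounded compact_continuous_image assms SG_compact)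
  then obtain B where B: "B > 0" "\<And>x. x \<in> SG p \<Longrightarrow> \<bar>u x\<bar> \<le> B"
    unfolding bounded_pos by auto
  obtain m0 where m0: "\<And>m. m \<ge> m0 \<Longrightarrow> \<bar>3/2 * 5^m * c m - L\<bar> < e / B"
    using LIMSEQ_D[OF L, of "e / B"] e B(1) by (auto simp: real_norm_def)
  have "\<bar>3/2 * 5^m * graph_lap p m u x + L * u x\<bar> \<le> e" if h: "m \<ge> m0" "x \<in> Vm p m - V0 p" for m x
  proof -
    have "3/2 * 5^m * graph_lap p m u x + L * u x = - ((3/2 * 5^m * c m - L) * u x)"
      using assms(2)[OF h(2)] by (simp add: algebra_simps)
    then have "\<bar>3/2 * 5^m * graph_lap p m u x + L * u x\<bar> = \<bar>3/2 * 5^m * c m - L\<bar> * \<bar>u x\<bar>"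
      by (simp only: abs_minus_cancel abs_mult)
    also have "\<dots> \<le> (e / B) * B"
      using m0[OF h(1)] B h(2) Vm_in_SG e by (intro mult_mono) auto
    finally show ?thesis using B(1) by simp
  qed
  then show "\<exists>m0. \<forall>m\<ge>m0. \<forall>x\<in>Vm p m - V0 p. \<bar>3/2 * 5^m * graph_lap p m u x + L * u x\<bar> \<le> e" by blast
qed

lemma aeig_U:
  assumes "0 \<le> \<alpha>" "\<alpha> < 6"
  shows "aeig (psi \<alpha>) (U \<alpha> a)"
proof (rule aeig_spectral[where c = "\<lambda>m. (phi_m1 ^^ m) \<alpha>"])
  show "continuous_on (SG p) (U \<alpha> a)" using assms by (intro U_continuous) auto
  show "(\<lambda>m. 3/2 * 5^m * (phi_m1 ^^ m) \<alpha>) \<longlonglongrightarrow> psi \<alpha>"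
    using assms by (intro psi_tendsto) auto
qed (rule graph_lap_U[OF assms])

text \<open>Comparison with a positive eigenfunction \<open>v\<close> of a larger eigenvalue: where \<open>u / v\<close> is
  maximal on \<open>V\<^sub>m\<close>, the graph Laplacian of \<open>u\<close> is too negative.\<close>

lemma aeig_nonpos:
  assumes u: "continuous_on (SG p) u" "aeig l u" "\<And>x. x \<in> V0 p \<Longrightarrow> u x = 0"
    and \<beta>: "0 \<le> \<beta>" "\<beta> < 6" "l < psi \<beta>" and x: "x \<in> SG p"
  shows "u x \<le> 0"
proof (rule ccontr)
  assume "\<not> u x \<le> 0"
  then obtain k y where y: "y \<in> Vm p k - V0 p" "u y > 0"
    using continuous_le_by_density[OF u(1), of 0 x] x by (meson not_le)
  define v where "v = U \<beta> (\<chi> j. 1)"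
  have v: "1 \<le> v z" if "z \<in> SG p" for z
    unfolding v_def by (rule U_ge[OF \<beta>(1,2) _ _ that]) auto
  \<comment> \<open>The maximal quotient on V_m is at least \<kappa> at every level m \<ge> k, so
    the contradiction is uniform in m.\<close>
  define \<kappa> where "\<kappa> = u y / v y"
  have \<kappa>: "\<kappa> > 0" using y v[of y] Vm_in_SG unfolding \<kappa>_def by (auto intro!: divide_pos_pos)
  \<comment> \<open>Half of the lower bound (psi \<beta> - l) / 2 * \<kappa> that the defect at a
    point of maximal quotient has for large m.\<close>
  define e where "e = (psi \<beta> - l) / 2 * \<kappa> / 2"
  have e: "e > 0" using \<beta>(3) \<kappa> by (simp add: e_def)
  obtain m1 where m1: "\<forall>m\<ge>m1. \<forall>x\<in>Vm p m - V0 p. \<bar>3/2 * 5^m * graph_lap p m u x + l * u x\<bar> \<le> e"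
    using u(2) e unfolding aeig_def by blast
  have "(\<lambda>m. 3/2 * 5^m * (phi_m1 ^^ m) \<beta>) \<longlonglongrightarrow> psi \<beta>"
    using \<beta> by (intro psi_tendsto) auto
  moreover have "psi \<beta> > (psi \<beta> + l) / 2" using \<beta>(3) by simp
  ultimately obtain m2 where m2: "\<And>m. m \<ge> m2 \<Longrightarrow> (psi \<beta> + l) / 2 < 3/2 * 5^m * (phi_m1 ^^ m) \<beta>"
    unfolding order_tendsto_iff eventually_sequentially by blast
  define m where "m = max k (max m1 m2)"
  have ym: "y \<in> Vm p m" using y Vm_mono[of k m p] by (auto simp: m_def)
  obtain q where q: "q \<in> Vm p m" "\<And>z. z \<in> Vm p m \<Longrightarrow> u z / v z \<le> u q / v q"
  proof -
    let ?A = "(\<lambda>z. u z / v z) ` Vm p m"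
    have "Max ?A \<in> ?A" using finite_Vm[of p m] ym by (intro Max_in) auto
    then obtain q where "q \<in> Vm p m" "Max ?A = u q / v q" by blast
    moreover have "u z / v z \<le> Max ?A" if "z \<in> Vm p m" for z
      using finite_Vm[of p m] that by (intro Max_ge) auto
    ultimately show ?thesis using that by metis
  qed
  define M where "M = u q / v q"
  have M: "\<kappa> \<le> M" using q(2)[OF ym] by (simp add: \<kappa>_def M_def)
  have vq: "1 \<le> v q" using v q Vm_in_SG by blast
  have uq: "u q = M * v q" using vq by (simp add: M_def)
  have uz: "u z \<le> M * v z" if "z \<in> Vm p m" for z
    using q(2)[OF that] v[of z] Vm_in_SG[OF that] by (simp add: M_def pos_divide_le_eq)
  have "M * v q \<ge> \<kappa> * 1" using M vq \<kappa> by (intro mult_mono) auto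
  then have uq_ge: "u q \<ge> \<kappa>" using uq by simp
  then have q0: "q \<in> Vm p m - V0 p" using u(3)[of q] q \<kappa> by auto
  \<comment> \<open>On V_m the function u is at most M v, with equality at q, so its differences at
    q are dominated by those of M v.\<close>
  have "graph_lap p m u q \<le> (\<Sum>z | nbr p m q z. M * (v z - v q))"
    unfolding graph_lap_def by (rule sum_mono) (use uz uq nbr_Vm in \<open>force simp: algebra_simps\<close>)
  also have "\<dots> = M * graph_lap p m v q" by (simp add: graph_lap_def sum_distrib_left)
  also have "\<dots> = - (phi_m1 ^^ m) \<beta> * u q"
    using graph_lap_U[OF \<beta>(1,2) q0] uq by (simp add: v_def)
  finally have "3/2 * 5^m * graph_lap p m u q \<le> 3/2 * 5^m * (- (phi_m1 ^^ m) \<beta> * u q)"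
    by (intro mult_left_mono) auto
  moreover have "\<bar>3/2 * 5^m * graph_lap p m u q + l * u q\<bar> \<le> e"
    using m1 q0 by (auto simp: m_def)
  ultimately have "(3/2 * 5^m * (phi_m1 ^^ m) \<beta> - l) * u q \<le> e"
    by (simp add: algebra_simps)
  moreover have "(psi \<beta> - l) / 2 * \<kappa> \<le> (3/2 * 5^m * (phi_m1 ^^ m) \<beta> - l) * u q"
  proof (rule mult_mono)
    have "m \<ge> m2" by (simp add: m_def)
    from m2[OF this] \<beta>(3) show "(psi \<beta> - l) / 2 \<le> 3/2 * 5^m * (phi_m1 ^^ m) \<beta> - l"
      "0 \<le> 3/2 * 5^m * (phi_m1 ^^ m) \<beta> - l" by argo+
  qed (use uq_ge \<kappa> in auto)
  ultimately show False using e unfolding e_def by linarith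
qed

text \<open>For l \<ge> 0 the comparison eigenvalue is the midpoint between l and
  \<open>psi 6\<close>, which \<open>psi\<close> attains; for negative l the harmonic parameter 0
  suffices. Comparison of both u and -u gives equality.\<close>

lemma aeig_zero:
  assumes "continuous_on (SG p) u" "aeig l u" "\<And>x. x \<in> V0 p \<Longrightarrow> u x = 0" "l < psi 6" "x \<in> SG p"
  shows "u x = 0"
proof -
  obtain \<beta> where \<beta>: "0 \<le> \<beta>" "\<beta> < 6" "l < psi \<beta>"
  proof (cases "l < 0")
    case True
    then show ?thesis using that[of 0] by simp
  next
    case False
    then have "0 \<le> (l + psi 6) / 2" "(l + psi 6) / 2 < psi 6" "l < (l + psi 6) / 2"
      using assms(4) by auto
    then show ?thesis using psi_surj that by metis
  qed
  have "u x \<le> 0" by (rule aeig_nonpos[OF assms(1-3) \<beta> assms(5)])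
  moreover have "- u x \<le> 0"
    by (rule aeig_nonpos[OF _ aeig_minus _ \<beta> assms(5)])
       (use assms in \<open>auto intro!: continuous_intros\<close>)
  ultimately show ?thesis by simp
qed

section \<open>The eigenspaces parametrised by boundary values\<close>

abbreviation UR :: "real \<Rightarrow> real^3 \<Rightarrow> real^2 \<Rightarrow> real" where
  "UR \<alpha> a \<equiv> restrict (U \<alpha> a) (SG p)"

lemma psi_less_6: "0 \<le> \<alpha> \<Longrightarrow> \<alpha> < 6 \<Longrightarrow> psi \<alpha> < psi 6"
  using psi_strict_mono[of \<alpha> 6] by simp

lemma restrict_C_SG: "continuous_on (SG p) u \<Longrightarrow> restrict u (SG p) \<in> C_SG p"
  unfolding C_SG_def by (auto cong: continuous_on_cong)

lemma UR_eigenspace: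
  assumes "0 \<le> \<alpha>" "\<alpha> < 6"
  shows "UR \<alpha> a \<in> eigenspace p (psi \<alpha>)"
  unfolding eigenspace_iff
  using restrict_C_SG[OF U_continuous] aeig_cong[of "UR \<alpha> a" "U \<alpha> a"] aeig_U assms by auto

lemma eigenspace_eq_UR:
  assumes "0 \<le> \<alpha>" "\<alpha> < 6" "u \<in> eigenspace p (psi \<alpha>)"
  shows "u = UR \<alpha> (tauD p u)"
proof (rule extensionalityI[of _ "SG p"])
  have u: "u \<in> C_SG p" "aeig (psi \<alpha>) u" using assms(3) eigenspace_iff by auto
  then show "u \<in> extensional (SG p)" unfolding C_SG_def by simp
  fix x assume x: "x \<in> SG p"
  have "u x - U \<alpha> (tauD p u) x = 0"
  proof (rule aeig_zero[OF _ aeig_diff[OF u(2) aeig_U[OF assms(1,2)]] _ psi_less_6[OF assms(1,2)] x])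
    show "continuous_on (SG p) (\<lambda>x. u x - U \<alpha> (tauD p u) x)"
      using u(1) assms unfolding C_SG_def by (auto intro!: continuous_intros U_continuous)
    show "u x - U \<alpha> (tauD p u) x = 0" if "x \<in> V0 p" for x
      using that by (auto simp: V0_iff tauD_def)
  qed
  then show "u x = UR \<alpha> (tauD p u) x" using x by simp
qed auto

lemma tauD_UR [simp]: "tauD p (UR \<alpha> a) = a"
  by (simp add: tauD_def vec_eq_iff)

lemma tauD_inv_eq:
  assumes "0 \<le> \<alpha>" "\<alpha> < 6"
  shows "tauD_inv p (psi \<alpha>) a = UR \<alpha> a"
proof -
  have inj: "inj_on (tauD p) (eigenspace p (psi \<alpha>))"
    by (rule inj_onI) (metis eigenspace_eq_UR assms)
  show ?thesis
    unfolding tauD_inv_def using inv_into_f_f[OF inj UR_eigenspace[OF assms, of a]]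
    by (simp only: tauD_UR)
qed

text \<open>The parameter 6 is singular, so the function is assembled from cells with parameter
  \<open>phi_m1 6\<close> = 2 and corner values 0, 1, 1, the zero at the vertex of the gasket. The
  flux at a corner of value 1 is 2 * 1 - 2 = 0, so the cells match at the junctions.\<close>

lemma dirichlet_eigenfunction:
  "\<exists>u. eigenfunction p (psi 6) u \<and> (\<forall>x\<in>V0 p. u x = 0)"
proof -
  define a :: "3 \<Rightarrow> real^3" where "a i = (\<chi> j. if j = i then 0 else 1)" for i
  define w where "w = glue (\<lambda>i. U 2 (a i))"
  have a: "a i $ j = (if j = i then 0 else 1)" for i j by (simp add: a_def)
  have w: "w (sgF p i y) = U 2 (a i) y" if "y \<in> SG p" for i y
    unfolding w_def by (rule glue_cell) (use that in \<open>auto simp: a\<close>)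
  have wv: "w (p i) = 0" for i using w[of "p i" i] by (simp add: a)
  have cont: "continuous_on (SG p) w"
  proof (rule continuous_on_cells)
    fix i show "continuous_on (SG p) (w \<circ> sgF p i)"
      by (rule continuous_on_eq[OF U_continuous[of 2 "a i"]]) (auto simp: w)
  qed
  have fl: "flux 2 (a i) j = 0" if ij: "i \<noteq> j" for i j
  proof -
    obtain k where k: "UNIV = {i, j, k}" "i \<noteq> j" "k \<noteq> i" "k \<noteq> j"
      using third_index[OF ij] ij by metis
    show ?thesis using k(2-) unfolding flux_def csum_third[OF k] by (simp add: a)
  qed
  have "graph_lap p m w x = - (phi_m1 ^^ m) 6 * w x" if x: "x \<in> Vm p m - V0 p" for m x
  proof (cases m)
    case 0
    then show ?thesis using x by (simp add: Vm_0)
  next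
    case (Suc n)
    have c: "(phi_m1 ^^ Suc n) 6 = (phi_m1 ^^ n) 2" by (simp add: funpow_swap1 phi_6)
    from x[unfolded Suc] show ?thesis unfolding Suc
    proof (cases rule: Vm_Suc_cases)
      case (cell i y)
      then have y: "y \<in> SG p" "y \<notin> V0 p" using Vm_in_SG by auto
      have "graph_lap p (Suc n) w x = graph_lap p n (U 2 (a i)) y"
        unfolding cell(2) graph_lap_cell[OF y] by (rule graph_lap_cong[OF y(1)]) (simp add: w)
      also have "\<dots> = - (phi_m1 ^^ n) 2 * U 2 (a i) y"
        by (rule graph_lap_U) (use cell(1) in auto)
      finally show "graph_lap p (Suc n) w x = - (phi_m1 ^^ Suc n) 6 * w x"
        unfolding c cell(2) w[OF y(1)] .
    next
      case (junction i j)
      have vf: "vflux p n (w \<circ> sgF p i) j = (phi_m1 ^^ n) 2 / 2" if "i \<noteq> j" for i j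
      proof -
        have "vflux p n (w \<circ> sgF p i) j = vflux p n (U 2 (a i)) j"
          by (rule vflux_cong) (simp add: w)
        then show ?thesis using that fl by (simp add: vflux_U a)
      qed
      have "graph_lap p (Suc n) w x = - (phi_m1 ^^ n) 2"
        unfolding junction(2) graph_lap_junction[OF junction(1)] using vf[of i j] vf[of j i] junction(1) by simp
      then show "graph_lap p (Suc n) w x = - (phi_m1 ^^ Suc n) 6 * w x"
        unfolding c junction(2) using junction(1) by (simp add: w a)
    qed
  qed
  then have "aeig (psi 6) w"
    by (intro aeig_spectral[where c = "\<lambda>m. (phi_m1 ^^ m) 6"] cont psi_tendsto) auto
  then have "restrict w (SG p) \<in> eigenspace p (psi 6)"
    unfolding eigenspace_iff
    using restrict_C_SG[OF cont] aeig_cong[of "restrict w (SG p)" w] by auto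
  moreover have "w (sgF p 1 (p 2)) \<noteq> 0" by (simp add: w a)
  ultimately have "eigenfunction p (psi 6) (restrict w (SG p))"
    unfolding eigenfunction_def by (intro conjI bexI[of _ "sgF p 1 (p 2)"]) auto
  moreover have "\<forall>x\<in>V0 p. restrict w (SG p) x = 0" using wv by (auto simp: V0_iff)
  ultimately show ?thesis by blast
qed

lemma lambda1D_eq: "lambda1D p = psi 6"
  unfolding lambda1D_def
proof (rule Least_equality)
  show "\<exists>u. eigenfunction p (psi 6) u \<and> (\<forall>x\<in>V0 p. u x = 0)"
    by (rule dirichlet_eigenfunction)
next
  fix l assume "\<exists>u. eigenfunction p l u \<and> (\<forall>x\<in>V0 p. u x = 0)"
  then obtain u x where u: "u \<in> C_SG p" "aeig l u" "\<forall>x\<in>V0 p. u x = 0" "x \<in> SG p" "u x \<noteq> 0"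
    unfolding eigenfunction_def eigenspace_iff by blast
  show "psi 6 \<le> l"
  proof (rule ccontr)
    assume "\<not> psi 6 \<le> l"
    then have "u x = 0"
      using u by (intro aeig_zero[OF _ u(2) _ _ u(4)]) (auto simp: C_SG_def)
    then show False using u by simp
  qed
qed

section \<open>Normal derivatives and cell maps in terms of boundary values\<close>

lemma normal_deriv_UR:
  assumes "0 \<le> \<alpha>" "\<alpha> < 6"
  obtains K where "K \<ge> 1" "\<And>a i. normal_deriv p (UR \<alpha> a) i = K * flux \<alpha> a i"
proof -
  obtain K where K: "K \<ge> 1" "\<And>a j. (\<lambda>m. (5/3) ^ m * vflux p m (U \<alpha> a) j) \<longlonglongrightarrow> K * flux \<alpha> a j"
    using vflux_U_tendsto[OF assms] by blast
  have "normal_deriv p (UR \<alpha> a) i = K * flux \<alpha> a i" for a i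
  proof -
    have "normal_deriv p (UR \<alpha> a) i = lim (\<lambda>m. (5/3) ^ m * vflux p m (U \<alpha> a) i)"
      unfolding normal_deriv_def vflux_def by (simp add: funpow_sgF_in_SG)
    then show ?thesis using limI[OF K(2)] by simp
  qed
  then show ?thesis using K(1) that by blast
qed

lemma coneC_eq:
  assumes "0 < \<alpha>" "\<alpha> < 6"
  shows "coneC p (psi \<alpha>) = {a. (\<forall>i. flux \<alpha> a i < 0) \<or> (\<forall>i. flux \<alpha> a i > 0)}"
proof -
  obtain K where K: "K \<ge> 1" "\<And>a i. normal_deriv p (UR \<alpha> a) i = K * flux \<alpha> a i"
    using normal_deriv_UR assms by (metis less_eq_real_def)
  have tN: "tauN p (UR \<alpha> a) $ i = K * flux \<alpha> a i" for a i by (simp add: tauN_def K)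
  have inj: "inj_on (tauN p) (eigenspace p (psi \<alpha>))"
  proof (rule inj_onI)
    fix u v assume u: "u \<in> eigenspace p (psi \<alpha>)" and v: "v \<in> eigenspace p (psi \<alpha>)"
      and e: "tauN p u = tauN p v"
    define a b where "a = tauD p u" and "b = tauD p v"
    have ua: "u = UR \<alpha> a" "v = UR \<alpha> b"
      using eigenspace_eq_UR[of \<alpha>] u v assms by (auto simp: a_def b_def)
    then have fl: "flux \<alpha> a i = flux \<alpha> b i" for i
      using arg_cong[OF e, of "\<lambda>w. w $ i"] tN[of a i] tN[of b i] K(1) by simp
    then have "csum a = csum b" using sum_flux[of \<alpha> a] sum_flux[of \<alpha> b] assms(1) by simp
    then have "a $ i = b $ i" for i using fl[of i] assms unfolding flux_def by simp
    then show "u = v" using ua by (metis vec_eq_iff)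
  qed
  have C0: "tauN p (UR \<alpha> a) \<in> coneC0 \<longleftrightarrow> (\<forall>i. flux \<alpha> a i < 0) \<or> (\<forall>i. flux \<alpha> a i > 0)" for a
    using K(1) unfolding coneC0_def by (auto simp: tN zero_less_mult_iff mult_less_0_iff)
  \<comment> \<open>The linear system for prescribed fluxes c is solved by summing first: the
    coordinate sum of the solution must be S, and then each coordinate is read off.\<close>
  have surj: "\<exists>a. b = tauN p (UR \<alpha> a)" for b
  proof -
    define c where "c = (1/K) *\<^sub>R b"
    define S where "S = - 2 / \<alpha> * csum c"
    define d where "d = 2 / (6 - \<alpha>)"
    define a :: "real^3" where "a = (\<chi> i. d * (c $ i + S))"
    have "csum a = d * (csum c + 3 * S)"
      by (simp add: csum_def a_def sum_3 algebra_simps)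
    also have "csum c + 3 * S = (6 - \<alpha>) / 2 * S" using assms by (simp add: S_def field_simps)
    also have "d * ((6 - \<alpha>) / 2 * S) = S" using assms by (simp add: d_def)
    finally have S: "csum a = S" .
    have d: "(6 - \<alpha>) / 2 * (d * x) = x" for x using assms by (simp add: d_def)
    have "flux \<alpha> a i = c $ i" for i
      unfolding flux_def S unfolding a_def vec_lambda_beta d by simp
    then have "b = tauN p (UR \<alpha> a)" using K(1) by (simp add: vec_eq_iff tN c_def)
    then show ?thesis by blast
  qed
  have inv: "tauN_inv p (psi \<alpha>) (tauN p (UR \<alpha> a)) = UR \<alpha> a" for a
    unfolding tauN_inv_def using assms by (intro inv_into_f_f inj UR_eigenspace) auto
  show ?thesis
  proof (intro set_eqI iffI)
    fix a assume "a \<in> coneC p (psi \<alpha>)"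
    then obtain b where b: "b \<in> coneC0" "a = tauD p (tauN_inv p (psi \<alpha>) b)"
      unfolding coneC_def by auto
    obtain a' where a': "b = tauN p (UR \<alpha> a')" using surj by blast
    have "a = a'" using b(2) unfolding a' inv by simp
    then show "a \<in> {a. (\<forall>i. flux \<alpha> a i < 0) \<or> (\<forall>i. flux \<alpha> a i > 0)}"
      using C0[of a'] b(1) a' by simp
  next
    fix a assume "a \<in> {a. (\<forall>i. flux \<alpha> a i < 0) \<or> (\<forall>i. flux \<alpha> a i > 0)}"
    then have "tauN p (UR \<alpha> a) \<in> coneC0" using C0 by blast
    moreover have "a = (tauD p \<circ> tauN_inv p (psi \<alpha>)) (tauN p (UR \<alpha> a))" by (simp add: inv)
    ultimately show "a \<in> coneC p (psi \<alpha>)" unfolding coneC_def by blast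
  qed
qed

lemma mapT_eq:
  assumes "0 \<le> \<alpha>" "\<alpha> < 6"
  shows "mapT p (psi \<alpha>) i a = tstep (phi_m1 \<alpha>) i a"
  unfolding mapT_def tauD_inv_eq[OF assms] using assms
  by (simp add: tauD_def vec_eq_iff U_junction)

end

section \<open>Extreme sets at the junction points\<close>

context gasket
begin

text \<open>The maximum half of an extreme set, with level c and radius d explicit. Minima are
  reached by passing to -a, and d is kept because zooming into a cell doubles it.\<close>

definition maxext :: "(real^2 \<Rightarrow> real) \<Rightarrow> (real^2) set \<Rightarrow> real \<Rightarrow> real \<Rightarrow> bool" where
  "maxext u A c d \<longleftrightarrow> A \<in> components {x \<in> SG p. u x = c} \<and> A \<inter> V0 p = {} \<and> d > 0 \<and>
     (\<forall>x\<in>sg_nhd p d A. u x \<le> c)"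

lemma maxext_cong:
  assumes "\<And>x. x \<in> SG p \<Longrightarrow> u x = v x"
  shows "maxext u A c d \<longleftrightarrow> maxext v A c d"
proof -
  have "{x \<in> SG p. u x = c} = {x \<in> SG p. v x = c}" using assms by auto
  moreover have "(\<forall>x\<in>sg_nhd p d A. u x \<le> c) \<longleftrightarrow> (\<forall>x\<in>sg_nhd p d A. v x \<le> c)"
    using assms by (auto simp: sg_nhd_def)
  ultimately show ?thesis unfolding maxext_def by simp
qed

lemma maxextD:
  assumes "maxext u A c d"
  shows "A \<noteq> {}" "connected A" "A \<subseteq> SG p" "\<And>x. x \<in> A \<Longrightarrow> u x = c"
    "\<And>T. connected T \<Longrightarrow> T \<subseteq> {x \<in> SG p. u x = c} \<Longrightarrow> A \<inter> T \<noteq> {} \<Longrightarrow> T \<subseteq> A"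
    "A \<inter> V0 p = {}"
    "\<And>x a. x \<in> SG p \<Longrightarrow> a \<in> A \<Longrightarrow> dist x a < d \<Longrightarrow> u x \<le> c" "d > 0"
proof -
  have c: "A \<in> components {x \<in> SG p. u x = c}" using assms maxext_def by blast
  show "A \<noteq> {}" using in_components_nonempty[OF c] .
  show "connected A" using in_components_connected[OF c] .
  show "A \<subseteq> SG p" "\<And>x. x \<in> A \<Longrightarrow> u x = c" using in_components_subset[OF c] by auto
  show "\<And>T. connected T \<Longrightarrow> T \<subseteq> {x \<in> SG p. u x = c} \<Longrightarrow> A \<inter> T \<noteq> {} \<Longrightarrow> T \<subseteq> A"
    using components_maximal[OF c] by blast
  show "A \<inter> V0 p = {}" "d > 0"
    "\<And>x a. x \<in> SG p \<Longrightarrow> a \<in> A \<Longrightarrow> dist x a < d \<Longrightarrow> u x \<le> c"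
    using assms unfolding maxext_def sg_nhd_def by auto
qed

lemma maxext_overlap:
  assumes "maxext u A c d" "maxext u A' c' d'" "A \<inter> A' \<noteq> {}"
  shows "A = A'"
proof -
  have "c = c'" using assms(3) maxextD(4)[OF assms(1)] maxextD(4)[OF assms(2)] by blast
  then show ?thesis using assms components_nonoverlap unfolding maxext_def by blast
qed

lemma global_maxext:
  assumes "\<And>x. x \<in> SG p \<Longrightarrow> u x \<le> c" "x \<in> SG p" "u x = c"
    "connected_component_set {x \<in> SG p. u x = c} x \<inter> V0 p = {}"
  shows "maxext u (connected_component_set {x \<in> SG p. u x = c} x) c 1"
  using assms unfolding maxext_def sg_nhd_def by (auto simp: components_def)

text \<open>Cells are closed and meet only in V_1, so a connected set that misses V_1 lies in one
  cell and off its corners. Maximality of the component is inherited because a larger connected set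
  in the cell is mapped forward to one in the level set.\<close>

lemma maxext_cell:
  assumes m: "maxext u A c d" and V1: "A \<inter> Vm p 1 = {}"
  obtains i B where "A = sgF p i ` B" "maxext (u \<circ> sgF p i) B c (2 * d)"
proof -
  note A = maxextD[OF m]
  obtain x where x: "x \<in> A" using A(1) by blast
  then have "x \<in> SG p" using A(3) by blast
  then obtain i where i: "x \<in> sgF p i ` SG p" by (rule SG_cases) blast
  let ?C1 = "sgF p i ` SG p" and ?C2 = "\<Union>j\<in>-{i}. sgF p j ` SG p"
  have cl: "closed (sgF p j ` SG p)" for j
    by (intro compact_imp_closed compact_continuous_image SG_compact continuous_intros)
  have "closed ?C2" using cl by (intro closed_UN) auto
  moreover have "A \<subseteq> ?C1 \<union> ?C2"
  proof
    fix y assume "y \<in> A"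
    then have "y \<in> SG p" using A(3) by blast
    then obtain j z where "z \<in> SG p" "y = sgF p j z" by (rule SG_cases)
    then show "y \<in> ?C1 \<union> ?C2" by (cases "j = i") auto
  qed
  moreover have "?C1 \<inter> ?C2 \<inter> A = {}"
  proof -
    have False if "y \<in> SG p" "z \<in> SG p" "j \<noteq> i" "sgF p i y = sgF p j z" "sgF p i y \<in> A" for y z j
    proof -
      have "y = p j" by (rule cell_inter(1)[OF that(1,2) that(3)[symmetric] that(4)])
      then show False using that(5) V1 junction_in_V1[of i j] by auto
    qed
    then show ?thesis by (auto simp: image_iff) metis
  qed
  ultimately have "\<not> (A \<inter> ?C2 \<noteq> {} \<and> A \<inter> ?C1 \<noteq> {})"
    using connected_closedD[OF A(2), of ?C1 ?C2] cl[of i] by (simp add: Int_commute disj_commute)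
  then have "A \<inter> ?C2 = {}" using x i by blast
  then have sub: "A \<subseteq> ?C1" using \<open>A \<subseteq> ?C1 \<union> ?C2\<close> by blast
  define B where "B = {y \<in> SG p. sgF p i y \<in> A}"
  have AB: "A = sgF p i ` B" using sub unfolding B_def by blast
  have "maxext (u \<circ> sgF p i) B c (2 * d)"
    unfolding maxext_def
  proof (intro conjI)
    show "B \<in> components {x \<in> SG p. (u \<circ> sgF p i) x = c}"
      unfolding in_components_maximal
    proof (intro conjI allI impI)
      show "B \<noteq> {}" using AB A(1) by blast
      show "B \<subseteq> {x \<in> SG p. (u \<circ> sgF p i) x = c}" using A(4) unfolding B_def by auto
      have "(\<lambda>x. 2 *\<^sub>R x - p i) ` A = B"
        unfolding AB by (simp add: image_image sgF_eq)
      moreover have "connected ((\<lambda>x. 2 *\<^sub>R x - p i) ` A)"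
        by (intro connected_continuous_image A continuous_intros)
      ultimately show "connected B" by simp
      fix T assume T: "T \<noteq> {} \<and> B \<subseteq> T \<and> T \<subseteq> {x \<in> SG p. (u \<circ> sgF p i) x = c} \<and> connected T"
      have "sgF p i ` T \<subseteq> A"
      proof (rule A(5))
        show "connected (sgF p i ` T)" using T by (intro connected_continuous_image continuous_intros) auto
        show "sgF p i ` T \<subseteq> {x \<in> SG p. u x = c}" using T by auto
        show "A \<inter> sgF p i ` T \<noteq> {}" using T AB A(1) by blast
      qed
      then have "T \<subseteq> B" using T unfolding B_def by auto
      then show "T = B" using T by auto
    qed
    show "B \<inter> V0 p = {}"
    proof -
      have "sgF p i (p j) \<notin> A" for j using V1 junction_in_V1[of i j] by blast
      then show ?thesis unfolding B_def V0_def by auto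
    qed
    show "2 * d > 0" using A(8) by simp
    show "\<forall>x\<in>sg_nhd p (2 * d) B. (u \<circ> sgF p i) x \<le> c"
    proof
      fix x assume "x \<in> sg_nhd p (2 * d) B"
      then obtain b where b: "x \<in> SG p" "b \<in> B" "dist x b < 2 * d" unfolding sg_nhd_def by blast
      then have "dist (sgF p i x) (sgF p i b) < d" by (simp add: dist_sgF)
      then show "(u \<circ> sgF p i) x \<le> c"
        using A(7)[of "sgF p i x" "sgF p i b"] b unfolding B_def by auto
    qed
  qed
  with AB show ?thesis by (rule that)
qed

lemma maxext_U_cell:
  assumes "0 \<le> \<alpha>" "\<alpha> < 6" "maxext (U \<alpha> a) A c d" "A \<inter> Vm p 1 = {}"
  obtains i B where "A = sgF p i ` B" "maxext (U (phi_m1 \<alpha>) (tstep (phi_m1 \<alpha>) i a)) B c (2 * d)"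
proof -
  obtain i B where B: "A = sgF p i ` B" "maxext (U \<alpha> a \<circ> sgF p i) B c (2 * d)"
    using maxext_cell[OF assms(3,4)] by blast
  then have "maxext (U (phi_m1 \<alpha>) (tstep (phi_m1 \<alpha>) i a)) B c (2 * d)"
    using assms(1,2) maxext_cong[of "U \<alpha> a \<circ> sgF p i"] by (simp add: U_cell)
  with B(1) show ?thesis by (rule that)
qed

section \<open>Local maxima at a vertex\<close>

lemma dist_funpow_vertex: "dist ((sgF p j ^^ m) (p k)) (p j) \<le> diam / 2 ^ m"
proof (induction m)
  case 0
  show ?case by (simp add: dist_le_diam)
next
  case (Suc m)
  have "dist (sgF p j ((sgF p j ^^ m) (p k))) (sgF p j (p j)) \<le> diam / 2 ^ Suc m"
    using Suc unfolding dist_sgF by simp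
  then show ?case by simp
qed

lemma flux_mono:
  assumes "\<alpha> < 6" "a $ i \<le> a $ j"
  shows "flux \<alpha> a i \<le> flux \<alpha> a j"
  unfolding flux_def using assms by (intro diff_right_mono mult_left_mono) auto

text \<open>If the flux at j vanishes, \<open>csum a\<close> is a multiple of a_j alone, so zooming
  into that corner merely divides the differences to a_j by 5 - b and preserves their signs.\<close>

lemma tstep_critical:
  assumes "b < 2" "flux (b * (5 - b)) a j = 0" "k \<noteq> j"
  shows "tstep b j a $ k - a $ j = (a $ k - a $ j) / (5 - b)"
proof -
  define x where "x = 1 / (5 - b)"
  define y where "y = 1 / (2 - b)"
  have x: "x * (5 - b) = 1" and y: "y * (2 - b) = 1" using assms by (auto simp: x_def y_def)
  have j: "tstep b j a $ k = (a $ j + a $ k) * x + 2 * csum a * x * y"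
    using assms(3) by (simp add: tstep_def x_def y_def)
  have d: "z / (5 - b) = z * x" for z by (simp add: x_def)
  have S: "csum a = (6 - b * (5 - b)) / 2 * a $ j" using assms(2) by (simp add: flux_def)
  show ?thesis
    unfolding j d S using x y by algebra
qed

lemma phi_quad': "0 \<le> \<alpha> \<Longrightarrow> \<alpha> < 6 \<Longrightarrow> phi_m1 \<alpha> * (5 - phi_m1 \<alpha>) = \<alpha>"
  by (rule phi_quad) simp

lemma flux_tstep_same':
  "0 \<le> \<alpha> \<Longrightarrow> \<alpha> < 6 \<Longrightarrow> flux (phi_m1 \<alpha>) (tstep (phi_m1 \<alpha>) i a) i =
    (6 - phi_m1 \<alpha>) / ((2 - phi_m1 \<alpha>) * (5 - phi_m1 \<alpha>)) * flux \<alpha> a i"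
  using flux_tstep_same[of "phi_m1 \<alpha>" i a] phi_range phi_quad' by simp

lemma flux_factor_pos: "0 \<le> \<alpha> \<Longrightarrow> \<alpha> < 6 \<Longrightarrow>
    (6 - phi_m1 \<alpha>) / ((2 - phi_m1 \<alpha>) * (5 - phi_m1 \<alpha>)) > 0"
  "0 \<le> \<alpha> \<Longrightarrow> \<alpha> < 6 \<Longrightarrow> (6 - phi_m1 \<alpha>) / (2 * (5 - phi_m1 \<alpha>)) > 0"
  using phi_range[of \<alpha>] by (auto intro!: divide_pos_pos mult_pos_pos)

lemma U_critical_gt:
  assumes "0 \<le> \<alpha>" "\<alpha> < 6" "flux \<alpha> a j = 0" "a $ k > a $ j"
  shows "U \<alpha> a ((sgF p j ^^ m) (p k)) > a $ j"
  using assms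
proof (induction m arbitrary: \<alpha> a)
  case 0
  then show ?case by simp
next
  case (Suc m)
  let ?b = "phi_m1 \<alpha>"
  have b: "0 \<le> ?b" "?b < 2" using phi_range Suc.prems by auto
  have "k \<noteq> j" using Suc.prems(4) by auto
  have "tstep ?b j a $ k - a $ j = (a $ k - a $ j) / (5 - ?b)"
    by (rule tstep_critical[OF b(2) _ \<open>k \<noteq> j\<close>]) (simp add: phi_quad' Suc.prems)
  also have "\<dots> > 0" using Suc.prems(4) b by (intro divide_pos_pos) auto
  finally have "U ?b (tstep ?b j a) ((sgF p j ^^ m) (p k)) > tstep ?b j a $ j"
    using Suc.prems b by (intro Suc.IH) (auto simp: flux_tstep_same')
  then show ?case using Suc.prems by (simp add: U_cell funpow_sgF_in_SG)
qed

text \<open>The m-neighbours of the vertex come arbitrarily close, so \<open>vflux\<close> is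
  eventually nonnegative and so is its renormalised limit. If that limit vanishes,
  \<open>U_critical_gt\<close> decides: a larger corner value would leave larger values arbitrarily
  near the vertex.\<close>

lemma local_max_vertex:
  assumes "0 \<le> \<alpha>" "\<alpha> < 6" "d > 0" "\<And>y. y \<in> SG p \<Longrightarrow> dist y (p j) < d \<Longrightarrow> U \<alpha> a y \<le> a $ j"
  shows "flux \<alpha> a j \<ge> 0" "flux \<alpha> a j = 0 \<Longrightarrow> a $ k \<le> a $ j"
proof -
  obtain m0 where m0: "diam / 2 ^ m0 < d" using diam_small assms(3) by blast
  have le: "U \<alpha> a ((sgF p j ^^ m) (p k)) \<le> a $ j" if "m \<ge> m0" for m k
  proof (rule assms(4))
    have "diam / 2 ^ m \<le> diam / 2 ^ m0"
      using that diam_nonneg by (intro divide_left_mono power_increasing) auto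
    then show "dist ((sgF p j ^^ m) (p k)) (p j) < d"
      using dist_funpow_vertex[of m j k] m0 by linarith
  qed (simp add: funpow_sgF_in_SG)
  have "0 \<le> vflux p m (U \<alpha> a) j" if "m \<ge> m0" for m
  proof -
    have "(\<Sum>k\<in>-{j}. U \<alpha> a ((sgF p j ^^ m) (p k))) \<le> (\<Sum>k\<in>-{j}. a $ j)"
      by (rule sum_mono) (rule le[OF that])
    then show ?thesis by (simp add: vflux_def card_compl_singleton_3)
  qed
  then have nn: "\<exists>N. \<forall>m\<ge>N. 0 \<le> (5/3) ^ m * vflux p m (U \<alpha> a) j"
    by (intro exI[of _ m0]) simp
  obtain K where K: "K \<ge> 1" "\<And>a j. (\<lambda>m. (5/3) ^ m * vflux p m (U \<alpha> a) j) \<longlonglongrightarrow> K * flux \<alpha> a j"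
    using vflux_U_tendsto[OF assms(1,2)] by blast
  have "0 \<le> K * flux \<alpha> a j" by (rule LIMSEQ_le_const[OF K(2) nn])
  then show "flux \<alpha> a j \<ge> 0" using K(1) by (simp add: zero_le_mult_iff)
  show "a $ k \<le> a $ j" if "flux \<alpha> a j = 0"
    using le[of m0 k] U_critical_gt[OF assms(1,2) that, of k m0] by (meson leD leI order_refl)
qed

text \<open>On a side with equal end values the flux tells whether the midpoint lies above or below
  the ends; zero flux is the borderline case in which the whole side becomes a level
  segment.\<close>

lemma isosceles_mid:
  assumes "0 \<le> \<alpha>" "\<alpha> < 6" "i \<noteq> j" "a $ i = a $ j"
  defines "b \<equiv> phi_m1 \<alpha>"
  shows "tstep b i a $ j - a $ i = - 2 * flux \<alpha> a i / ((2 - b) * (5 - b))"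
proof -
  have b: "0 \<le> b" "b < 2" using phi_range[OF assms(1,2)] by (auto simp: b_def)
  have q: "\<alpha> = b * (5 - b)" using phi_quad'[OF assms(1,2)] by (simp add: b_def)
  define x where "x = 1 / (5 - b)"
  define y where "y = 1 / (2 - b)"
  have x: "x * (5 - b) = 1" and y: "y * (2 - b) = 1" using b by (auto simp: x_def y_def)
  have j: "tstep b i a $ j = (a $ i + a $ j) * x + 2 * csum a * x * y"
    using assms(3) by (simp add: tstep_def x_def y_def)
  have d: "z / ((2 - b) * (5 - b)) = z * x * y" for z by (simp add: x_def y_def)
  show ?thesis
    unfolding j d flux_def q using x y assms(4) by algebra
qed

section \<open>Constancy along a side with zero flux\<close>

lemma closed_segment_halves:
  assumes "x \<in> closed_segment (p i) (p j)"
  obtains x' where "x' \<in> closed_segment (p i) (p j)" "x = sgF p i x' \<or> x = sgF p j x'"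
proof -
  obtain t where t: "0 \<le> t" "t \<le> 1" "x = (1 - t) *\<^sub>R p i + t *\<^sub>R p j"
    using assms unfolding in_segment by blast
  show ?thesis
  proof (cases "t \<le> 1/2")
    case True
    let ?y = "(1 - 2 * t) *\<^sub>R p i + (2 * t) *\<^sub>R p j"
    have "x = sgF p i ?y"
      unfolding t sgF_eq vec_eq_iff by (simp add: algebra_simps)
    moreover have "?y \<in> closed_segment (p i) (p j)"
      unfolding in_segment using True t by (intro exI[of _ "2 * t"]) auto
    ultimately show ?thesis using that by blast
  next
    case False
    let ?y = "(1 - (2 * t - 1)) *\<^sub>R p i + (2 * t - 1) *\<^sub>R p j"
    have "x = sgF p j ?y"
      unfolding t sgF_eq vec_eq_iff by (simp add: algebra_simps)
    moreover have "?y \<in> closed_segment (p i) (p j)"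
      unfolding in_segment using False t by (intro exI[of _ "2 * t - 1"]) auto
    ultimately show ?thesis using that by blast
  qed
qed

lemma closed_level:
  assumes "0 \<le> \<alpha>" "\<alpha> < 6"
  shows "closed {x \<in> SG p. U \<alpha> a x = c}"
  using continuous_closed_preimage_constant[OF U_continuous compact_imp_closed[OF SG_compact]] assms by simp

text \<open>With equal end values and zero flux the midpoint has the same value, and the two cells
  along the side satisfy the same hypotheses. So the level is attained in the gasket arbitrarily
  close to each point of the side, and closedness yields both membership in the gasket and
  constancy.\<close>

lemma segment_approx:
  assumes "0 \<le> \<alpha>" "\<alpha> < 6" "i \<noteq> j" "a $ i = a $ j" "flux \<alpha> a i = 0" "x \<in> closed_segment (p i) (p j)"
  shows "\<exists>q\<in>SG p. U \<alpha> a q = a $ i \<and> dist x q \<le> diam / 2 ^ m"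
  using assms
proof (induction m arbitrary: \<alpha> a x)
  case 0
  have "dist x (p i) \<le> dist (p j) (p i)"
    using dist_in_closed_segment[OF 0(6)] by (simp add: dist_commute)
  also have "\<dots> \<le> diam" by (simp add: dist_le_diam)
  finally show ?case using 0 by (intro bexI[of _ "p i"]) auto
next
  case (Suc m)
  let ?b = "phi_m1 \<alpha>"
  have b: "0 \<le> ?b" "?b < 6" using phi_range Suc.prems(1,2) by force+
  have c: "tstep ?b i a $ j = a $ i"
    using isosceles_mid[OF Suc.prems(1-4)] Suc.prems(5) by simp
  have fj: "flux \<alpha> a j = 0" using Suc.prems(4,5) by (simp add: flux_def)
  obtain x' l where x': "x' \<in> closed_segment (p i) (p j)" "x = sgF p l x'" "l = i \<or> l = j"
    using closed_segment_halves[OF Suc.prems(6)] by metis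
  have l: "tstep ?b l a $ i = a $ i" "tstep ?b l a $ j = a $ i"
    using x'(3) c Suc.prems(4) tstep_commute[of ?b i a j] by auto
  have "flux ?b (tstep ?b l a) l = 0"
    using x'(3) Suc.prems(1,2,5) fj by (auto simp: flux_tstep_same')
  then have fl: "flux ?b (tstep ?b l a) i = 0"
    using x'(3) l by (auto simp: flux_def)
  obtain q where q: "q \<in> SG p" "U ?b (tstep ?b l a) q = tstep ?b l a $ i" "dist x' q \<le> diam / 2 ^ m"
    using Suc.IH[OF b Suc.prems(3) _ fl x'(1)] l by auto
  have "U \<alpha> a (sgF p l q) = a $ i" using q l Suc.prems(1,2) by (simp add: U_cell)
  moreover have "dist x (sgF p l q) \<le> diam / 2 ^ Suc m"
    using q(3) unfolding x'(2) dist_sgF by simp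
  ultimately show ?case using q(1) by blast
qed

lemma segment_level:
  assumes "0 \<le> \<alpha>" "\<alpha> < 6" "i \<noteq> j" "a $ i = a $ j" "flux \<alpha> a i = 0"
  shows "closed_segment (p i) (p j) \<subseteq> {x \<in> SG p. U \<alpha> a x = a $ i}"
proof
  fix x assume x: "x \<in> closed_segment (p i) (p j)"
  have "x \<in> closure {x \<in> SG p. U \<alpha> a x = a $ i}"
    unfolding closure_approachable
  proof (intro allI impI)
    fix e :: real assume "e > 0"
    then obtain m where m: "diam / 2 ^ m < e" using diam_small by blast
    obtain q where "q \<in> SG p" "U \<alpha> a q = a $ i" "dist x q \<le> diam / 2 ^ m"
      using segment_approx[OF assms x] by blast
    then show "\<exists>y\<in>{x \<in> SG p. U \<alpha> a x = a $ i}. dist y x < e"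
      using m by (intro bexI[of _ q]) (auto simp: dist_commute)
  qed
  then show "x \<in> {x \<in> SG p. U \<alpha> a x = a $ i}"
    using closed_level[OF assms(1,2)] by (simp add: closure_closed)
qed

text \<open>Seen from either cell the junction is a local maximum, so both fluxes are nonnegative;
  being opposite they vanish. The delicate point is strictness: a zero flux of the whole function at
  i would make the side from p_i to p_j a level segment through the junction, and A would contain
  vertices.\<close>

lemma maxext_junction:
  assumes \<alpha>: "0 \<le> \<alpha>" "\<alpha> < 6" and m: "maxext (U \<alpha> a) A c d" and ij: "i \<noteq> j" "sgF p i (p j) \<in> A"
  shows "c = tstep (phi_m1 \<alpha>) i a $ j" "a $ i = a $ j" "a $ k \<le> a $ i" "flux \<alpha> a k < 0"
proof -
  let ?b = "phi_m1 \<alpha>"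
  note A = maxextD[OF m]
  have b: "0 \<le> ?b" "?b < 2" using phi_range \<alpha> by auto
  have b6: "?b < 6" using b by simp
  show c: "c = tstep ?b i a $ j" using A(4)[OF ij(2)] \<alpha> by (simp add: U_junction)
  have loc: "U ?b (tstep ?b i a) y \<le> tstep ?b i a $ j"
    if "sgF p i (p j) \<in> A" "c = tstep ?b i a $ j" "y \<in> SG p" "dist y (p j) < 2 * d" for y i j
  proof -
    have "dist (sgF p i y) (sgF p i (p j)) < d" using that(4) by (simp add: dist_sgF)
    then show ?thesis using A(7)[of "sgF p i y" "sgF p i (p j)"] that \<alpha> by (simp add: U_cell)
  qed
  have d2: "2 * d > 0" using A(8) by simp
  have L: "flux ?b (tstep ?b i a) j \<ge> 0 \<and>
      (flux ?b (tstep ?b i a) j = 0 \<longrightarrow> (\<forall>k. tstep ?b i a $ k \<le> tstep ?b i a $ j))"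
    if "sgF p i (p j) \<in> A" "c = tstep ?b i a $ j" for i j
    using local_max_vertex[OF b(1) b6 d2, of j "tstep ?b i a"] loc[OF that] by blast
  have ji: "sgF p j (p i) \<in> A" "c = tstep ?b j a $ i"
    using ij(2) c by (auto simp: sgF_commute[of p j i] tstep_commute[of _ j])
  have f0: "flux ?b (tstep ?b i a) j = 0"
    using L[OF ij(2) c] L[OF ji] flux_junction[OF \<alpha> ij(1), of a] by simp
  show e: "a $ i = a $ j"
    using f0 flux_tstep_other[OF b(2) ij(1), of a] b by (auto simp: divide_eq_0_iff)
  have fij: "flux \<alpha> a i = flux \<alpha> a j" using e by (simp add: flux_def)
  have le: "tstep ?b i a $ k \<le> c" for k using L[OF ij(2) c] f0 c by simp
  show ak: "a $ k \<le> a $ i" for k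
  proof (cases "k = i")
    case False
    have "(a $ j - a $ k) / (5 - ?b) \<ge> 0"
      using le[of k] tstep_diff[of j i k ?b a] ij(1) False c by simp
    then show ?thesis using b e by (simp add: zero_le_divide_iff)
  qed simp
  have D: "(2 - ?b) * (5 - ?b) > 0" using b by (intro mult_pos_pos) auto
  have "- 2 * flux \<alpha> a i / ((2 - ?b) * (5 - ?b)) \<ge> 0"
    using isosceles_mid[OF \<alpha> ij(1) e] le[of i] c by simp
  then have "- 2 * flux \<alpha> a i \<ge> 0" using D by (simp only: zero_le_divide_iff) linarith
  then have "flux \<alpha> a i \<le> 0" by simp
  moreover have "flux \<alpha> a i \<noteq> 0"
  proof
    assume f: "flux \<alpha> a i = 0"
    then have ca: "c = a $ i" using isosceles_mid[OF \<alpha> ij(1) e] c by simp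
    have "closed_segment (p i) (p j) \<subseteq> A"
    proof (rule A(5))
      show "closed_segment (p i) (p j) \<subseteq> {x \<in> SG p. U \<alpha> a x = c}"
        unfolding ca by (rule segment_level[OF \<alpha> ij(1) e f])
      have "sgF p i (p j) \<in> closed_segment (p i) (p j)"
        unfolding in_segment sgF_eq
        by (intro exI[of _ "1/2"]) (simp add: scaleR_add_right add.commute)
      then show "A \<inter> closed_segment (p i) (p j) \<noteq> {}" using ij(2) by blast
    qed simp
    then show False using A(6) by (auto simp: V0_iff)
  qed
  ultimately have "flux \<alpha> a i < 0" by simp
  then show "flux \<alpha> a k < 0" using flux_mono[OF \<alpha>(2) ak[of k]] by linarith
qed

end

section \<open>Extreme sets and the signs of the normal derivatives\<close>

text \<open>The data with a maximum-type extreme set that meets V_1 (\<open>topTie_iff\<close>): a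
  tie at the top puts the set on the junction between the tied corners.\<close>

definition topTie :: "real \<Rightarrow> real^3 \<Rightarrow> bool" where
  "topTie \<alpha> a \<longleftrightarrow> (\<forall>i. flux \<alpha> a i < 0) \<and> (\<exists>i j. i \<noteq> j \<and> a $ i = a $ j \<and> (\<forall>k. a $ k \<le> a $ i))"

context gasket
begin

text \<open>Either some a_j \<ge> a_l with j \<noteq> l, which makes a junction flux of the cell l
  nonnegative, or a_l is the strict maximum and its own flux is at least the given one. For the
  values it suffices to look at a maximal corner m: the junctions next to it lie below a_m, and the
  remaining junction lies below one of these.\<close>

lemma tstep_weak_max:
  assumes \<alpha>: "0 \<le> \<alpha>" "\<alpha> < 6" and i: "flux \<alpha> a i \<ge> 0" and M: "\<And>j. a $ j \<le> M"
  defines "b \<equiv> phi_m1 \<alpha>"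
  shows "\<exists>j. flux b (tstep b l a) j \<ge> 0" "tstep b l a $ j \<le> M"
proof -
  have b: "0 \<le> b" "b < 2" using phi_range[OF \<alpha>] by (auto simp: b_def)
  have q: "b * (5 - b) = \<alpha>" using phi_quad'[OF \<alpha>] by (simp add: b_def)
  have D: "(2 - b) * (5 - b) > 0" using b by (intro mult_pos_pos) auto
  show "\<exists>j. flux b (tstep b l a) j \<ge> 0"
  proof (cases "\<exists>j. j \<noteq> l \<and> a $ j \<ge> a $ l")
    case True
    then obtain j where j: "j \<noteq> l" "a $ j \<ge> a $ l" by blast
    have "0 \<le> (6 - b) / (2 * (5 - b)) * (a $ j - a $ l)"
      using j b by (intro mult_nonneg_nonneg divide_nonneg_nonneg) auto
    then have "0 \<le> flux b (tstep b l a) j"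
      using flux_tstep_other[OF b(2) j(1)[symmetric], of a] by (simp only:)
    then show ?thesis by blast
  next
    case False
    then have "a $ i \<le> a $ l" by (cases "i = l") force+
    then have "0 \<le> flux \<alpha> a l" using flux_mono[OF \<alpha>(2), of a i l] i by linarith
    then have "0 \<le> flux b (tstep b l a) l"
      unfolding b_def flux_tstep_same'[OF \<alpha>]
      using flux_factor_pos(1)[OF \<alpha>] by (meson less_imp_le mult_nonneg_nonneg)
    then show ?thesis by blast
  qed
  obtain m where m: "\<And>j. a $ j \<le> a $ m"
  proof -
    have "finite (range (\<lambda>j. a $ j))" by simp
    then have "Max (range (\<lambda>j. a $ j)) \<in> range (\<lambda>j. a $ j)" by (intro Max_in) auto
    then obtain m where "Max (range (\<lambda>j. a $ j)) = a $ m" by blast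
    then show ?thesis using that[of m] Max_ge[of "range (\<lambda>j. a $ j)"] by auto
  qed
  have fm: "flux \<alpha> a m \<ge> 0" using flux_mono[OF \<alpha>(2) m, of i] i by linarith
  have near: "tstep b m a $ j \<le> a $ m" for j
  proof (cases "j = m")
    case False
    then have mj: "m \<noteq> j" by simp
    obtain k where k: "UNIV = {m, j, k}" "m \<noteq> j" "k \<noteq> m" "k \<noteq> j"
      using third_index[OF mj] mj by metis
    \<comment> \<open>This is the nonnegative flux at m rewritten in differences to a_m; it absorbs
      the eigenvalue term \<alpha> a_m whatever the sign of a_m.\<close>
    have "2 * (a $ j - a $ m) + 2 * (a $ k - a $ m) \<le> - \<alpha> * a $ m"
      using fm unfolding flux_def csum_third[OF k] by (simp add: field_simps)
    moreover have "(2 - b) * (a $ j - a $ m) \<le> 0" using m[of j] b by (intro mult_nonneg_nonpos) auto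
    moreover have "(4 - b) * (a $ j - a $ m) = (2 - b) * (a $ j - a $ m) + 2 * (a $ j - a $ m)"
      by (simp add: algebra_simps)
    ultimately have n: "(4 - b) * (a $ j - a $ m) + 2 * (a $ k - a $ m) + \<alpha> * a $ m \<le> 0"
      by linarith
    have "b * a $ m / (2 - b) = \<alpha> * a $ m / ((2 - b) * (5 - b))"
      using b unfolding q[symmetric] by simp
    then have "tstep b m a $ j - a $ m =
      ((4 - b) * (a $ j - a $ m) + 2 * (a $ k - a $ m) + \<alpha> * a $ m) / ((2 - b) * (5 - b))"
      unfolding tstep_minus_corner[OF b(2) k] by (simp only: add_divide_distrib)
    also have "\<dots> \<le> 0" using n D by (intro divide_nonpos_pos)
    finally show ?thesis by simp
  qed simp
  have "tstep b l a $ j \<le> a $ m"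
  proof (cases "l = m \<or> j = m")
    case True
    then show ?thesis using near[of j] near[of l] tstep_commute[of b l a j] by auto
  next
    case False
    show ?thesis
    proof (cases "j = l")
      case True
      then show ?thesis using m by simp
    next
      case jl: False
      have "tstep b l a $ j - tstep b l a $ m = (a $ j - a $ m) / (5 - b)"
        using jl False by (intro tstep_diff) auto
      also have "\<dots> \<le> 0" using m[of j] b by (intro divide_nonpos_pos) auto
      finally show ?thesis using near[of l] tstep_commute[of b l a m] by simp
    qed
  qed
  then show "tstep b l a $ j \<le> M" using M[of m] by linarith
qed

lemma U_weak_max:
  assumes "0 \<le> \<alpha>" "\<alpha> < 6" "flux \<alpha> a i \<ge> 0" "\<And>j. a $ j \<le> M" "x \<in> SG p"
  shows "U \<alpha> a x \<le> M"
proof -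
  have "uapp m \<alpha> a x \<le> M" for m
    using assms
  proof (induction m arbitrary: \<alpha> a x i)
    case 0
    have "(\<Sum>i\<in>UNIV. a $ i * bary p i x) \<le> (\<Sum>i\<in>UNIV. M * bary p i x)"
      by (intro sum_mono mult_right_mono 0 SG_bary)
    also have "\<dots> = M"
      using SG_bary(3)[OF 0(5)] by (simp flip: sum_distrib_left)
    finally show ?case by simp
  next
    case (Suc m)
    obtain l y where y: "y \<in> SG p" "x = sgF p l y" using SG_cases[OF Suc.prems(5)] by metis
    have b: "0 \<le> phi_m1 \<alpha>" "phi_m1 \<alpha> < 6" using phi_range Suc.prems(1,2) by force+
    obtain j where "flux (phi_m1 \<alpha>) (tstep (phi_m1 \<alpha>) l a) j \<ge> 0"
      using tstep_weak_max(1)[OF Suc.prems(1-4)] by blast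
    then have "uapp m (phi_m1 \<alpha>) (tstep (phi_m1 \<alpha>) l a) y \<le> M"
      by (rule Suc.IH[OF b _ tstep_weak_max(2)[OF Suc.prems(1-4)] y(1)])
    then show ?case unfolding y(2) uapp_cell[OF y(1)] .
  qed
  then show ?thesis
    using assms by (intro LIMSEQ_le_const2[OF uapp_tendsto]) auto
qed

lemma flux_neg_from_cell:
  assumes \<alpha>: "0 \<le> \<alpha>" "\<alpha> < 6" and f: "\<And>j. flux (phi_m1 \<alpha>) (tstep (phi_m1 \<alpha>) l a) j < 0"
  shows "flux \<alpha> a j < 0" "j \<noteq> l \<Longrightarrow> a $ j < a $ l"
proof -
  let ?b = "phi_m1 \<alpha>"
  have b: "0 \<le> ?b" "?b < 2" using phi_range[OF \<alpha>] by auto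
  have l: "flux \<alpha> a l < 0"
    using f[of l] flux_factor_pos(1)[OF \<alpha>] unfolding flux_tstep_same'[OF \<alpha>]
    by (meson mult_less_0_iff less_asym)
  show less: "a $ j < a $ l" if "j \<noteq> l" for j
  proof -
    have "a $ j - a $ l < 0"
      using f[of j] flux_factor_pos(2)[OF \<alpha>] unfolding flux_tstep_other[OF b(2) that[symmetric]]
      by (meson mult_less_0_iff less_asym)
    then show ?thesis by simp
  qed
  have "a $ j \<le> a $ l" using less[of j] by (cases "j = l") auto
  then show "flux \<alpha> a j < 0" using flux_mono[OF \<alpha>(2)] l by (meson le_less_trans)
qed

text \<open>Off its corners a cell shares no point with another one, so a set that misses V_1 but
  meets V_(m+1) pulls back to one that meets V_m. The induction thus ends at a junction.\<close>

lemma maxext_Vm_flux: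
  assumes "0 \<le> \<alpha>" "\<alpha> < 6" "maxext (U \<alpha> a) A c d" "A \<inter> Vm p m \<noteq> {}"
  shows "flux \<alpha> a j < 0"
  using assms
proof (induction m arbitrary: \<alpha> a A d j)
  case 0
  then show ?case using maxextD(6)[OF 0(3)] by (simp add: Vm_0)
next
  case (Suc m)
  show ?case
  proof (cases "A \<inter> Vm p 1 = {}")
    case True
    have b: "0 \<le> phi_m1 \<alpha>" "phi_m1 \<alpha> < 6" using phi_range Suc.prems(1,2) by force+
    obtain l B where B: "A = sgF p l ` B" "maxext (U (phi_m1 \<alpha>) (tstep (phi_m1 \<alpha>) l a)) B c (2 * d)"
      using maxext_U_cell[OF Suc.prems(1-3) True] by blast
    obtain x y k where x: "x \<in> B" "y \<in> Vm p m" "sgF p l x = sgF p k y"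
      using Suc.prems(4) unfolding B(1) Vm_Suc by blast
    have xS: "x \<in> SG p" "x \<notin> V0 p" using maxextD(3,6)[OF B(2)] x(1) by auto
    have "x = y" using cell_inter_V0(2)[OF xS Vm_in_SG[OF x(2)] x(3)] .
    then have "B \<inter> Vm p m \<noteq> {}" using x by blast
    then show ?thesis
      using Suc.IH[OF b B(2)] by (intro flux_neg_from_cell(1)[OF Suc.prems(1,2)])
  next
    case False
    then obtain x where x: "x \<in> A" "x \<in> Vm p 1 - V0 p" using maxextD(6)[OF Suc.prems(3)] by blast
    then obtain i k where ik: "i \<noteq> k" "x = sgF p i (p k)" using V1_cases by metis
    show ?thesis
      using maxext_junction(4)[OF Suc.prems(1-3) ik(1)] x(1) ik(2) by simp
  qed
qed

text \<open>With some nonnegative flux the maximum is attained at a corner, by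
  \<open>U_weak_max\<close>. This passes to every cell, hence each cell that contains a maximum
  point also has one among its corners.\<close>

lemma global_max_Vm:
  assumes "0 \<le> \<alpha>" "\<alpha> < 6" "flux \<alpha> a i \<ge> 0" "\<And>y. y \<in> SG p \<Longrightarrow> U \<alpha> a y \<le> c" "x \<in> SG p" "U \<alpha> a x = c"
  shows "\<exists>q\<in>Vm p m. U \<alpha> a q = c \<and> dist x q \<le> diam / 2 ^ m"
  using assms
proof (induction m arbitrary: \<alpha> a x i)
  case 0
  have "\<exists>j. a $ j = c"
  proof (rule ccontr)
    assume "\<nexists>j. a $ j = c"
    moreover have "a $ j \<le> c" for j using 0(4)[of "p j"] by simp
    ultimately have less: "a $ j < c" for j by (simp add: less_le)
    define M where "M = Max (range (($) a))"
    have "M \<in> range (($) a)" unfolding M_def by (rule Max_in) auto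
    then have "M < c" using less by auto
    moreover have "U \<alpha> a x \<le> M"
      by (rule U_weak_max[OF 0(1-3) _ 0(5)]) (auto simp: M_def)
    ultimately show False using 0(6) by simp
  qed
  then obtain j where "a $ j = c" by blast
  then show ?case using dist_le_diam[OF 0(5)] by (intro bexI[of _ "p j"]) (auto simp: Vm_0 V0_def)
next
  case (Suc m)
  obtain l y where y: "y \<in> SG p" "x = sgF p l y" using SG_cases[OF Suc.prems(5)] by metis
  let ?b = "phi_m1 \<alpha>"
  have b: "0 \<le> ?b" "?b < 6" using phi_range Suc.prems(1,2) by force+
  have cell: "U \<alpha> a (sgF p l z) = U ?b (tstep ?b l a) z" if "z \<in> SG p" for z
    using Suc.prems(1,2) that by (simp add: U_cell)
  obtain j where j: "flux ?b (tstep ?b l a) j \<ge> 0"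
    using tstep_weak_max(1)[OF Suc.prems(1-3), of c] Suc.prems(4)[of "p _"] by auto
  obtain q where q: "q \<in> Vm p m" "U ?b (tstep ?b l a) q = c" "dist y q \<le> diam / 2 ^ m"
    using Suc.IH[OF b j _ y(1)] Suc.prems(4,6) y cell by (metis sgF_in_SG)
  have "sgF p l q \<in> Vm p (Suc m)" using q(1) by (auto simp: Vm_Suc)
  moreover have "dist x (sgF p l q) \<le> diam / 2 ^ Suc m"
    using q(3) unfolding y(2) dist_sgF by simp
  ultimately show ?case using q cell[OF Vm_in_SG[OF q(1)]] by auto
qed

text \<open>The components through the vertices form a closed set W. A maximum point in V_m outside
  W would lie on an extreme set that meets V_m and force negative fluxes; so W has points
  arbitrarily close to x and contains x. This handles components that miss every V_m.\<close>

lemma global_max_component: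
  assumes \<alpha>: "0 \<le> \<alpha>" "\<alpha> < 6" and f: "flux \<alpha> a i \<ge> 0"
    and c: "\<And>y. y \<in> SG p \<Longrightarrow> U \<alpha> a y \<le> c" and x: "x \<in> SG p" "U \<alpha> a x = c"
  shows "connected_component_set {x \<in> SG p. U \<alpha> a x = c} x \<inter> V0 p \<noteq> {}"
proof -
  let ?L = "{x \<in> SG p. U \<alpha> a x = c}"
  define W where "W = (\<Union>i. connected_component_set ?L (p i))"
  have "closed W"
    unfolding W_def using closed_level[OF \<alpha>] by (intro closed_UN) (auto intro: closed_connected_component)
  have q: "\<exists>q\<in>W. dist q x \<le> diam / 2 ^ m" for m
  proof -
    obtain q where q: "q \<in> Vm p m" "U \<alpha> a q = c" "dist x q \<le> diam / 2 ^ m"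
      using global_max_Vm[OF \<alpha> f c x] by blast
    have qS: "q \<in> SG p" using Vm_in_SG[OF q(1)] .
    have "connected_component_set ?L q \<inter> V0 p \<noteq> {}"
    proof
      assume e: "connected_component_set ?L q \<inter> V0 p = {}"
      have "q \<in> connected_component_set ?L q" using q(2) qS by simp
      then have "connected_component_set ?L q \<inter> Vm p m \<noteq> {}" using q(1) by blast
      moreover have "maxext (U \<alpha> a) (connected_component_set ?L q) c 1"
        by (rule global_maxext[OF _ qS q(2) e]) (rule c)
      ultimately have "flux \<alpha> a i < 0" using maxext_Vm_flux[OF \<alpha>] by blast
      then show False using f by simp
    qed
    then obtain j where "connected_component ?L q (p j)" by (auto simp: V0_iff)
    then have "q \<in> W" unfolding W_def using connected_component_sym by blast
    then show ?thesis using q(3) by (auto simp: dist_commute)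
  qed
  have "x \<in> closure W"
    unfolding closure_approachable
  proof (intro allI impI)
    fix e :: real assume "e > 0"
    then obtain m where "diam / 2 ^ m < e" using diam_small by blast
    then show "\<exists>y\<in>W. dist y x < e" using q[of m] by force
  qed
  then have "x \<in> W" using \<open>closed W\<close> by simp
  then obtain j where "connected_component ?L x (p j)"
    unfolding W_def using connected_component_sym by blast
  then show ?thesis by (auto simp: V0_iff)
qed

text \<open>After n zooms the radius exceeds the diameter and the level is the global maximum on the
  cell; a nonnegative flux there would connect the set to a vertex.\<close>

lemma maxext_noVm_flux:
  assumes "0 \<le> \<alpha>" "\<alpha> < 6" "maxext (U \<alpha> a) A c d" "\<And>m. A \<inter> Vm p m = {}" "d > diam / 2 ^ n"
  shows "flux \<alpha> a j < 0"
  using assms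
proof (induction n arbitrary: \<alpha> a A d j)
  case 0
  note A = maxextD[OF 0(3)]
  obtain x where x: "x \<in> A" using A(1) by blast
  have xS: "x \<in> SG p" using x A(3) by blast
  have c: "U \<alpha> a y \<le> c" if "y \<in> SG p" for y
    using A(7)[OF that x] dist_le_diam[OF that xS] 0(5) by simp
  show ?case
  proof (rule ccontr)
    assume "\<not> flux \<alpha> a j < 0"
    then have f: "flux \<alpha> a j \<ge> 0" by simp
    let ?C = "connected_component_set {x \<in> SG p. U \<alpha> a x = c} x"
    have "?C \<subseteq> A"
    proof (rule A(5))
      show "?C \<subseteq> {x \<in> SG p. U \<alpha> a x = c}" by (rule connected_component_subset)
      have "x \<in> ?C" using xS A(4)[OF x] by simp
      then show "A \<inter> ?C \<noteq> {}" using x by blast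
    qed simp
    then show False
      using global_max_component[OF 0(1,2) f c xS A(4)[OF x]] A(6) by blast
  qed
next
  case (Suc n)
  have b: "0 \<le> phi_m1 \<alpha>" "phi_m1 \<alpha> < 6" using phi_range Suc.prems(1,2) by force+
  obtain l B where B: "A = sgF p l ` B" "maxext (U (phi_m1 \<alpha>) (tstep (phi_m1 \<alpha>) l a)) B c (2 * d)"
    using maxext_U_cell[OF Suc.prems(1-4)] by blast
  have BV: "B \<inter> Vm p m = {}" for m
    using Suc.prems(4)[of "Suc m"] unfolding B(1) Vm_Suc by blast
  have "2 * d > diam / 2 ^ n" using Suc.prems(5) by (simp add: field_simps)
  then show ?case
    using Suc.IH[OF b B(2) BV] by (intro flux_neg_from_cell(1)[OF Suc.prems(1,2)])
qed

lemma maxext_flux: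
  assumes "0 \<le> \<alpha>" "\<alpha> < 6" "maxext (U \<alpha> a) A c d"
  shows "flux \<alpha> a j < 0"
proof (cases "\<forall>m. A \<inter> Vm p m = {}")
  case True
  obtain n where "diam / 2 ^ n < d" using diam_small maxextD(8)[OF assms(3)] by blast
  then show ?thesis using maxext_noVm_flux[OF assms] True by blast
next
  case False
  then show ?thesis using maxext_Vm_flux[OF assms] by blast
qed

section \<open>Existence and uniqueness of extreme sets\<close>

lemma maxext_exists:
  assumes \<alpha>: "0 \<le> \<alpha>" "\<alpha> < 6" and f: "\<And>j. flux \<alpha> a j < 0"
  shows "\<exists>A c d. maxext (U \<alpha> a) A c d"
proof -
  have "SG p \<noteq> {}" using SG_vertex by blast
  then obtain x where x: "x \<in> SG p" "\<And>y. y \<in> SG p \<Longrightarrow> U \<alpha> a y \<le> U \<alpha> a x"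
    using continuous_attains_sup[OF SG_compact _ U_continuous] \<alpha> by (metis less_eq_real_def)
  let ?L = "{y \<in> SG p. U \<alpha> a y = U \<alpha> a x}"
  have "p j \<notin> ?L" for j
  proof
    assume "p j \<in> ?L"
    then have "U \<alpha> a y \<le> a $ j" if "y \<in> SG p" for y using x(2)[OF that] by simp
    then have "flux \<alpha> a j \<ge> 0" by (intro local_max_vertex(1)[OF \<alpha>, of 1]) auto
    then show False using f[of j] by simp
  qed
  then have "?L \<inter> V0 p = {}" by (auto simp: V0_iff)
  then have "connected_component_set ?L x \<inter> V0 p = {}"
    using connected_component_subset by blast
  then have "maxext (U \<alpha> a) (connected_component_set ?L x) (U \<alpha> a x) 1"
    by (intro global_maxext x refl)
  then show ?thesis by blast
qed

lemma V1_maxext: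
  assumes \<alpha>: "0 \<le> \<alpha>" "\<alpha> < 6" and m: "maxext (U \<alpha> a) A c d" and V1: "A \<inter> Vm p 1 \<noteq> {}"
  obtains i j where "i \<noteq> j" "sgF p i (p j) \<in> A" "a $ i = a $ j" "\<And>k. a $ k \<le> a $ i"
proof -
  obtain x where x: "x \<in> A" "x \<in> Vm p 1 - V0 p" using maxextD(6)[OF m] V1 by blast
  then obtain i j where "i \<noteq> j" "x = sgF p i (p j)" using V1_cases by metis
  then show ?thesis using that maxext_junction[OF \<alpha> m] x(1) by metis
qed

text \<open>The junction value c is the global maximum: in every cell the corner values are at most
  c, and a tied corner with index other than that of the cell supplies a nonnegative flux, so
  \<open>U_weak_max\<close> applies.\<close>

lemma V1_maxext_exists:
  assumes \<alpha>: "0 \<le> \<alpha>" "\<alpha> < 6" and f: "\<And>j. flux \<alpha> a j < 0" and ij: "i \<noteq> j" "a $ i = a $ j" "\<And>k. a $ k \<le> a $ i"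
  shows "\<exists>A c d. maxext (U \<alpha> a) A c d \<and> sgF p i (p j) \<in> A"
proof -
  let ?b = "phi_m1 \<alpha>"
  have b: "0 \<le> ?b" "?b < 2" using phi_range \<alpha> by auto
  have b6: "?b < 6" using b by simp
  define c where "c = tstep ?b i a $ j"
  have D: "(2 - ?b) * (5 - ?b) > 0" using b by (intro mult_pos_pos) auto
  have "- 2 * flux \<alpha> a i / ((2 - ?b) * (5 - ?b)) > 0"
    using f[of i] D by (intro divide_pos_pos) auto
  then have ci: "a $ i < c" using isosceles_mid[OF \<alpha> ij(1,2)] by (simp add: c_def)
  have mid: "tstep ?b s a $ k \<le> c" if s: "s = i \<or> s = j" for s k
  proof (cases "k = s")
    case True
    then show ?thesis using s ci ij by auto
  next
    case False
    define t where "t = (if s = i then j else i)"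
    have t: "t \<noteq> s" "tstep ?b s a $ t = c"
      using s ij(1) tstep_commute[of ?b j a i] by (auto simp: t_def c_def)
    have at: "a $ t = a $ i" using ij(2) by (simp add: t_def)
    have "tstep ?b s a $ t - tstep ?b s a $ k = (a $ t - a $ k) / (5 - ?b)"
      using t(1) False by (intro tstep_diff)
    also have "\<dots> \<ge> 0" using at ij(3)[of k] b by (intro divide_nonneg_pos) auto
    finally show ?thesis using t(2) by simp
  qed
  have other: "flux ?b (tstep ?b l a) k \<ge> 0" if "l \<noteq> k" "a $ k \<ge> a $ l" for l k
    unfolding flux_tstep_other[OF b(2) that(1)] using that(2) b
    by (intro mult_nonneg_nonneg divide_nonneg_nonneg) auto
  have le: "U \<alpha> a x \<le> c" if xS: "x \<in> SG p" for x
  proof -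
    obtain l y where y: "y \<in> SG p" "x = sgF p l y" using SG_cases[OF xS] by metis
    define k where "k = (if l = i then j else i)"
    have "l \<noteq> k" "a $ k \<ge> a $ l" using ij by (auto simp: k_def)
    from other[OF this] have fl: "flux ?b (tstep ?b l a) k \<ge> 0" .
    have en: "tstep ?b l a $ n \<le> c" for n
    proof (cases "l = i \<or> l = j \<or> n = i \<or> n = j")
      case True
      then show ?thesis using mid[of l n] mid[of n l] tstep_commute[of ?b l a n] by auto
    next
      case False
      \<comment> \<open>Both indices avoid i and j, so both are the third one and the value is the
        corner value a_l.\<close>
      then have "n = l" using ij(1) exhaust_3[of i] exhaust_3[of j] exhaust_3[of l] exhaust_3[of n] by auto
      then show ?thesis using ij(3)[of l] ci by simp
    qed
    have "U ?b (tstep ?b l a) y \<le> c" by (rule U_weak_max[OF b(1) b6 fl en y(1)])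
    then show ?thesis using \<alpha> y by (simp add: U_cell)
  qed
  let ?q = "sgF p i (p j)"
  have q: "U \<alpha> a ?q = c" using \<alpha> by (simp add: U_junction c_def)
  let ?L = "{y \<in> SG p. U \<alpha> a y = c}"
  have "p k \<notin> ?L" for k using ij(3)[of k] ci by simp
  then have "?L \<inter> V0 p = {}" unfolding V0_def by blast
  then have "connected_component_set ?L ?q \<inter> V0 p = {}"
    using connected_component_subset by blast
  then have "maxext (U \<alpha> a) (connected_component_set ?L ?q) c 1"
    by (intro global_maxext le q) auto
  moreover have "?q \<in> connected_component_set ?L ?q" using q by simp
  ultimately show ?thesis by blast
qed

text \<open>Two pairs out of three indices share an index s. If the other members differ, all
  boundary values agree, the fluxes at the two junctions vanish in the cell s, and the side of that
  cell joining them lies in one level set, which links A with A'.\<close>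

lemma V1_maxext_unique:
  assumes \<alpha>: "0 \<le> \<alpha>" "\<alpha> < 6" and m: "maxext (U \<alpha> a) A c d" "A \<inter> Vm p 1 \<noteq> {}"
    and m': "maxext (U \<alpha> a) A' c' d'" "A' \<inter> Vm p 1 \<noteq> {}"
  shows "A = A'"
proof -
  let ?b = "phi_m1 \<alpha>"
  have b: "0 \<le> ?b" "?b < 2" using phi_range \<alpha> by auto
  have b6: "?b < 6" using b by simp
  obtain i j where ij: "i \<noteq> j" "sgF p i (p j) \<in> A" using V1_maxext[OF \<alpha> m] by metis
  obtain i' j' where ij': "i' \<noteq> j'" "sgF p i' (p j') \<in> A'" using V1_maxext[OF \<alpha> m'] by metis
  have "\<exists>s t t'. (s = i \<and> t = j \<or> s = j \<and> t = i) \<and> (s = i' \<and> t' = j' \<or> s = j' \<and> t' = i')"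
    using ij(1) ij'(1) exhaust_3[of i] exhaust_3[of j] exhaust_3[of i'] exhaust_3[of j'] by auto
  then obtain s t t' where st: "s \<noteq> t" "sgF p s (p t) \<in> A" "s \<noteq> t'" "sgF p s (p t') \<in> A'"
    using ij ij' by (metis sgF_commute)
  show ?thesis
  proof (cases "t = t'")
    case True
    then show ?thesis using maxext_overlap[OF m(1) m'(1)] st by blast
  next
    case False
    have J: "c = tstep ?b s a $ t" "a $ s = a $ t" using maxext_junction[OF \<alpha> m(1) st(1,2)] by auto
    have J': "c' = tstep ?b s a $ t'" "a $ s = a $ t'" using maxext_junction[OF \<alpha> m'(1) st(3,4)] by auto
    have "tstep ?b s a $ t - tstep ?b s a $ t' = (a $ t - a $ t') / (5 - ?b)"
      using st by (intro tstep_diff) auto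
    then have cc: "c' = c" using J J' by simp
    have fl: "flux ?b (tstep ?b s a) t = 0" using flux_tstep_other[OF b(2) st(1), of a] J by simp
    have "closed_segment (p t) (p t') \<subseteq> {x \<in> SG p. U ?b (tstep ?b s a) x = tstep ?b s a $ t}"
      by (rule segment_level[OF b(1) b6 False _ fl]) (use J J' cc in simp)
    then have lev: "sgF p s ` closed_segment (p t) (p t') \<subseteq> {x \<in> SG p. U \<alpha> a x = c}"
      using \<alpha> J(1) by (auto simp: U_cell)
    have con: "connected (sgF p s ` closed_segment (p t) (p t'))"
      by (intro connected_continuous_image continuous_intros) auto
    have "sgF p s ` closed_segment (p t) (p t') \<subseteq> A"
      by (rule maxextD(5)[OF m(1) con lev]) (use st in auto)
    then have "sgF p s (p t') \<in> A" by auto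
    then show ?thesis using maxext_overlap[OF m(1) m'(1)] st(4) by blast
  qed
qed

text \<open>Not both sets meet V_1, by uniqueness there, and not exactly one, since a tie at the top
  contradicts the strict maximum that the other requires. So both lie in the same cell, and the
  bound on distances halves.\<close>

lemma maxext_close:
  assumes "0 \<le> \<alpha>" "\<alpha> < 6" "maxext (U \<alpha> a) A c d" "maxext (U \<alpha> a) A' c' d'" "A \<noteq> A'" "x \<in> A" "y \<in> A'"
  shows "dist x y \<le> diam / 2 ^ m"
  using assms
proof (induction m arbitrary: \<alpha> a A d A' d' x y)
  case 0
  then show ?case using dist_le_diam maxextD(3)[OF 0(3)] maxextD(3)[OF 0(4)] by auto
next
  case (Suc m)
  let ?b = "phi_m1 \<alpha>"
  have b: "0 \<le> ?b" "?b < 6" using phi_range Suc.prems(1,2) by force+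
  have strict: "\<exists>l B. A = sgF p l ` B \<and> maxext (U ?b (tstep ?b l a)) B c (2 * d) \<and> (\<forall>j. j \<noteq> l \<longrightarrow> a $ j < a $ l)"
    if m1: "maxext (U \<alpha> a) A c d" and V1: "A \<inter> Vm p 1 = {}" for A c d
  proof -
    obtain l B where B: "A = sgF p l ` B" "maxext (U ?b (tstep ?b l a)) B c (2 * d)"
      using maxext_U_cell[OF Suc.prems(1,2) m1 V1] by blast
    have "a $ j < a $ l" if "j \<noteq> l" for j
      by (rule flux_neg_from_cell(2)[OF Suc.prems(1,2) maxext_flux[OF b B(2)] that])
    with B show ?thesis by blast
  qed
  have mixed: False
    if m: "maxext (U \<alpha> a) A c d" "A \<inter> Vm p 1 \<noteq> {}" and m': "maxext (U \<alpha> a) A' c' d'" "A' \<inter> Vm p 1 = {}"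
    for A c d A' c' d'
  proof -
    obtain i j where ij: "i \<noteq> j" "a $ i = a $ j" "\<And>k. a $ k \<le> a $ i"
      using V1_maxext[OF Suc.prems(1,2) m] by metis
    obtain l where "\<And>j. j \<noteq> l \<Longrightarrow> a $ j < a $ l" using strict[OF m'] by blast
    then show False using ij by (metis leD)
  qed
  have V1: "A \<inter> Vm p 1 = {}" "A' \<inter> Vm p 1 = {}"
    using V1_maxext_unique[OF Suc.prems(1-3) _ Suc.prems(4)] Suc.prems(5)
      mixed[OF Suc.prems(3) _ Suc.prems(4)] mixed[OF Suc.prems(4) _ Suc.prems(3)] by blast+
  obtain l B where B: "A = sgF p l ` B" "maxext (U ?b (tstep ?b l a)) B c (2 * d)"
    "\<forall>j. j \<noteq> l \<longrightarrow> a $ j < a $ l" using strict[OF Suc.prems(3) V1(1)] by blast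
  obtain l' B' where B': "A' = sgF p l' ` B'" "maxext (U ?b (tstep ?b l' a)) B' c' (2 * d')"
    "\<forall>j. j \<noteq> l' \<longrightarrow> a $ j < a $ l'" using strict[OF Suc.prems(4) V1(2)] by blast
  have ll: "l' = l" using B(3) B'(3) by (metis less_asym)
  obtain x' where x': "x' \<in> B" "x = sgF p l x'" using Suc.prems(6) B(1) by blast
  obtain y' where y': "y' \<in> B'" "y = sgF p l y'" using Suc.prems(7) B'(1) ll by blast
  have "B \<noteq> B'" using Suc.prems(5) B(1) B'(1) ll by blast
  then have "dist x' y' \<le> diam / 2 ^ m"
    using Suc.IH[OF b B(2) B'(2)[unfolded ll]] x' y' by blast
  then show ?case unfolding x' y' dist_sgF by simp
qed

lemma maxext_unique:
  assumes \<alpha>: "0 \<le> \<alpha>" "\<alpha> < 6" and m: "maxext (U \<alpha> a) A c d" "maxext (U \<alpha> a) A' c' d'"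
  shows "A = A'"
proof (rule ccontr)
  assume ne: "A \<noteq> A'"
  have "x = y" if "x \<in> A" "y \<in> A'" for x y
  proof (rule ccontr)
    assume "x \<noteq> y"
    then obtain n where "diam / 2 ^ n < dist x y" using diam_small[of "dist x y"] by auto
    then show False using maxext_close[OF \<alpha> m ne that, of n] by simp
  qed
  then have "A = A'" using maxextD(1)[OF m(1)] maxextD(1)[OF m(2)] by blast
  then show False using ne by simp
qed

section \<open>The cones of boundary values\<close>

lemma Extr_UR:
  assumes \<alpha>: "0 \<le> \<alpha>" "\<alpha> < 6"
  shows "A \<in> Extr p (UR \<alpha> a) \<longleftrightarrow> (\<exists>c d. maxext (U \<alpha> a) A c d) \<or> (\<exists>c d. maxext (U \<alpha> (- a)) A c d)"
proof -
  have lev: "{x \<in> SG p. UR \<alpha> a x = c} = {x \<in> SG p. U \<alpha> a x = c}" for c by auto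
  have lev': "{x \<in> SG p. U \<alpha> (- a) x = - c} = {x \<in> SG p. U \<alpha> a x = c}" for c
    using \<alpha> by (auto simp: U_minus)
  have m: "maxext (U \<alpha> a) A c d \<longleftrightarrow> A \<in> components {x \<in> SG p. UR \<alpha> a x = c} \<and> A \<inter> V0 p = {} \<and> d > 0 \<and>
     (\<forall>x\<in>sg_nhd p d A. UR \<alpha> a x \<le> c)" for c d
    unfolding maxext_def lev by (auto simp: sg_nhd_def)
  have m': "maxext (U \<alpha> (- a)) A (- c) d \<longleftrightarrow> A \<in> components {x \<in> SG p. UR \<alpha> a x = c} \<and> A \<inter> V0 p = {} \<and> d > 0 \<and>
     (\<forall>x\<in>sg_nhd p d A. UR \<alpha> a x \<ge> c)" for c d
    unfolding maxext_def lev lev' using \<alpha> by (auto simp: sg_nhd_def U_minus)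
  have "A \<in> Extr p (UR \<alpha> a) \<longleftrightarrow> (\<exists>c d. maxext (U \<alpha> a) A c d) \<or> (\<exists>c d. maxext (U \<alpha> (- a)) A (- c) d)"
    unfolding m m' Extr_def by blast
  also have "(\<exists>c d. maxext (U \<alpha> (- a)) A (- c) d) \<longleftrightarrow> (\<exists>c d. maxext (U \<alpha> (- a)) A c d)"
    by (metis minus_minus)
  finally show ?thesis .
qed

text \<open>A maximum and a minimum cannot occur together, because one needs all fluxes negative and
  the other all positive.\<close>

lemma Extr_unique:
  assumes \<alpha>: "0 \<le> \<alpha>" "\<alpha> < 6" and "A \<in> Extr p (UR \<alpha> a)" "A' \<in> Extr p (UR \<alpha> a)"
  shows "A = A'"
proof -
  have "\<not> (maxext (U \<alpha> a) B c d \<and> maxext (U \<alpha> (- a)) B' c' d')" for B c d B' c' d'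
    using maxext_flux[OF \<alpha>, of a B c d 1] maxext_flux[OF \<alpha>, of "- a" B' c' d' 1] by (auto simp: flux_minus)
  then show ?thesis using assms(3,4) maxext_unique[OF \<alpha>] unfolding Extr_UR[OF \<alpha>] by blast
qed

lemma Extr_nonempty_iff:
  assumes \<alpha>: "0 \<le> \<alpha>" "\<alpha> < 6"
  shows "Extr p (UR \<alpha> a) \<noteq> {} \<longleftrightarrow> (\<forall>i. flux \<alpha> a i < 0) \<or> (\<forall>i. flux \<alpha> a i > 0)"
proof
  assume "Extr p (UR \<alpha> a) \<noteq> {}"
  then obtain A where "A \<in> Extr p (UR \<alpha> a)" by blast
  then show "(\<forall>i. flux \<alpha> a i < 0) \<or> (\<forall>i. flux \<alpha> a i > 0)"
    unfolding Extr_UR[OF \<alpha>]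
  proof
    assume "\<exists>c d. maxext (U \<alpha> a) A c d"
    then show ?thesis using maxext_flux[OF \<alpha>] by blast
  next
    assume "\<exists>c d. maxext (U \<alpha> (- a)) A c d"
    then have "flux \<alpha> (- a) i < 0" for i using maxext_flux[OF \<alpha>] by blast
    then show ?thesis by (simp add: flux_minus)
  qed
next
  assume "(\<forall>i. flux \<alpha> a i < 0) \<or> (\<forall>i. flux \<alpha> a i > 0)"
  then have "(\<exists>A c d. maxext (U \<alpha> a) A c d) \<or> (\<exists>A c d. maxext (U \<alpha> (- a)) A c d)"
    using maxext_exists[OF \<alpha>, of a] maxext_exists[OF \<alpha>, of "- a"] by (auto simp: flux_minus)
  then show "Extr p (UR \<alpha> a) \<noteq> {}" using Extr_UR[OF \<alpha>] by blast
qed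

lemma coneA_eq:
  assumes "0 < \<alpha>" "\<alpha> < 6"
  shows "coneA p (psi \<alpha>) = {a. (\<forall>i. flux \<alpha> a i < 0) \<or> (\<forall>i. flux \<alpha> a i > 0)}"
  unfolding coneA_def using assms by (simp add: tauD_inv_eq Extr_nonempty_iff)

lemma topTie_iff:
  assumes \<alpha>: "0 \<le> \<alpha>" "\<alpha> < 6"
  shows "topTie \<alpha> a \<longleftrightarrow> (\<exists>A c d. maxext (U \<alpha> a) A c d \<and> A \<inter> Vm p 1 \<noteq> {})"
proof
  assume t: "topTie \<alpha> a"
  then obtain i j where ij: "i \<noteq> j" "a $ i = a $ j" "\<And>k. a $ k \<le> a $ i"
    and f: "\<And>i. flux \<alpha> a i < 0" unfolding topTie_def by blast
  show "\<exists>A c d. maxext (U \<alpha> a) A c d \<and> A \<inter> Vm p 1 \<noteq> {}"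
    using V1_maxext_exists[OF \<alpha> f ij] junction_in_V1[of i j] by blast
next
  assume "\<exists>A c d. maxext (U \<alpha> a) A c d \<and> A \<inter> Vm p 1 \<noteq> {}"
  then obtain A c d where m: "maxext (U \<alpha> a) A c d" "A \<inter> Vm p 1 \<noteq> {}" by blast
  then show "topTie \<alpha> a"
    using V1_maxext[OF \<alpha> m] maxext_flux[OF \<alpha> m(1)] unfolding topTie_def by metis
qed

lemma coneB_eq:
  assumes "0 < \<alpha>" "\<alpha> < 6"
  shows "coneB p (psi \<alpha>) = {a. topTie \<alpha> a \<or> topTie \<alpha> (- a)}"
proof -
  have \<alpha>: "0 \<le> \<alpha>" using assms by simp
  have "(\<exists>!A. A \<in> Extr p (UR \<alpha> a) \<and> A \<inter> Vm p 1 \<noteq> {}) \<longleftrightarrow> (\<exists>A. A \<in> Extr p (UR \<alpha> a) \<and> A \<inter> Vm p 1 \<noteq> {})" for a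
    using Extr_unique[OF \<alpha> assms(2)] by blast
  also have "\<dots> a \<longleftrightarrow> topTie \<alpha> a \<or> topTie \<alpha> (- a)" for a
    unfolding topTie_iff[OF \<alpha> assms(2)] Extr_UR[OF \<alpha> assms(2)] by blast
  finally show ?thesis
    unfolding coneB_def tauD_inv_eq[OF \<alpha> assms(2)] by simp
qed

text \<open>Finiteness is part of the claim because \<open>card\<close> of an infinite set is
  0.\<close>

lemma eigenfunction_Extr:
  assumes "0 \<le> l" "l < psi 6" "eigenfunction p l u"
  shows "finite (Extr p u) \<and> card (Extr p u) \<le> 1"
proof -
  obtain \<alpha> where \<alpha>: "0 \<le> \<alpha>" "\<alpha> < 6" "psi \<alpha> = l" using psi_surj[OF assms(1,2)] by blast
  have "u \<in> eigenspace p (psi \<alpha>)" using assms(3) \<alpha>(3) unfolding eigenfunction_def by simp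
  then have "u = UR \<alpha> (tauD p u)" by (rule eigenspace_eq_UR[OF \<alpha>(1,2)])
  then have "A = A'" if "A \<in> Extr p u" "A' \<in> Extr p u" for A A'
    using Extr_unique[OF \<alpha>(1,2)] that by metis
  then have "\<exists>A. Extr p u \<subseteq> {A}" by blast
  then obtain A where "Extr p u \<subseteq> {A}" by blast
  then show ?thesis using card_mono[of "{A}" "Extr p u"] finite_subset[of "Extr p u" "{A}"] by simp
qed

end

section \<open>The projective plane\<close>

lemma Qt_components:
  "(Qt *v x) $ 1 = sqrt 3 / 2 * (x $ 3 - x $ 2)" "(Qt *v x) $ 2 = x $ 1 - (x $ 2 + x $ 3) / 2"
  by (simp_all add: Qt_def matrix_vector_mult_def sum_3 Qcol_def field_simps)

text \<open>The point of \<open>\<pi>\<inverse>(\<xi>)\<close> with coordinate sum 1.\<close>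

definition lift :: "real^2 \<Rightarrow> real^3" where
  "lift \<xi> = vector [(1 + 2 * \<xi> $ 2) / 3, (1 - sqrt 3 * \<xi> $ 1 - \<xi> $ 2) / 3, (1 + sqrt 3 * \<xi> $ 1 - \<xi> $ 2) / 3]"

lemma lift_components:
  "lift \<xi> $ 1 = (1 + 2 * \<xi> $ 2) / 3" "lift \<xi> $ 2 = (1 - sqrt 3 * \<xi> $ 1 - \<xi> $ 2) / 3"
  "lift \<xi> $ 3 = (1 + sqrt 3 * \<xi> $ 1 - \<xi> $ 2) / 3"
  by (simp_all add: lift_def)

lemma csum_lift: "csum (lift \<xi>) = 1"
  by (simp add: csum_def sum_3 lift_components field_simps)

lemma sqrt3: "sqrt 3 * (sqrt 3 * x) = 3 * x"
  by (simp flip: mult.assoc)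

lemma Qt_lift: "Qt *v lift \<xi> = \<xi>"
  by (simp add: vec_eq_iff forall_2 Qt_components lift_components field_simps sqrt3)

lemma proj_csum: "proj x = (if csum x \<noteq> 0 then Affine (inverse (csum x) *\<^sub>R (Qt *v x))
    else At_infinity (abs_direction (Qt *v x)))"
  by (simp add: proj_def csum_def)

lemma proj_lift: "proj (lift \<xi>) = Affine \<xi>"
  by (simp add: proj_csum csum_lift Qt_lift)

lemma csum_Qt_inject:
  assumes "csum x = csum y" "Qt *v x = Qt *v y"
  shows "x = y"
proof -
  have "sqrt 3 / 2 * (x $ 3 - x $ 2) = sqrt 3 / 2 * (y $ 3 - y $ 2)"
    "x $ 1 - (x $ 2 + x $ 3) / 2 = y $ 1 - (y $ 2 + y $ 3) / 2"
    using assms(2) Qt_components by metis+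
  then have "x $ 3 - x $ 2 = y $ 3 - y $ 2" "x $ 1 - (x $ 2 + x $ 3) / 2 = y $ 1 - (y $ 2 + y $ 3) / 2"
    by auto
  moreover have "x $ 1 + x $ 2 + x $ 3 = y $ 1 + y $ 2 + y $ 3"
    using assms(1) by (simp add: csum_def sum_3)
  ultimately have "x $ 1 = y $ 1" "x $ 2 = y $ 2" "x $ 3 = y $ 3" by argo+
  then show ?thesis by (simp add: vec_eq_iff forall_3)
qed

lemma proj_AffineD:
  assumes "proj x = Affine \<xi>"
  shows "csum x \<noteq> 0" "x = csum x *\<^sub>R lift \<xi>"
proof -
  show c: "csum x \<noteq> 0" using assms by (auto simp: proj_csum split: if_splits)
  then have \<xi>: "\<xi> = inverse (csum x) *\<^sub>R (Qt *v x)" using assms by (simp add: proj_csum)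
  show "x = csum x *\<^sub>R lift \<xi>"
    by (rule csum_Qt_inject)
       (use c in \<open>simp_all add: csum_scale csum_lift matrix_vector_mult_scaleR Qt_lift \<xi>\<close>)
qed

text \<open>A double cone that avoids the plane projected to the line at infinity, in particular the
  origin, where \<open>proj\<close> has no meaning. Membership can then be tested at the
  representative of coordinate sum 1.\<close>

definition cone :: "(real^3 \<Rightarrow> bool) \<Rightarrow> bool" where
  "cone P \<longleftrightarrow> (\<forall>c a. c \<noteq> 0 \<longrightarrow> P a \<longrightarrow> P (c *\<^sub>R a)) \<and> (\<forall>a. P a \<longrightarrow> csum a \<noteq> 0)"

lemma cone_lift_iff:
  assumes "cone P" "proj x = Affine \<xi>"
  shows "P x \<longleftrightarrow> P (lift \<xi>)"
proof -
  note x = proj_AffineD[OF assms(2)]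
  have "lift \<xi> = inverse (csum x) *\<^sub>R (csum x *\<^sub>R lift \<xi>)" using x(1) by simp
  then have "lift \<xi> = inverse (csum x) *\<^sub>R x" using x(2) by simp
  then show ?thesis using assms(1) x unfolding cone_def by (metis inverse_nonzero_iff_nonzero)
qed

lemma cone_proj:
  assumes "cone P" "P x"
  obtains \<xi> where "proj x = Affine \<xi>" "P (lift \<xi>)"
proof -
  have "csum x \<noteq> 0" using assms unfolding cone_def by blast
  then have "proj x = Affine (inverse (csum x) *\<^sub>R (Qt *v x))" by (simp add: proj_csum)
  then show ?thesis using that cone_lift_iff[OF assms(1)] assms(2) by blast
qed

lemma proj_cone:
  assumes "cone P"
  shows "proj ` {a. P a} = Affine ` {\<xi>. P (lift \<xi>)}"
proof
  show "proj ` {a. P a} \<subseteq> Affine ` {\<xi>. P (lift \<xi>)}"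
    using cone_proj[OF assms] by (fastforce simp: image_iff)
  show "Affine ` {\<xi>. P (lift \<xi>)} \<subseteq> proj ` {a. P a}"
    by (auto simp: image_iff) (metis proj_lift)
qed

lemma proj_in_cone:
  assumes "cone P"
  shows "proj x \<in> proj ` {a. P a} \<longleftrightarrow> P x"
proof
  assume "proj x \<in> proj ` {a. P a}"
  then obtain \<xi> where "proj x = Affine \<xi>" "P (lift \<xi>)"
    unfolding proj_cone[OF assms] by blast
  then show "P x" using cone_lift_iff[OF assms] by blast
qed blast

lemma proj_surj: "\<exists>a. a \<noteq> 0 \<and> proj a = x"
proof (cases x)
  case (Affine \<xi>)
  have "lift \<xi> \<noteq> 0" using csum_lift[of \<xi>] by (auto simp: csum_def)
  then show ?thesis using proj_lift Affine by blast
next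
  case (At_infinity d)
  obtain v where v: "v \<noteq> 0" "d = abs_direction v"
    by (induction d rule: direction.abs_induct) (auto simp: parallel_def)
  \<comment> \<open>A difference of two lifts has coordinate sum 0, and \<open>Qt\<close> sends this
    one to v - 0.\<close>
  define a where "a = lift v - lift 0"
  have "csum a = csum (lift v) - csum (lift 0)"
    by (simp add: csum_def a_def sum_subtractf)
  then have c: "csum a = 0" by (simp add: csum_lift)
  have q: "Qt *v a = v"
    unfolding a_def by (simp add: matrix_vector_mult_diff_distrib Qt_lift)
  have "a \<noteq> 0" using q v(1) by auto
  moreover have "proj a = x" using c q v At_infinity by (simp add: proj_csum)
  ultimately show ?thesis by blast
qed

lemma inv_proj: "proj (inv_into (- {0}) proj x) = x"
  using proj_surj[of x] by (intro f_inv_into_f) auto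

section \<open>From inequalities between boundary values to polygons\<close>

definition sameSign :: "real \<Rightarrow> real^3 \<Rightarrow> bool" where
  "sameSign \<alpha> a \<longleftrightarrow> (\<forall>i. flux \<alpha> a i < 0) \<or> (\<forall>i. flux \<alpha> a i > 0)"

lemma csum_neg_flux: "\<alpha> > 0 \<Longrightarrow> \<forall>i. flux \<alpha> a i < 0 \<Longrightarrow> csum a > 0"
proof -
  assume a: "\<alpha> > 0" "\<forall>i. flux \<alpha> a i < 0"
  then have "(\<Sum>i\<in>UNIV. flux \<alpha> a i) < 0" by (simp add: sum_3 add_neg_neg)
  then show "csum a > 0" using a(1) by (simp add: sum_flux zero_less_mult_iff)
qed

lemma csum_pos_flux: "\<alpha> > 0 \<Longrightarrow> \<forall>i. flux \<alpha> a i > 0 \<Longrightarrow> csum a < 0"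
  using csum_neg_flux[of \<alpha> "- a"] by (simp add: flux_minus csum_minus)

lemma cone_sameSign:
  assumes "\<alpha> > 0"
  shows "cone (sameSign \<alpha>)"
  unfolding cone_def
proof (intro conjI allI impI)
  fix c :: real and a assume "c \<noteq> 0" "sameSign \<alpha> a"
  then show "sameSign \<alpha> (c *\<^sub>R a)"
    unfolding sameSign_def flux_scale by (cases "c > 0") (auto simp: zero_less_mult_iff mult_less_0_iff)
next
  fix a assume "sameSign \<alpha> a"
  then show "csum a \<noteq> 0"
    using csum_neg_flux[OF assms, of a] csum_pos_flux[OF assms, of a] unfolding sameSign_def by auto
qed

lemma sameSign_lift: "\<alpha> > 0 \<Longrightarrow> sameSign \<alpha> (lift \<xi>) \<longleftrightarrow> (\<forall>i. flux \<alpha> (lift \<xi>) i < 0)"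
  using csum_pos_flux[of \<alpha> "lift \<xi>"] by (auto simp: sameSign_def csum_lift)

text \<open>At coordinate sum 1 negative flux is a half-plane condition. The bound 6 / (6 -
  \<alpha>) is split because \<alpha> / (6 - \<alpha>) is the scale of all the polygons.\<close>

lemma flux_lift_neg:
  assumes "0 < \<alpha>" "\<alpha> < 6"
  shows "flux \<alpha> (lift \<xi>) i < 0 \<longleftrightarrow> 3 * lift \<xi> $ i < 1 + \<alpha> / (6 - \<alpha>)"
proof -
  have "1 + \<alpha> / (6 - \<alpha>) = 6 / (6 - \<alpha>)" using assms by (simp add: field_simps)
  moreover have "3 * lift \<xi> $ i < 6 / (6 - \<alpha>) \<longleftrightarrow> 3 * lift \<xi> $ i * (6 - \<alpha>) < 6"
    using assms by (intro pos_less_divide_eq) simp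
  moreover have "3 * lift \<xi> $ i * (6 - \<alpha>) < 6 \<longleftrightarrow> (6 - \<alpha>) / 2 * lift \<xi> $ i - 1 < 0"
    by (simp add: algebra_simps) linarith
  ultimately show ?thesis
    unfolding flux_def csum_lift by simp
qed

lemma sameSign_calD:
  assumes "0 < \<alpha>" "\<alpha> < 6"
  shows "{\<xi>. sameSign \<alpha> (lift \<xi>)} = calD \<alpha>"
proof -
  define e where "e = \<alpha> / (6 - \<alpha>)"
  have e2: "\<alpha> / (2 * (6 - \<alpha>)) = e / 2" by (simp add: e_def)
  have abs: "sqrt 3 * \<bar>x\<bar> = \<bar>sqrt 3 * x\<bar>" for x by (simp add: abs_mult)
  have "sameSign \<alpha> (lift \<xi>) \<longleftrightarrow> \<xi> \<in> calD \<alpha>" for \<xi>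
    unfolding sameSign_lift[OF assms(1)] flux_lift_neg[OF assms] calD_def mem_Collect_eq e2 abs
      e_def[symmetric] forall_3 lift_components
    by (simp add: field_simps abs_less_iff) linarith
  then show ?thesis by blast
qed

lemma zeta_commute: "zeta \<alpha> i j = zeta \<alpha> j i"
  by (simp add: zeta_def insert_commute)

lemma lift_combination:
  "lift (y *\<^sub>R u + z *\<^sub>R v) $ m - 1/3 = y * (lift u $ m - 1/3) + z * (lift v $ m - 1/3)"
  using exhaust_3[of m] by (elim disjE) (simp_all add: lift_components field_simps)

text \<open>For 0 < \<alpha> < 6 the coordinates i and j reach the bound of
  \<open>flux_lift_neg\<close>, so this is the corner of the triangle at which the fluxes i and j
  vanish.\<close>

lemma lift_zeta:
  assumes "i \<noteq> j"
  shows "lift (zeta \<alpha> i j) $ m - 1/3 = (if m = i \<or> m = j then 1/3 else - 2/3) * (\<alpha> / (6 - \<alpha>))"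
proof -
  define e where "e = \<alpha> / (6 - \<alpha>)"
  have e2: "\<alpha> / (2 * (6 - \<alpha>)) = e / 2" by (simp add: e_def)
  have z: "zeta \<alpha> 2 3 = e *\<^sub>R vector [0, -1]" "zeta \<alpha> 3 1 = (e / 2) *\<^sub>R vector [sqrt 3, 1]"
    "zeta \<alpha> 1 2 = (e / 2) *\<^sub>R vector [- sqrt 3, 1]"
    unfolding e_def e2[symmetric] by (simp_all add: zeta_def doubleton_eq_iff)
  have s: "sqrt 3 * (e / 2 * sqrt 3) = 3 * e / 2" "sqrt 3 * (e * sqrt 3) = 3 * e"
    by (simp_all add: mult.left_commute)
  have "lift (zeta \<alpha> 2 3) $ m - 1/3 = (if m = 2 \<or> m = 3 then 1/3 else - 2/3) * e"
    "lift (zeta \<alpha> 3 1) $ m - 1/3 = (if m = 3 \<or> m = 1 then 1/3 else - 2/3) * e"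
    "lift (zeta \<alpha> 1 2) $ m - 1/3 = (if m = 1 \<or> m = 2 then 1/3 else - 2/3) * e"
    unfolding z using exhaust_3[of m] by (auto simp: lift_components s add_divide_distrib diff_divide_distrib)
  then show ?thesis
    using assms exhaust_3[of i] exhaust_3[of j] unfolding e_def[symmetric]
    by (elim disjE) (simp_all add: zeta_commute[of \<alpha> 3 2] zeta_commute[of \<alpha> 1 3] zeta_commute[of \<alpha> 2 1])
qed

text \<open>With respect to the two corners adjacent to i the coordinates are, up to the scale e,
  the differences of entry i to the other two, and their sum measures entry i itself. This turns
  order and size conditions into positions in the plane.\<close>

lemma zeta_coords:
  fixes \<alpha> :: real
  assumes "i \<noteq> j" "k \<noteq> i" "k \<noteq> j"
  defines "e \<equiv> \<alpha> / (6 - \<alpha>)"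
  shows "\<xi> = y *\<^sub>R zeta \<alpha> i j + z *\<^sub>R zeta \<alpha> i k \<longleftrightarrow>
    lift \<xi> $ i - lift \<xi> $ k = e * y \<and> lift \<xi> $ i - lift \<xi> $ j = e * z"
    and "\<xi> = y *\<^sub>R zeta \<alpha> i j + z *\<^sub>R zeta \<alpha> i k \<Longrightarrow> 3 * lift \<xi> $ i = 1 + e * (y + z)"
proof -
  let ?\<eta> = "y *\<^sub>R zeta \<alpha> i j + z *\<^sub>R zeta \<alpha> i k"
  have ik: "i \<noteq> k" using assms by simp
  have "lift ?\<eta> $ i - 1/3 = y * (1/3 * e) + z * (1/3 * e)"
    "lift ?\<eta> $ j - 1/3 = y * (1/3 * e) + z * (- 2/3 * e)"
    "lift ?\<eta> $ k - 1/3 = y * (- 2/3 * e) + z * (1/3 * e)"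
    unfolding lift_combination lift_zeta[OF assms(1)] lift_zeta[OF ik] using assms(1-3)
    by (auto simp: e_def)
  then have \<eta>: "3 * lift ?\<eta> $ i = 1 + e * (y + z)"
    "lift ?\<eta> $ i - lift ?\<eta> $ k = e * y" "lift ?\<eta> $ i - lift ?\<eta> $ j = e * z"
    by (simp_all add: algebra_simps)
  then show "\<xi> = ?\<eta> \<Longrightarrow> 3 * lift \<xi> $ i = 1 + e * (y + z)" by simp
  have UNIV: "UNIV = {i, j, k}" using assms(1-3) third_index[OF assms(1)] by (metis UNIV_I insertE singletonD)
  show "\<xi> = ?\<eta> \<longleftrightarrow> lift \<xi> $ i - lift \<xi> $ k = e * y \<and> lift \<xi> $ i - lift \<xi> $ j = e * z"
  proof
    assume h: "lift \<xi> $ i - lift \<xi> $ k = e * y \<and> lift \<xi> $ i - lift \<xi> $ j = e * z"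
    have "lift \<xi> $ i + lift \<xi> $ j + lift \<xi> $ k = lift ?\<eta> $ i + lift ?\<eta> $ j + lift ?\<eta> $ k"
      using csum_lift[of \<xi>] csum_lift[of ?\<eta>] unfolding csum_third[OF UNIV assms(1-3)] by simp
    then have "lift \<xi> $ i = lift ?\<eta> $ i" "lift \<xi> $ j = lift ?\<eta> $ j" "lift \<xi> $ k = lift ?\<eta> $ k"
      using h \<eta> by linarith+
    then have "lift \<xi> $ m = lift ?\<eta> $ m" if "m \<in> {i, j, k}" for m using that by blast
    then have "lift \<xi> = lift ?\<eta>" unfolding vec_eq_iff using UNIV by blast
    then show "\<xi> = ?\<eta>" using Qt_lift by metis
  qed (use \<eta> in simp)
qed

text \<open>The pullback of \<open>sameSign\<close> under the map to the cell i;
  \<open>topCorner_iff\<close> reads it as a strict maximum a_i with negative flux, or the same with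
  signs reversed.\<close>

definition topCorner :: "real \<Rightarrow> 3 \<Rightarrow> real^3 \<Rightarrow> bool" where
  "topCorner \<alpha> i a \<longleftrightarrow> sameSign (phi_m1 \<alpha>) (tstep (phi_m1 \<alpha>) i a)"

lemma tstep_scale: "tstep b i (c *\<^sub>R a) = c *\<^sub>R tstep b i a"
  by (simp add: tstep_def vec_eq_iff csum_scale distrib_left add_divide_distrib)

lemma flux_tstep_neg_iff:
  assumes "0 \<le> \<alpha>" "\<alpha> < 6"
  shows "(\<forall>j. flux (phi_m1 \<alpha>) (tstep (phi_m1 \<alpha>) i a) j < 0) \<longleftrightarrow>
    flux \<alpha> a i < 0 \<and> (\<forall>j. j \<noteq> i \<longrightarrow> a $ j < a $ i)"
proof -
  let ?b = "phi_m1 \<alpha>"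
  have b: "0 \<le> ?b" "?b < 2" using phi_range[OF assms] by auto
  have q: "?b * (5 - ?b) = \<alpha>" using assms by (intro phi_quad) simp
  have pos: "(6 - ?b) / ((2 - ?b) * (5 - ?b)) > 0" "(6 - ?b) / (2 * (5 - ?b)) > 0"
    using b by (auto intro!: divide_pos_pos mult_pos_pos)
  have 1: "flux ?b (tstep ?b i a) i < 0 \<longleftrightarrow> flux \<alpha> a i < 0"
    unfolding flux_tstep_same[OF b(2)] q using pos(1) by (meson mult_less_0_iff less_asym)
  have 2: "flux ?b (tstep ?b i a) j < 0 \<longleftrightarrow> a $ j < a $ i" if "j \<noteq> i" for j
  proof -
    have "flux ?b (tstep ?b i a) j < 0 \<longleftrightarrow> a $ j - a $ i < 0"
      unfolding flux_tstep_other[OF b(2) that[symmetric]] using pos(2) by (meson mult_less_0_iff less_asym)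
    then show ?thesis by simp
  qed
  show ?thesis using 1 2 by metis
qed

lemma topCorner_iff:
  assumes "0 \<le> \<alpha>" "\<alpha> < 6"
  shows "topCorner \<alpha> i a \<longleftrightarrow>
    flux \<alpha> a i < 0 \<and> (\<forall>j. j \<noteq> i \<longrightarrow> a $ j < a $ i) \<or>
    flux \<alpha> a i > 0 \<and> (\<forall>j. j \<noteq> i \<longrightarrow> a $ j > a $ i)"
  using flux_tstep_neg_iff[OF assms, of i a] flux_tstep_neg_iff[OF assms, of i "- a"]
  unfolding topCorner_def sameSign_def by (simp add: tstep_minus flux_minus)

lemma topCorner_csum:
  assumes "0 < \<alpha>" "\<alpha> < 6" "flux \<alpha> a i < 0" "\<And>j. j \<noteq> i \<Longrightarrow> a $ j < a $ i"
  shows "csum a > 0"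
proof -
  have "flux \<alpha> a j < 0" for j
  proof -
    have "a $ j \<le> a $ i" using assms(4)[of j] by (cases "j = i") auto
    then have "(6 - \<alpha>) / 2 * a $ j \<le> (6 - \<alpha>) / 2 * a $ i"
      using assms(2) by (intro mult_left_mono) auto
    then show ?thesis using assms(3) by (simp add: flux_def)
  qed
  then show ?thesis using csum_neg_flux[OF assms(1)] by blast
qed

lemma cone_topCorner:
  assumes "0 < \<alpha>" "\<alpha> < 6"
  shows "cone (topCorner \<alpha> i)"
proof -
  have b: "phi_m1 \<alpha> > 0" using assms phi_pos by simp
  have \<alpha>: "0 \<le> \<alpha>" using assms by simp
  have "csum a \<noteq> 0" if t: "topCorner \<alpha> i a" for a
    using t topCorner_csum[OF assms, of a i] topCorner_csum[OF assms, of "- a" i]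
    unfolding topCorner_iff[OF \<alpha> assms(2)] by (auto simp: flux_minus csum_minus)
  then show ?thesis
    using cone_sameSign[OF b] unfolding cone_def topCorner_def tstep_scale by blast
qed

lemma topCorner_lift:
  assumes "0 < \<alpha>" "\<alpha> < 6"
  shows "topCorner \<alpha> i (lift \<xi>) \<longleftrightarrow>
    3 * lift \<xi> $ i < 1 + \<alpha> / (6 - \<alpha>) \<and> (\<forall>j. j \<noteq> i \<longrightarrow> lift \<xi> $ j < lift \<xi> $ i)"
proof -
  have \<alpha>: "0 \<le> \<alpha>" using assms by simp
  have "\<not> (flux \<alpha> (lift \<xi>) i > 0 \<and> (\<forall>j. j \<noteq> i \<longrightarrow> lift \<xi> $ j > lift \<xi> $ i))"
    using topCorner_csum[OF assms, of "- lift \<xi>" i] by (auto simp: flux_minus csum_minus csum_lift)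
  then show ?thesis
    unfolding topCorner_iff[OF \<alpha> assms(2)] flux_lift_neg[OF assms] by blast
qed

text \<open>The strict inequalities to a_i give positive weights at the two outer corners, and
  negative flux makes them add up to less than 1, so a positive weight remains for the
  origin.\<close>

lemma topCorner_calG:
  assumes "0 < \<alpha>" "\<alpha> < 6"
  shows "{\<xi>. topCorner \<alpha> i (lift \<xi>)} = calG \<alpha> i"
proof -
  define e where "e = \<alpha> / (6 - \<alpha>)"
  have e: "e > 0" using assms by (simp add: e_def)
  obtain j where j: "i \<noteq> j" by (metis zero_neq_one)
  obtain k where k: "UNIV = {i, j, k}" "i \<noteq> j" "k \<noteq> i" "k \<noteq> j"
    using third_index[OF j] j by metis
  note Z = zeta_coords[OF k(2-4), where \<alpha> = \<alpha>, folded e_def]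
  have c: "- {i} = {j, k}" using k by blast
  \<comment> \<open>The description of the interior by strictly positive weights is for a
    nondegenerate triangle.\<close>
  have ncol: "\<not> collinear {0, zeta \<alpha> i j, zeta \<alpha> i k}"
  proof
    have l0: "lift 0 $ m = 1/3" for m using exhaust_3[of m] by (auto simp: lift_components)
    have ind: "y = 0 \<and> z = 0" if "y *\<^sub>R zeta \<alpha> i j + z *\<^sub>R zeta \<alpha> i k = 0" for y z
      using Z(1)[of 0 y z] that e by (simp add: l0)
    assume "collinear {0, zeta \<alpha> i j, zeta \<alpha> i k}"
    then consider "zeta \<alpha> i j = 0" | "zeta \<alpha> i k = 0" | c where "zeta \<alpha> i k = c *\<^sub>R zeta \<alpha> i j"
      unfolding collinear_lemma by blast
    then show False
    proof cases
      case 1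
      then show False using ind[of 1 0] by simp
    next
      case 2
      then show False using ind[of 0 1] by simp
    next
      case (3 c)
      then show False using ind[of c "-1"] by simp
    qed
  qed
  have G: "calG \<alpha> i = {v. \<exists>x y z. 0 < x \<and> 0 < y \<and> 0 < z \<and> x + y + z = 1 \<and>
      x *\<^sub>R 0 + y *\<^sub>R zeta \<alpha> i j + z *\<^sub>R zeta \<alpha> i k = v}"
    unfolding calG_def c image_insert image_empty
    by (rule interior_convex_hull_3_minimal[OF ncol]) simp
  have "topCorner \<alpha> i (lift \<xi>) \<longleftrightarrow> \<xi> \<in> calG \<alpha> i" for \<xi>
  proof
    assume t: "topCorner \<alpha> i (lift \<xi>)"
    define y z where "y = (lift \<xi> $ i - lift \<xi> $ k) / e" and "z = (lift \<xi> $ i - lift \<xi> $ j) / e"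
    have eq: "\<xi> = y *\<^sub>R zeta \<alpha> i j + z *\<^sub>R zeta \<alpha> i k"
      unfolding Z(1) using e by (simp add: y_def z_def)
    have l: "lift \<xi> $ k < lift \<xi> $ i" "lift \<xi> $ j < lift \<xi> $ i" "3 * lift \<xi> $ i < 1 + e"
      using t k unfolding topCorner_lift[OF assms] e_def by auto
    then have "e * (y + z) < e * 1" using Z(2)[OF eq] by simp
    then have "y + z < 1" using e by (simp only: mult_less_cancel_left_pos)
    moreover have "y > 0" "z > 0" using l e by (auto simp: y_def z_def)
    ultimately show "\<xi> \<in> calG \<alpha> i"
      unfolding G using eq by (intro CollectI exI[of _ "1 - y - z"] exI[of _ y] exI[of _ z]) simp
  next
    assume "\<xi> \<in> calG \<alpha> i"
    then obtain x y z where xyz: "0 < x" "0 < y" "0 < z" "x + y + z = 1"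
      and eq: "\<xi> = y *\<^sub>R zeta \<alpha> i j + z *\<^sub>R zeta \<alpha> i k" unfolding G by auto
    have "lift \<xi> $ i - lift \<xi> $ k = e * y" "lift \<xi> $ i - lift \<xi> $ j = e * z"
      using eq Z(1) by auto
    moreover have "e * y > 0" "e * z > 0" using xyz e by auto
    ultimately have less: "lift \<xi> $ k < lift \<xi> $ i" "lift \<xi> $ j < lift \<xi> $ i" by linarith+
    have "e * (y + z) < e * 1" using xyz e by (intro mult_strict_left_mono) auto
    then have "3 * lift \<xi> $ i < 1 + e" using Z(2)[OF eq] by simp
    moreover have "lift \<xi> $ n < lift \<xi> $ i" if "n \<noteq> i" for n
    proof -
      have "n \<in> {j, k}" using that c by blast
      then show ?thesis using less by blast
    qed
    ultimately show "topCorner \<alpha> i (lift \<xi>)" unfolding topCorner_lift[OF assms] e_def by blast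
  qed
  then show ?thesis by blast
qed

lemma topTie_scale:
  assumes "c > 0" "topTie \<alpha> a"
  shows "topTie \<alpha> (c *\<^sub>R a)"
  using assms unfolding topTie_def flux_scale by (auto simp: mult_less_0_iff)

definition bTie :: "real \<Rightarrow> real^3 \<Rightarrow> bool" where
  "bTie \<alpha> a \<longleftrightarrow> topTie \<alpha> a \<or> topTie \<alpha> (- a)"

lemma cone_bTie:
  assumes "0 < \<alpha>"
  shows "cone (bTie \<alpha>)"
  unfolding cone_def
proof (intro conjI allI impI)
  fix c :: real and a assume c: "c \<noteq> 0" and t: "bTie \<alpha> a"
  have "c > 0 \<or> - c > 0" using c by auto
  then show "bTie \<alpha> (c *\<^sub>R a)"
    using t topTie_scale[of c \<alpha> a] topTie_scale[of c \<alpha> "- a"]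
      topTie_scale[of "- c" \<alpha> a] topTie_scale[of "- c" \<alpha> "- a"]
    unfolding bTie_def by auto
next
  fix a assume "bTie \<alpha> a"
  then show "csum a \<noteq> 0"
    using csum_neg_flux[OF assms, of a] csum_neg_flux[OF assms, of "- a"]
    unfolding bTie_def topTie_def by (auto simp: csum_minus)
qed

lemma bTie_lift:
  assumes "0 < \<alpha>" "\<alpha> < 6"
  shows "bTie \<alpha> (lift \<xi>) \<longleftrightarrow> (\<exists>i j. i \<noteq> j \<and> lift \<xi> $ i = lift \<xi> $ j \<and>
    (\<forall>k. lift \<xi> $ k \<le> lift \<xi> $ i) \<and> 3 * lift \<xi> $ i < 1 + \<alpha> / (6 - \<alpha>))"
proof -
  have "\<not> topTie \<alpha> (- lift \<xi>)"
    using csum_neg_flux[OF assms(1), of "- lift \<xi>"] unfolding topTie_def by (auto simp: csum_minus csum_lift)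
  then show ?thesis
    unfolding bTie_def topTie_def flux_lift_neg[OF assms]
    by (meson le_less_trans mult_le_cancel_left_pos zero_less_numeral)
qed

text \<open>Each pair of tied coordinates contributes the half-open segment of parameters 0 \<le> t
  < 1. The value t = 0 is common to all three, which is why the origin appears beside the open
  segments.\<close>

lemma bTie_calL:
  assumes "0 < \<alpha>" "\<alpha> < 6"
  shows "{\<xi>. bTie \<alpha> (lift \<xi>)} = (\<Union>(i, j)\<in>S1. calL \<alpha> i j) \<union> {0}"
proof -
  define e where "e = \<alpha> / (6 - \<alpha>)"
  have e: "e > 0" using assms by (simp add: e_def)
  have l0: "lift 0 $ m = 1/3" for m using exhaust_3[of m] by (auto simp: lift_components)
  have tie: "(\<exists>t. 0 \<le> t \<and> t < 1 \<and> \<xi> = t *\<^sub>R zeta \<alpha> i j) \<longleftrightarrow>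
    lift \<xi> $ i = lift \<xi> $ j \<and> (\<forall>k. lift \<xi> $ k \<le> lift \<xi> $ i) \<and> 3 * lift \<xi> $ i < 1 + e"
    if ij: "i \<noteq> j" for \<xi> i j
  proof -
    obtain k where k: "UNIV = {i, j, k}" "i \<noteq> j" "k \<noteq> i" "k \<noteq> j"
      using third_index[OF ij] ij by metis
    note Z = zeta_coords[OF k(2-4), where \<alpha> = \<alpha>, folded e_def]
    show ?thesis
    proof
      assume "\<exists>t. 0 \<le> t \<and> t < 1 \<and> \<xi> = t *\<^sub>R zeta \<alpha> i j"
      then obtain t where t: "0 \<le> t" "t < 1" "\<xi> = t *\<^sub>R zeta \<alpha> i j + 0 *\<^sub>R zeta \<alpha> i k" by auto
      have a: "lift \<xi> $ i - lift \<xi> $ k = e * t" "lift \<xi> $ i = lift \<xi> $ j" 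
        using Z(1)[THEN iffD1, OF t(3)] by auto
      moreover have "0 \<le> e * t" using e t by simp
      ultimately have "lift \<xi> $ n \<le> lift \<xi> $ i" if "n \<in> {i, j, k}" for n using that by auto
      then have "\<forall>n. lift \<xi> $ n \<le> lift \<xi> $ i" using k(1) by blast
      moreover have "e * t < e * 1" using e t by (intro mult_strict_left_mono) auto
      then have "3 * lift \<xi> $ i < 1 + e" using Z(2)[OF t(3)] by simp
      ultimately show "lift \<xi> $ i = lift \<xi> $ j \<and> (\<forall>k. lift \<xi> $ k \<le> lift \<xi> $ i) \<and> 3 * lift \<xi> $ i < 1 + e"
        using a by blast
    next
      assume h: "lift \<xi> $ i = lift \<xi> $ j \<and> (\<forall>k. lift \<xi> $ k \<le> lift \<xi> $ i) \<and> 3 * lift \<xi> $ i < 1 + e"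
      define t where "t = (lift \<xi> $ i - lift \<xi> $ k) / e"
      have eq: "\<xi> = t *\<^sub>R zeta \<alpha> i j + 0 *\<^sub>R zeta \<alpha> i k"
        unfolding Z(1) using e h by (simp add: t_def)
      have "e * t < e * 1" using Z(2)[OF eq] h by simp
      then have "t < 1" using e by (simp only: mult_less_cancel_left_pos)
      moreover have "lift \<xi> $ k \<le> lift \<xi> $ i" using h by blast
      then have "0 \<le> t" using e by (simp add: t_def)
      ultimately show "\<exists>t. 0 \<le> t \<and> t < 1 \<and> \<xi> = t *\<^sub>R zeta \<alpha> i j" using eq by auto
    qed
  qed
  have nz: "zeta \<alpha> i j \<noteq> 0" if ij: "i \<noteq> j" for i j
  proof
    assume z: "zeta \<alpha> i j = 0"
    obtain k where k: "UNIV = {i, j, k}" "i \<noteq> j" "k \<noteq> i" "k \<noteq> j"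
      using third_index[OF ij] ij by metis
    show False using zeta_coords(1)[OF k(2-4), where \<alpha> = \<alpha> and \<xi> = 0 and y = 1 and z = 0] z e assms by (auto simp: l0)
  qed
  have half: "\<xi> \<in> calL \<alpha> i j \<or> \<xi> = 0 \<longleftrightarrow> (\<exists>t. 0 \<le> t \<and> t < 1 \<and> \<xi> = t *\<^sub>R zeta \<alpha> i j)"
    if "i \<noteq> j" for \<xi> i j
  proof
    assume "\<xi> \<in> calL \<alpha> i j \<or> \<xi> = 0"
    then show "\<exists>t. 0 \<le> t \<and> t < 1 \<and> \<xi> = t *\<^sub>R zeta \<alpha> i j"
    proof
      assume "\<xi> \<in> calL \<alpha> i j"
      then obtain u where "0 < u" "u < 1" "\<xi> = (1 - u) *\<^sub>R 0 + u *\<^sub>R zeta \<alpha> i j"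
        unfolding calL_def in_segment by blast
      then show ?thesis by (intro exI[of _ u]) simp
    next
      assume "\<xi> = 0"
      then show ?thesis by (intro exI[of _ 0]) simp
    qed
  next
    assume "\<exists>t. 0 \<le> t \<and> t < 1 \<and> \<xi> = t *\<^sub>R zeta \<alpha> i j"
    then obtain t where t: "0 \<le> t" "t < 1" "\<xi> = t *\<^sub>R zeta \<alpha> i j" by blast
    show "\<xi> \<in> calL \<alpha> i j \<or> \<xi> = 0"
    proof (cases "t = 0")
      case True
      then show ?thesis using t by simp
    next
      case False
      then have "\<xi> \<in> calL \<alpha> i j"
        unfolding calL_def in_segment using t nz[OF that] by (intro conjI exI[of _ t]) simp_all
      then show ?thesis by blast
    qed
  qed
  have pairs: "(\<exists>i j. i \<noteq> j \<and> (\<xi> \<in> calL \<alpha> i j \<or> \<xi> = 0)) \<longleftrightarrow> \<xi> \<in> (\<Union>(i, j)\<in>S1. calL \<alpha> i j) \<union> {0}" for \<xi>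
  proof
    assume "\<exists>i j. i \<noteq> j \<and> (\<xi> \<in> calL \<alpha> i j \<or> \<xi> = 0)"
    then obtain i j where ij: "i \<noteq> j" "\<xi> \<in> calL \<alpha> i j \<or> \<xi> = 0" by blast
    moreover have "calL \<alpha> i j = calL \<alpha> j i" unfolding calL_def by (simp add: zeta_commute)
    moreover have "(i, j) \<in> S1 \<or> (j, i) \<in> S1"
      using ij(1) exhaust_3[of i] exhaust_3[of j] unfolding S1_def by auto
    ultimately show "\<xi> \<in> (\<Union>(i, j)\<in>S1. calL \<alpha> i j) \<union> {0}" by blast
  next
    assume x: "\<xi> \<in> (\<Union>(i, j)\<in>S1. calL \<alpha> i j) \<union> {0}"
    have "i \<noteq> j" if "(i, j) \<in> S1" for i j using that unfolding S1_def by auto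
    moreover have "(2::3) \<noteq> 3" by simp
    ultimately show "\<exists>i j. i \<noteq> j \<and> (\<xi> \<in> calL \<alpha> i j \<or> \<xi> = 0)" using x by blast
  qed
  have "\<xi> \<in> calL \<alpha> i j \<or> \<xi> = 0 \<longleftrightarrow>
    lift \<xi> $ i = lift \<xi> $ j \<and> (\<forall>k. lift \<xi> $ k \<le> lift \<xi> $ i) \<and> 3 * lift \<xi> $ i < 1 + e"
    if "i \<noteq> j" for \<xi> i j
    unfolding half[OF that] tie[OF that] ..
  then have "bTie \<alpha> (lift \<xi>) \<longleftrightarrow> (\<exists>i j. i \<noteq> j \<and> (\<xi> \<in> calL \<alpha> i j \<or> \<xi> = 0))" for \<xi>
    unfolding bTie_lift[OF assms] e_def[symmetric] by blast
  then show ?thesis unfolding pairs by blast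
qed

context gasket
begin

lemma gasket_cones:
  assumes "0 < l" "l < lambda1D p"
  shows "calA p l = calC p l" "calC p l = Affine ` calD (psi_inv l)"
    "calB p l = Affine ` ((\<Union>(i, j)\<in>S1. calL (psi_inv l) i j) \<union> {0})"
    "calT p l i -` calA p (l / 5) = Affine ` calG (psi_inv l) i"
proof -
  obtain \<alpha> where \<alpha>: "0 \<le> \<alpha>" "\<alpha> < 6" "psi \<alpha> = l"
    using psi_surj[of l] assms lambda1D_eq by auto
  then have pos: "0 < \<alpha>" using assms(1) by (cases "\<alpha> = 0") auto
  have inv: "psi_inv l = \<alpha>" using psi_inv_psi[of \<alpha>] pos \<alpha> by simp
  have A: "coneA p (psi \<beta>) = {a. sameSign \<beta> a}" if "0 < \<beta>" "\<beta> < 6" for \<beta>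
    using coneA_eq[OF that] by (simp add: sameSign_def)
  have C: "coneC p l = {a. sameSign \<alpha> a}"
    using coneC_eq[OF pos \<alpha>(2)] by (simp add: sameSign_def \<alpha>(3))
  show "calA p l = calC p l"
    unfolding calA_def calC_def C using A[OF pos \<alpha>(2)] \<alpha>(3) by simp
  show "calC p l = Affine ` calD (psi_inv l)"
    unfolding calC_def C inv proj_cone[OF cone_sameSign[OF pos]] sameSign_calD[OF pos \<alpha>(2)] ..
  have "coneB p l = {a. bTie \<alpha> a}"
    using coneB_eq[OF pos \<alpha>(2)] by (simp add: bTie_def \<alpha>(3))
  then show "calB p l = Affine ` ((\<Union>(i, j)\<in>S1. calL (psi_inv l) i j) \<union> {0})"
    unfolding calB_def inv using proj_cone[OF cone_bTie[OF pos]] bTie_calL[OF pos \<alpha>(2)] by simp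
  let ?b = "phi_m1 \<alpha>"
  have b: "0 < ?b" "?b < 6" using phi_pos[OF pos] phi_range[OF \<alpha>(1,2)] by auto
  have lb: "l / 5 = psi ?b" using psi_phi[of \<alpha>] \<alpha> by simp
  \<comment> \<open>The chosen representative enters only through a condition invariant under
    scaling, so \<open>proj_in_cone\<close> eliminates the choice.\<close>
  let ?r = "\<lambda>x. inv_into (- {0}) proj x"
  have 1: "calT p l i x \<in> calA p (l / 5) \<longleftrightarrow> topCorner \<alpha> i (?r x)" for x
  proof -
    have "calT p l i x = proj (tstep ?b i (?r x))"
      unfolding calT_def using mapT_eq[OF \<alpha>(1,2)] \<alpha>(3) by simp
    then show ?thesis
      unfolding calA_def lb A[OF b] topCorner_def using proj_in_cone[OF cone_sameSign[OF b(1)]] by simp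
  qed
  have 2: "topCorner \<alpha> i (?r x) \<longleftrightarrow> x \<in> proj ` {a. topCorner \<alpha> i a}" for x
    using proj_in_cone[OF cone_topCorner[OF pos \<alpha>(2)], of "?r x"] by (simp only: inv_proj)
  have 3: "proj ` {a. topCorner \<alpha> i a} = Affine ` calG (psi_inv l) i"
    unfolding proj_cone[OF cone_topCorner[OF pos \<alpha>(2)]] topCorner_calG[OF pos \<alpha>(2)] inv ..
  show "calT p l i -` calA p (l / 5) = Affine ` calG (psi_inv l) i"
    unfolding vimage_def 1 2 3 Collect_mem_eq ..
qed

end

theorem theorem3p4:
  fixes p :: "3 \<Rightarrow> real^2"
  assumes "equilateral p"
  shows "(\<forall>l. 0 < l \<and> l < lambda1D p \<longrightarrow>
            calA p l = calC p l \<and>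
            calC p l = Affine ` calD (psi_inv l) \<and>
            calB p l = Affine ` ((\<Union>(i, j)\<in>S1. calL (psi_inv l) i j) \<union> {0}) \<and>
            (\<forall>i. calT p l i -` calA p (l / 5) = Affine ` calG (psi_inv l) i))
       \<and> (\<exists>l0>0. \<forall>l u. 0 \<le> l \<and> l < l0 \<and> eigenfunction p l u \<longrightarrow>
            finite (Extr p u) \<and> card (Extr p u) \<le> 1)"
proof -
  interpret gasket p by (rule gasket.intro[OF assms])
  have "0 < psi 6" by (rule psi_pos) auto
  \<comment> \<open>The bound is taken to be \<open>psi 6\<close>, the first Dirichlet eigenvalue
    itself.\<close>
  have "\<exists>l0>0. \<forall>l u. 0 \<le> l \<and> l < l0 \<and> eigenfunction p l u \<longrightarrow>
      finite (Extr p u) \<and> card (Extr p u) \<le> 1"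
    using \<open>0 < psi 6\<close> eigenfunction_Extr by (intro exI[of _ "psi 6"]) blast
  with gasket_cones show ?thesis by (intro conjI allI impI) (elim conjE; simp only:)+
qed

end
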